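(* Let $\nu>0$. There exists a divergence-free vector field $\mathbf{u}\in C_0^\infty(\mathbb{R}^3\times[0,\infty);\mathbb{R}^3)$ such that, if $\mathbf{A}^N:\mathbb{R}^3\times[0,\infty)\to\mathbb{R}^3$ is a smooth solution of $$\frac{\partial \mathbf{A}^N}{\partial t}+\mathbf{u}\cdot\nabla\mathbf{A}^N-\nu\Delta\mathbf{A}^N=\mathbf{0}\quad\text{in }\mathbb{R}^3\times(0,\infty),\qquad \mathbf{A}^N(\mathbf{x},0)=\mathbf{x}\quad\text{for }\mathbf{x}\in\mathbb{R}^3,$$ then there exists $t>0$ such that both of the following hold. (a) The map $\mathbf{A}^N(\cdot,t)$ does not have a smooth inverse at the origin, i.e. there is no open neighbourhood $U$ of $\mathbf{0}$ such that $\mathbf{A}^N(\cdot,t)$ is a bijection of $U$ onto an open set with $C^\infty$ inverse. (b) $\limsup_{\tau\to t^-}\|\mathbf{Q}(\cdot,\tau)\|_{L^\infty(\mathbb{R}^3)}=\infty$, whenever $\mathbf{Q}$ is a smooth matrix-valued solution on $\mathbb{R}^3\times[0,t)$ of $$\frac{\partial \mathbf{Q}}{\partial t}+\mathbf{u}\cdot\nabla\mathbf{Q}-\nu\Delta\mathbf{Q}=(\nabla\mathbf{u})\mathbf{Q}+2\nu\sum_{k=1}^3\mathbf{Q}\,\partial_k(\nabla\mathbf{A}^N)\,\partial_k\mathbf{Q}\quad\text{in }\mathbb{R}^3\times(0,t),\qquad \mathbf{Q}(\mathbf{x},0)=\mathbf{I}.$$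
   Context: $C_0^\infty(\mathbb{R}^3\times[0,\infty))$ denotes smooth functions with compact support in $\mathbb{R}^3\times[0,\infty)$; divergence free means $\sum_i\partial u_i/\partial x_i=0$ at every time. $\mathbf{I}$ is the $3\times3$ identity matrix, and $\mathbf{Q}$ takes values in real $3\times3$ matrices. For a vector field $\mathbf{v}$, $\nabla\mathbf{v}$ is the matrix with entries $(\nabla\mathbf{v})_{ij}=\partial v_i/\partial x_j$. The operator $\frac{\partial}{\partial t}+\mathbf{u}\cdot\nabla-\nu\Delta$, where $\mathbf{u}\cdot\nabla=\sum_j u_j\partial/\partial x_j$, acts componentwise on vectors and matrices; $\partial_k=\partial/\partial x_k$, and products of matrices are matrix products. A smooth solution $\mathbf{A}^N$ is understood to be one that is $C^\infty$ on $\mathbb{R}^3\times(0,\infty)$, continuous on $\mathbb{R}^3\times[0,\infty)$, and satisfies, for every $T>0$ and every $k\ge2$, $\mathbf{A}^N-\mathbf{x}\in L^2((0,T);W^{k,2}(\mathbb{R}^3))$ and $\partial\mathbf{A}^N/\partial t\in L^2((0,T);W^{k-2,2}(\mathbb{R}^3))$ (in this class the solution exists and is unique). A smooth solution $\mathbf{Q}$ on $\mathbb{R}^3\times[0,t)$ is understood to have $\mathbf{Q}$ and $\nabla\mathbf{Q}$ bounded on $\mathbb{R}^3\times[0,t']$ for every $t'<t$. *)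

theory Defs
  imports "HOL-Analysis.Analysis" "HOL-Probability.Essential_Supremum"
begin

text \<open>
  Space-time functions take pairs \<open>(x, t)\<close> with \<open>x\<close> in \<open>real ^ 3\<close> and \<open>t\<close> a real number.  They are
  total in \<open>t\<close>; values at times outside the interval under consideration are irrelevant.
\<close>

text \<open>
  On open sets this is the usual notion.  On \<open>UNIV \<times> {0..}\<close> the derivatives are relative to the set,
  hence one-sided in time at \<open>t = 0\<close>: all derivatives exist and are continuous up to the boundary.
  The definition is only meant for sets on which the derivative is unique, such as these.
\<close>

fun C_k_on :: "nat \<Rightarrow> 'a set \<Rightarrow> ('a::euclidean_space \<Rightarrow> 'b::real_normed_vector) \<Rightarrow> bool" where
  "C_k_on 0 S f \<longleftrightarrow> continuous_on S f"
| "C_k_on (Suc k) S f \<longleftrightarrow>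
     f differentiable_on S \<and>
     (\<forall>b\<in>Basis. C_k_on k S (\<lambda>z. frechet_derivative f (at z within S) b))"

definition smooth_on :: "'a set \<Rightarrow> ('a::euclidean_space \<Rightarrow> 'b::real_normed_vector) \<Rightarrow> bool" where
  "smooth_on S f \<longleftrightarrow> (\<forall>k. C_k_on k S f)"

definition C0_infinity :: "((real ^ 3) \<times> real \<Rightarrow> 'b::real_normed_vector) \<Rightarrow> bool" where
  "C0_infinity f \<longleftrightarrow>
     smooth_on (UNIV \<times> {0..}) f \<and>
     (\<exists>K. compact K \<and> K \<subseteq> UNIV \<times> {0..} \<and> (\<forall>z \<in> UNIV \<times> {0..} - K. f z = 0))"

definition partial :: "3 \<Rightarrow> (real ^ 3 \<Rightarrow> 'b::real_normed_vector) \<Rightarrow> real ^ 3 \<Rightarrow> 'b" where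
  "partial k f x = vector_derivative (\<lambda>h. f (x + h *\<^sub>R axis k 1)) (at 0)"

definition dx :: "3 \<Rightarrow> ((real ^ 3) \<times> real \<Rightarrow> 'b::real_normed_vector) \<Rightarrow> (real ^ 3) \<times> real \<Rightarrow> 'b" where
  "dx k f = (\<lambda>(x, t). partial k (\<lambda>y. f (y, t)) x)"

definition dt :: "((real ^ 3) \<times> real \<Rightarrow> 'b::real_normed_vector) \<Rightarrow> (real ^ 3) \<times> real \<Rightarrow> 'b" where
  "dt f = (\<lambda>(x, t). vector_derivative (\<lambda>s. f (x, s)) (at t))"

definition grad :: "((real ^ 3) \<times> real \<Rightarrow> real ^ 3) \<Rightarrow> (real ^ 3) \<times> real \<Rightarrow> real ^ 3 ^ 3" where
  "grad v z = (\<chi> i j. dx j v z $ i)"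

definition divergence_free :: "((real ^ 3) \<times> real \<Rightarrow> real ^ 3) \<Rightarrow> bool" where
  "divergence_free u \<longleftrightarrow> (\<forall>t\<ge>0. \<forall>x. (\<Sum>i\<in>UNIV. dx i u (x, t) $ i) = 0)"

definition transport_diffusion ::
    "real \<Rightarrow> ((real ^ 3) \<times> real \<Rightarrow> real ^ 3) \<Rightarrow> ((real ^ 3) \<times> real \<Rightarrow> 'b::real_normed_vector)
      \<Rightarrow> (real ^ 3) \<times> real \<Rightarrow> 'b" where
  "transport_diffusion \<nu> u f z =
     dt f z + (\<Sum>j\<in>UNIV. (u z $ j) *\<^sub>R dx j f z) - \<nu> *\<^sub>R (\<Sum>k\<in>UNIV. dx k (dx k f) z)"

text \<open>Multi-indices are functions on the index type \<open>3\<close>, in which \<open>3 = 0\<close>.\<close>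

definition multi_partial ::
    "(3 \<Rightarrow> nat) \<Rightarrow> (real ^ 3 \<Rightarrow> 'b::real_normed_vector) \<Rightarrow> real ^ 3 \<Rightarrow> 'b" where
  "multi_partial \<alpha> f =
     (partial 1 ^^ \<alpha> 1) ((partial 2 ^^ \<alpha> 2) ((partial 3 ^^ \<alpha> 3) f))"

definition multi_order :: "(3 \<Rightarrow> nat) \<Rightarrow> nat" where
  "multi_order \<alpha> = (\<Sum>i\<in>UNIV. \<alpha> i)"

definition test_function :: "(real ^ 3 \<Rightarrow> real) \<Rightarrow> bool" where
  "test_function \<phi> \<longleftrightarrow> smooth_on UNIV \<phi> \<and> compact (closure {x. \<phi> x \<noteq> 0})"

definition locally_integrable :: "(real ^ 3 \<Rightarrow> 'b::euclidean_space) \<Rightarrow> bool" where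
  "locally_integrable f \<longleftrightarrow> (\<forall>K. compact K \<longrightarrow> set_integrable lborel K f)"

definition weak_derivative ::
    "(3 \<Rightarrow> nat) \<Rightarrow> (real ^ 3 \<Rightarrow> 'b::euclidean_space) \<Rightarrow> (real ^ 3 \<Rightarrow> 'b) \<Rightarrow> bool" where
  "weak_derivative \<alpha> f g \<longleftrightarrow>
     locally_integrable f \<and> locally_integrable g \<and>
     (\<forall>\<phi>. test_function \<phi> \<longrightarrow>
        (\<integral>x. multi_partial \<alpha> \<phi> x *\<^sub>R f x \<partial>lborel) =
        (- 1) ^ multi_order \<alpha> *\<^sub>R (\<integral>x. \<phi> x *\<^sub>R g x \<partial>lborel))"

definition square_integrable :: "(real ^ 3 \<Rightarrow> 'b::euclidean_space) \<Rightarrow> bool" where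
  "square_integrable f \<longleftrightarrow>
     f \<in> borel_measurable lborel \<and> integrable lborel (\<lambda>x. (norm (f x))\<^sup>2)"

text \<open>\<open>W2 k f\<close> says that \<open>f\<close> represents an element of \<open>W\<^bsup>k,2\<^esup>\<close>.\<close>

definition W2 :: "nat \<Rightarrow> (real ^ 3 \<Rightarrow> 'b::euclidean_space) \<Rightarrow> bool" where
  "W2 k f \<longleftrightarrow>
     square_integrable f \<and>
     (\<forall>\<alpha>. multi_order \<alpha> \<le> k \<longrightarrow> (\<exists>g. square_integrable g \<and> weak_derivative \<alpha> f g))"

text \<open>Weak derivatives are unique up to null sets, so the choice below is immaterial.\<close>

definition W2_norm :: "nat \<Rightarrow> (real ^ 3 \<Rightarrow> 'b::euclidean_space) \<Rightarrow> real" where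
  "W2_norm k f =
     sqrt (\<Sum>\<alpha> | multi_order \<alpha> \<le> k. \<integral>x. (norm ((SOME g. weak_derivative \<alpha> f g) x))\<^sup>2 \<partial>lborel)"

text \<open>
  The Bochner space \<open>L\<^sup>2((0,T); W\<^bsup>k,2\<^esup>)\<close>.  Since the values are representatives rather than elements
  of a normed space type, strong measurability (being an almost everywhere limit of simple
  functions) is spelled out.
\<close>

definition L2_W2 :: "real \<Rightarrow> nat \<Rightarrow> (real \<Rightarrow> real ^ 3 \<Rightarrow> 'b::euclidean_space) \<Rightarrow> bool" where
  "L2_W2 T k w \<longleftrightarrow>
     (let M = restrict_space lborel {0<..<T} in
       (AE t in M. W2 k (w t)) \<and>
       (\<exists>s. (\<forall>n. simple_function M (s n) \<and> (\<forall>t\<in>space M. W2 k (s n t))) \<and>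
            (AE t in M. (\<lambda>n. W2_norm k (\<lambda>x. s n t x - w t x)) \<longlonglongrightarrow> 0)) \<and>
       (\<integral>\<^sup>+ t. ennreal ((W2_norm k (w t))\<^sup>2) \<partial>M) < \<infinity>)"

definition smooth_solution_A ::
    "real \<Rightarrow> ((real ^ 3) \<times> real \<Rightarrow> real ^ 3) \<Rightarrow> ((real ^ 3) \<times> real \<Rightarrow> real ^ 3) \<Rightarrow> bool" where
  "smooth_solution_A \<nu> u A \<longleftrightarrow>
     smooth_on (UNIV \<times> {0<..}) A \<and>
     continuous_on (UNIV \<times> {0..}) A \<and>
     (\<forall>T>0. \<forall>k\<ge>2. L2_W2 T k (\<lambda>t x. A (x, t) - x) \<and>
                   L2_W2 T (k - 2) (\<lambda>t x. dt A (x, t))) \<and>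
     (\<forall>x. \<forall>t>0. transport_diffusion \<nu> u A (x, t) = 0) \<and>
     (\<forall>x. A (x, 0) = x)"

text \<open>
  As for the first problem, smoothness is required in the open time interval and continuity up to
  the initial time.
\<close>

definition smooth_solution_Q ::
    "real \<Rightarrow> ((real ^ 3) \<times> real \<Rightarrow> real ^ 3) \<Rightarrow> ((real ^ 3) \<times> real \<Rightarrow> real ^ 3) \<Rightarrow> real
      \<Rightarrow> ((real ^ 3) \<times> real \<Rightarrow> real ^ 3 ^ 3) \<Rightarrow> bool" where
  "smooth_solution_Q \<nu> u A t Q \<longleftrightarrow>
     smooth_on (UNIV \<times> {0<..<t}) Q \<and>
     continuous_on (UNIV \<times> {0..<t}) Q \<and>
     (\<forall>t'<t. bounded (Q ` (UNIV \<times> {0..t'})) \<and>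
             (\<forall>k. bounded (dx k Q ` (UNIV \<times> {0..t'})))) \<and>
     (\<forall>x. \<forall>\<tau>\<in>{0<..<t}.
        transport_diffusion \<nu> u Q (x, \<tau>) =
          grad u (x, \<tau>) ** Q (x, \<tau>)
          + (2 * \<nu>) *\<^sub>R (\<Sum>k\<in>UNIV. Q (x, \<tau>) ** dx k (grad A) (x, \<tau>) ** dx k Q (x, \<tau>))) \<and>
     (\<forall>x. Q (x, 0) = mat 1)"

definition smoothly_invertible_at_origin :: "(real ^ 3 \<Rightarrow> real ^ 3) \<Rightarrow> bool" where
  "smoothly_invertible_at_origin f \<longleftrightarrow>
     (\<exists>U V. open U \<and> 0 \<in> U \<and> open V \<and> bij_betw f U V \<and> smooth_on V (inv_into U f))"

definition Linfty_norm :: "(real ^ 3 \<Rightarrow> 'b::real_normed_vector) \<Rightarrow> ereal" where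
  "Linfty_norm f = esssup lborel (\<lambda>x. ereal (norm (f x)))"

end

theory Submission
  imports Defs
begin

text \<open>
  Write \<open>G\<close> for the gradient of \<open>A\<close>.  At time \<open>0\<close> it is the identity matrix.  The proof produces a field
  \<open>u\<close> for which \<open>det (G (0, 4)) < 0\<close>; by continuity \<open>det (G (0, t)) = 0\<close> for some \<open>t > 0\<close>, and this \<open>t\<close>
  has both properties of the theorem.  A differentiable inverse of \<open>A (_, t)\<close> near the origin would make
  \<open>G (0, t)\<close> invertible by the chain rule (\<open>not_smoothly_invertible\<close>).  The equation for \<open>Q\<close> is made so
  that \<open>Z = G Q - I\<close> solves \<open>L Z = 2 \<nu> Z M\<close>, where \<open>L\<close> is the transport-diffusion operator and \<open>M\<close> is
  built from the first derivatives of \<open>G\<close> and \<open>Q\<close>; as \<open>M\<close> is bounded before time \<open>t\<close>, the maximum principle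
  gives \<open>Z = 0\<close> (\<open>Z_zero\<close>), hence \<open>det G * det Q = 1\<close>, and \<open>Q\<close> cannot stay bounded as \<open>det G\<close> tends to
  \<open>0\<close> (\<open>blow_up\<close>).

  For \<open>\<nu> = 0\<close> the map \<open>A (_, t)\<close> preserves volume and \<open>det G = 1\<close> for all times, so the sign change has
  to come from diffusion.  In the ball of radius \<open>R\<close> the field is, with \<open>x\<close> and \<open>y\<close> the first two
  coordinates, the succession of two shears
  \<open>u = (- amp * alpha t * cos y, \<epsilon> * beta t * (sin x + cos x), 0)\<close>: the first one, of large amplitude, acts
  for \<open>2 \<le> t \<le> 3\<close>, the second one, of small amplitude \<open>\<epsilon>\<close>, acts for \<open>3 \<le> t \<le> 4\<close>.  The profiles in \<open>x\<close> and
  \<open>y\<close> are eigenfunctions of the Laplacian, which allows one to solve the equation for \<open>A\<close> explicitly up to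
  second order in \<open>\<epsilon>\<close>.  The result \<open>app\<close> has gradient determinant \<open>1 + amp * \<epsilon>^2 * E 4\<close> at \<open>(0, 4)\<close>, where
  \<open>E\<close> compares the product of the two off-diagonal entries with the amplitude of the mode
  \<open>cos y * sin (2 x)\<close> which transport creates from them.  The two quantities would cancel without diffusion;
  but they are damped at different rates, and \<open>E 4 > 0\<close> (\<open>kappa_pos\<close>).  With \<open>amp = - 2 / (kappa * \<epsilon>^2)\<close>,
  where \<open>kappa = E 4\<close>, the determinant is \<open>-1\<close> for every \<open>\<epsilon>\<close>.

  It remains to see that \<open>A\<close> and \<open>app\<close> have nearly the same gradient at \<open>(0, 4)\<close>.  Their difference \<open>D\<close>
  satisfies \<open>L D = 0\<close> in the ball of radius \<open>R\<close>, except for a first component of size \<open>\<epsilon>\<close>.  It is small in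
  the unit ball by comparison with a multiple of \<open>|x|^2 / R^2\<close> (\<open>local_comparison\<close>), where \<open>R\<close>, the radius
  at which the field is cut off, is chosen after \<open>\<epsilon>\<close>; and its gradient is small by an interior estimate of
  Bernstein type (\<open>bernstein\<close>, \<open>gradient_estimate\<close>).  The entry of order \<open>1 / \<epsilon>\<close> in the first row is
  harmless, because the errors in the other rows are of order \<open>\<epsilon>^2\<close> (\<open>det_negative\<close>).

  All this requires a priori control of \<open>A\<close>, of which only integrability properties of \<open>A - x\<close> are given.  An
  energy argument (\<open>energy_max_principle\<close>) yields a maximum principle in this class, hence \<open>A = x\<close> as long as
  \<open>u\<close> vanishes, which is for \<open>t < 2\<close>, and \<open>|A - x| \<le> U t\<close> afterwards.  Interior estimates then bound the
  first and second derivatives of \<open>A\<close>.  That the field is switched on only at time \<open>2\<close> leaves room for these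
  estimates: they look back one unit of time.
\<close>

section \<open>Calculus of smooth functions on sets\<close>

declare C_k_on.simps(2) [simp del]

text \<open>
  A set of this kind contains, arbitrarily close to each of its points, further points in every coordinate
  direction.  This makes the derivative relative to the set unique, and it covers open sets as well as the
  closed half space of nonnegative times.
\<close>

definition diff_unique :: "'a::euclidean_space set \<Rightarrow> bool" where
  "diff_unique S \<longleftrightarrow> (\<forall>z\<in>S. \<forall>i\<in>Basis. \<forall>e>0. \<exists>d. 0 < \<bar>d\<bar> \<and> \<bar>d\<bar> < e \<and> z + d *\<^sub>R i \<in> S)"

lemma diff_unique_open:
  assumes "open S" shows "diff_unique S"
  unfolding diff_unique_def
proof (intro ballI allI impI)
  fix z and i :: 'a and e :: real assume z: "z \<in> S" and i: "i \<in> Basis" and e: "e > 0"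
  obtain r where r: "r > 0" "ball z r \<subseteq> S" using assms z openE by blast
  define d where "d = min e r / 2"
  have d: "0 < d" "d < e" "d < r" using r(1) e by (auto simp: d_def min_def field_simps)
  have "z + d *\<^sub>R i \<in> ball z r" using d i by (simp add: dist_norm)
  then have "z + d *\<^sub>R i \<in> S" using r(2) by blast
  then show "\<exists>d. 0 < \<bar>d\<bar> \<and> \<bar>d\<bar> < e \<and> z + d *\<^sub>R i \<in> S"
    using d by (intro exI[of _ d]) simp
qed

lemma diff_unique_half: "diff_unique ((UNIV::(real^3) set) \<times> {0::real..})"
  unfolding diff_unique_def
proof (intro ballI allI impI)
  fix z i :: "(real^3) \<times> real" and e :: real
  assume z: "z \<in> UNIV \<times> {0..}" and i: "i \<in> Basis" and e: "e > 0"
  have "snd i \<ge> 0" using i by (auto simp: Basis_prod_def)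
  then show "\<exists>d. 0 < \<bar>d\<bar> \<and> \<bar>d\<bar> < e \<and> z + d *\<^sub>R i \<in> UNIV \<times> {0..}"
    using z e by (intro exI[of _ "e/2"]) (simp add: mem_Times_iff)
qed

lemma frechet_derivative_eqI:
  assumes "diff_unique S" "z \<in> S" "(f has_derivative f') (at z within S)"
  shows "frechet_derivative f (at z within S) = f'"
proof (rule frechet_derivative_unique_within[symmetric])
  show "(f has_derivative f') (at z within S)" by fact
  show "(f has_derivative frechet_derivative f (at z within S)) (at z within S)"
    using assms(3) frechet_derivative_works differentiableI by blast
  show "\<exists>d. 0 < \<bar>d\<bar> \<and> \<bar>d\<bar> < e \<and> z + d *\<^sub>R i \<in> S" if "i \<in> Basis" "0 < e" for i e
    using assms(1,2) that unfolding diff_unique_def by blast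
qed

lemma C_k_on_cong:
  assumes "\<And>z. z \<in> S \<Longrightarrow> f z = g z"
  shows "C_k_on k S f \<longleftrightarrow> C_k_on k S g"
  using assms
proof (induction k arbitrary: f g)
  case 0 then show ?case using continuous_on_cong[of S S f g] by simp
next
  case (Suc k)
  have hd: "(f has_derivative f') (at z within S) \<longleftrightarrow> (g has_derivative f') (at z within S)" if "z \<in> S" for z f'
  proof
    assume "(f has_derivative f') (at z within S)"
    then show "(g has_derivative f') (at z within S)"
      by (rule has_derivative_transform[OF that, rotated]) (simp add: Suc.prems)
  next
    assume "(g has_derivative f') (at z within S)"
    then show "(f has_derivative f') (at z within S)"
      by (rule has_derivative_transform[OF that, rotated]) (simp add: Suc.prems)
  qed
  have fd: "frechet_derivative f (at z within S) = frechet_derivative g (at z within S)" if "z \<in> S" for z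
    unfolding frechet_derivative_def hd[OF that] ..
  have "f differentiable_on S \<longleftrightarrow> g differentiable_on S"
    unfolding differentiable_on_def differentiable_def using hd by blast
  moreover have "C_k_on k S (\<lambda>z. frechet_derivative f (at z within S) b) \<longleftrightarrow>
    C_k_on k S (\<lambda>z. frechet_derivative g (at z within S) b)" for b
    by (rule Suc.IH) (simp add: fd)
  ultimately show ?case by (simp add: C_k_on.simps(2))
qed

text \<open>
  Smoothness is proved from any derivative that one can exhibit; the definition speaks of the one chosen by
  \<open>frechet_derivative\<close>, which agrees by uniqueness.
\<close>

lemma C_k_on_SucI:
  assumes "diff_unique S" "\<And>z. z \<in> S \<Longrightarrow> (f has_derivative f' z) (at z within S)"
    "\<And>b. b \<in> Basis \<Longrightarrow> C_k_on k S (\<lambda>z. f' z b)"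
  shows "C_k_on (Suc k) S f"
proof -
  have "f differentiable_on S" using assms(2) by (auto simp: differentiable_on_def intro: differentiableI)
  moreover have "C_k_on k S (\<lambda>z. frechet_derivative f (at z within S) b)" if "b \<in> Basis" for b
    using assms(3)[OF that]
    by (subst C_k_on_cong[of _ _ "\<lambda>z. f' z b"]) (simp_all add: frechet_derivative_eqI[OF assms(1) _ assms(2)])
  ultimately show ?thesis by (simp add: C_k_on.simps(2))
qed

lemma C_k_on_SucD:
  assumes "C_k_on (Suc k) S f"
  shows "z \<in> S \<Longrightarrow> (f has_derivative frechet_derivative f (at z within S)) (at z within S)"
    "b \<in> Basis \<Longrightarrow> C_k_on k S (\<lambda>z. frechet_derivative f (at z within S) b)"
  using assms by (auto simp: C_k_on.simps(2) differentiable_on_def frechet_derivative_works)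

lemma C_k_on_lower: "C_k_on (Suc k) S f \<Longrightarrow> C_k_on k S f"
proof (induction k arbitrary: f)
  case 0 then show ?case by (auto simp: C_k_on.simps(2) intro: differentiable_imp_continuous_on)
next
  case (Suc k)
  show ?case using Suc.prems Suc.IH unfolding C_k_on.simps(2)[of "Suc k"] C_k_on.simps(2)[of k] by blast
qed

lemma C_k_on_const:
  assumes "diff_unique S" shows "C_k_on k S (\<lambda>z. c)"
proof (induction k arbitrary: c)
  case 0 show ?case by simp
next
  case (Suc k)
  have "((\<lambda>z. c) has_derivative (\<lambda>b. 0)) (at z within S)" for z by simp
  with Suc show ?case by (intro C_k_on_SucI[OF assms, where f'="\<lambda>z b. 0"])
qed

lemma C_k_on_linear:
  assumes "diff_unique S" "bounded_linear h"
  shows "C_k_on k S h"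
proof (cases k)
  case 0 then show ?thesis using assms by (simp add: linear_continuous_on)
next
  case (Suc m)
  show ?thesis unfolding Suc
    by (rule C_k_on_SucI[OF assms(1) bounded_linear_imp_has_derivative[OF assms(2)]]) (rule C_k_on_const[OF assms(1)])
qed

lemma C_k_on_bounded_linear:
  assumes "diff_unique S" "bounded_linear h" "C_k_on k S f"
  shows "C_k_on k S (\<lambda>z. h (f z))"
  using assms(3)
proof (induction k arbitrary: f)
  case 0 then show ?case using assms(2) by (simp add: bounded_linear.continuous_on)
next
  case (Suc k)
  show ?case
    by (rule C_k_on_SucI[OF assms(1) bounded_linear.has_derivative[OF assms(2) C_k_on_SucD(1)[OF Suc.prems]]])
      (auto intro!: Suc.IH C_k_on_SucD(2)[OF Suc.prems])
qed

lemma C_k_on_add: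
  assumes "diff_unique S" "C_k_on k S f" "C_k_on k S g"
  shows "C_k_on k S (\<lambda>z. f z + g z)"
  using assms(2,3)
proof (induction k arbitrary: f g)
  case 0 then show ?case by (simp add: continuous_on_add)
next
  case (Suc k)
  show ?case
    by (rule C_k_on_SucI[OF assms(1) has_derivative_add[OF C_k_on_SucD(1)[OF Suc.prems(1)] C_k_on_SucD(1)[OF Suc.prems(2)]]])
      (auto intro!: Suc.IH C_k_on_SucD(2)[OF Suc.prems(1)] C_k_on_SucD(2)[OF Suc.prems(2)])
qed

lemma C_k_on_mult:
  fixes f g :: "'a::euclidean_space \<Rightarrow> real"
  assumes "diff_unique S" "C_k_on k S f" "C_k_on k S g"
  shows "C_k_on k S (\<lambda>z. f z * g z)"
  using assms(2,3)
proof (induction k arbitrary: f g)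
  case 0 then show ?case by (simp add: continuous_on_mult)
next
  case (Suc k)
  show ?case
    by (rule C_k_on_SucI[OF assms(1) has_derivative_mult[OF C_k_on_SucD(1)[OF Suc.prems(1)] C_k_on_SucD(1)[OF Suc.prems(2)]]])
      (auto intro!: Suc.IH C_k_on_add assms(1) C_k_on_SucD(2)[OF Suc.prems(1)] C_k_on_SucD(2)[OF Suc.prems(2)]
          C_k_on_lower[OF Suc.prems(1)] C_k_on_lower[OF Suc.prems(2)])
qed

lemma C_k_on_compose:
  fixes f :: "real \<Rightarrow> real" and g :: "'a::euclidean_space \<Rightarrow> real"
  assumes "diff_unique S" "C_k_on k UNIV f" "C_k_on k S g"
  shows "C_k_on k S (\<lambda>z. f (g z))"
  using assms(2,3)
proof (induction k arbitrary: f g)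
  case 0 then show ?case using continuous_on_compose2[of UNIV f S g] by simp
next
  case (Suc k)
  let ?f' = "\<lambda>s. frechet_derivative f (at s) 1"
  have f': "(f has_derivative (\<lambda>h. ?f' s * h)) (at s)" for s
  proof -
    have *: "(f has_derivative frechet_derivative f (at s)) (at s)" using C_k_on_SucD(1)[OF Suc.prems(1), of s] by simp
    then interpret bounded_linear "frechet_derivative f (at s)" by (rule has_derivative_bounded_linear)
    have "frechet_derivative f (at s) h = ?f' s * h" for h
      using scaleR[of h 1] by (simp add: mult.commute)
    then have "frechet_derivative f (at s) = (\<lambda>h. ?f' s * h)" by (rule ext)
    with * show ?thesis by metis
  qed
  have "C_k_on k UNIV ?f'" using C_k_on_SucD(2)[OF Suc.prems(1), of 1] by simp
  then have "C_k_on k S (\<lambda>z. ?f' (g z))" by (rule Suc.IH[OF _ C_k_on_lower[OF Suc.prems(2)]])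
  then have *: "C_k_on k S (\<lambda>z. ?f' (g z) * frechet_derivative g (at z within S) b)" if "b \<in> Basis" for b
    by (rule C_k_on_mult[OF assms(1) _ C_k_on_SucD(2)[OF Suc.prems(2) that]])
  show ?case
    by (rule C_k_on_SucI[OF assms(1) has_derivative_compose[OF C_k_on_SucD(1)[OF Suc.prems(2)] f'] *])
qed

lemma C_k_on_restrict:
  assumes "diff_unique T" "T \<subseteq> S" "C_k_on k S f"
  shows "C_k_on k T f"
  using assms(3)
proof (induction k arbitrary: f)
  case 0 then show ?case using assms(2) continuous_on_subset by auto
next
  case (Suc k)
  have *: "(f has_derivative frechet_derivative f (at z within S)) (at z within T)" if "z \<in> T" for z
    using that assms(2) by (intro has_derivative_subset[OF C_k_on_SucD(1)[OF Suc.prems]]) auto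
  have **: "C_k_on k T (\<lambda>z. frechet_derivative f (at z within S) b)" if "b \<in> Basis" for b
    by (rule Suc.IH[OF C_k_on_SucD(2)[OF Suc.prems that]])
  show ?case
    by (rule C_k_on_SucI[OF assms(1) * **])
qed

lemma smooth_on_cong: "(\<And>z. z \<in> S \<Longrightarrow> f z = g z) \<Longrightarrow> smooth_on S f \<longleftrightarrow> smooth_on S g"
  using C_k_on_cong[of S f g] by (auto simp: smooth_on_def)

lemma smooth_on_const: "diff_unique S \<Longrightarrow> smooth_on S (\<lambda>z. c)"
  by (simp add: smooth_on_def C_k_on_const)

lemma smooth_on_linear: "diff_unique S \<Longrightarrow> bounded_linear h \<Longrightarrow> smooth_on S h"
  by (simp add: smooth_on_def C_k_on_linear)

lemma smooth_on_bounded_linear: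
  "diff_unique S \<Longrightarrow> bounded_linear h \<Longrightarrow> smooth_on S f \<Longrightarrow> smooth_on S (\<lambda>z. h (f z))"
  by (simp add: smooth_on_def C_k_on_bounded_linear)

lemma smooth_on_add:
  "diff_unique S \<Longrightarrow> smooth_on S f \<Longrightarrow> smooth_on S g \<Longrightarrow> smooth_on S (\<lambda>z. f z + g z)"
  by (simp add: smooth_on_def C_k_on_add)

lemma smooth_on_uminus: "diff_unique S \<Longrightarrow> smooth_on S f \<Longrightarrow> smooth_on S (\<lambda>z. - f z)"
  using smooth_on_bounded_linear[of S "\<lambda>x. - x"] bounded_linear_minus[OF bounded_linear_ident] by blast

lemma smooth_on_diff:
  "diff_unique S \<Longrightarrow> smooth_on S f \<Longrightarrow> smooth_on S g \<Longrightarrow> smooth_on S (\<lambda>z. f z - g z)"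
  using smooth_on_add[of S f "\<lambda>z. - g z"] smooth_on_uminus[of S g] by simp

lemma smooth_on_sum:
  "diff_unique S \<Longrightarrow> (\<And>i. i \<in> I \<Longrightarrow> smooth_on S (f i)) \<Longrightarrow> smooth_on S (\<lambda>z. \<Sum>i\<in>I. f i z)"
  by (induction I rule: infinite_finite_induct) (auto intro: smooth_on_add smooth_on_const)

lemma smooth_on_mult:
  fixes f g :: "'a::euclidean_space \<Rightarrow> real"
  shows "diff_unique S \<Longrightarrow> smooth_on S f \<Longrightarrow> smooth_on S g \<Longrightarrow> smooth_on S (\<lambda>z. f z * g z)"
  by (simp add: smooth_on_def C_k_on_mult)

lemma smooth_on_power:
  fixes f :: "'a::euclidean_space \<Rightarrow> real"
  shows "diff_unique S \<Longrightarrow> smooth_on S f \<Longrightarrow> smooth_on S (\<lambda>z. f z ^ n)"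
  by (induction n) (auto intro: smooth_on_mult smooth_on_const)

lemma smooth_on_prod:
  fixes f :: "'i \<Rightarrow> 'a::euclidean_space \<Rightarrow> real"
  shows "diff_unique S \<Longrightarrow> (\<And>i. i \<in> I \<Longrightarrow> smooth_on S (f i)) \<Longrightarrow> smooth_on S (\<lambda>z. \<Prod>i\<in>I. f i z)"
  by (induction I rule: infinite_finite_induct) (auto intro: smooth_on_mult smooth_on_const)

lemma smooth_on_compose:
  fixes f :: "real \<Rightarrow> real" and g :: "'a::euclidean_space \<Rightarrow> real"
  shows "diff_unique S \<Longrightarrow> smooth_on UNIV f \<Longrightarrow> smooth_on S g \<Longrightarrow> smooth_on S (\<lambda>z. f (g z))"
  by (simp add: smooth_on_def C_k_on_compose)

lemma smooth_on_nth: "diff_unique S \<Longrightarrow> smooth_on S f \<Longrightarrow> smooth_on S (\<lambda>z. f z $ i)"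
  using smooth_on_bounded_linear[OF _ bounded_linear_vec_nth] by blast

lemma smooth_on_scaleR_const:
  "diff_unique S \<Longrightarrow> smooth_on S f \<Longrightarrow> smooth_on S (\<lambda>z. f z *\<^sub>R v)"
  using smooth_on_bounded_linear[OF _ bounded_linear_scaleR_left] by blast

lemma smooth_on_coord: "diff_unique S \<Longrightarrow> smooth_on S (\<lambda>z. fst z $ i)"
  by (rule smooth_on_nth) (simp_all add: smooth_on_linear bounded_linear_fst)

lemma smooth_on_snd: "diff_unique S \<Longrightarrow> smooth_on S snd"
  by (simp_all add: smooth_on_linear bounded_linear_snd)

lemma smooth_on_restrict: "smooth_on S f \<Longrightarrow> diff_unique T \<Longrightarrow> T \<subseteq> S \<Longrightarrow> smooth_on T f"
  by (auto simp: smooth_on_def intro: C_k_on_restrict)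

lemma smooth_on_imp_continuous_on: "smooth_on S f \<Longrightarrow> continuous_on S f"
  unfolding smooth_on_def using C_k_on.simps(1) by blast

lemma smooth_on_has_derivative:
  "smooth_on S f \<Longrightarrow> open S \<Longrightarrow> z \<in> S \<Longrightarrow> (f has_derivative frechet_derivative f (at z)) (at z)"
  using C_k_on_SucD(1)[of 0 S f z] unfolding smooth_on_def by (metis at_within_open)

lemma smooth_on_frechet:
  assumes "smooth_on S f" "open S" "b \<in> Basis"
  shows "smooth_on S (\<lambda>z. frechet_derivative f (at z) b)"
  unfolding smooth_on_def
proof
  fix k
  have eq: "frechet_derivative f (at z within S) b = frechet_derivative f (at z) b" if "z \<in> S" for z
    using at_within_open[OF that assms(2)] by simp
  have "C_k_on (Suc k) S f" using assms(1) unfolding smooth_on_def by (rule spec)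
  then have "C_k_on k S (\<lambda>z. frechet_derivative f (at z within S) b)" by (rule C_k_on_SucD(2)) fact
  then show "C_k_on k S (\<lambda>z. frechet_derivative f (at z) b)"
    by (simp only: C_k_on_cong[of S, OF eq])
qed

lemma smooth_on_realI:
  fixes f :: "real \<Rightarrow> real"
  assumes "\<And>x. (f has_real_derivative f' x) (at x)" "smooth_on UNIV f'"
  shows "smooth_on UNIV f"
  unfolding smooth_on_def
proof
  fix k
  have *: "C_k_on k UNIV (\<lambda>z. f' z * b)" if "b \<in> Basis" for b :: real
    using assms(2) that by (simp add: smooth_on_def)
  have "C_k_on (Suc k) UNIV f"
    by (rule C_k_on_SucI[OF diff_unique_open[OF open_UNIV] _ *, of f])
      (use assms(1) in \<open>auto simp: has_field_derivative_def\<close>)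
  then show "C_k_on k UNIV f" by (rule C_k_on_lower)
qed

section \<open>Mixed partial derivatives\<close>

text \<open>
  Two applications of the mean value theorem, one in each direction.  The left-hand side is symmetric in
  \<open>a\<close> and \<open>b\<close>, which gives the symmetry of second derivatives in the limit.
\<close>

lemma second_difference_mean_value:
  fixes f :: "'a::euclidean_space \<Rightarrow> real"
  defines "D \<equiv> \<lambda>b f z. frechet_derivative f (at z) b"
  assumes f: "smooth_on S f" and S: "open S" "ball z d \<subseteq> S" and ab: "a \<in> Basis" "b \<in> Basis" and h: "0 < h" "2 * h < d"
  shows "\<exists>w\<in>ball z d. f (z + h *\<^sub>R a + h *\<^sub>R b) - f (z + h *\<^sub>R a) - f (z + h *\<^sub>R b) + f z = h * (h * D b (D a f) w)"
proof -
  have D: "((\<lambda>s. g (y + s *\<^sub>R c)) has_real_derivative D c g (y + s *\<^sub>R c)) (at s)"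
    if "smooth_on S g" "y + s *\<^sub>R c \<in> S" for g y c s
  proof -
    have *: "(g has_derivative frechet_derivative g (at (y + s *\<^sub>R c))) (at (y + s *\<^sub>R c))"
      using smooth_on_has_derivative[OF that(1) S(1) that(2)] .
    then interpret bounded_linear "frechet_derivative g (at (y + s *\<^sub>R c))" by (rule has_derivative_bounded_linear)
    have i: "((\<lambda>s. y + s *\<^sub>R c) has_derivative (\<lambda>h. h *\<^sub>R c)) (at s)"
      using has_derivative_add[OF has_derivative_const[of y] has_derivative_scaleR_left[OF has_derivative_ident]] by simp
    have "((\<lambda>s. g (y + s *\<^sub>R c)) has_derivative (\<lambda>h. frechet_derivative g (at (y + s *\<^sub>R c)) (h *\<^sub>R c))) (at s)"
      using has_derivative_compose[OF i *] .
    moreover have "(\<lambda>h. frechet_derivative g (at (y + s *\<^sub>R c)) (h *\<^sub>R c)) = (*) (D c g (y + s *\<^sub>R c))"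
      unfolding D_def by (rule ext) (simp add: scaleR)
    ultimately show ?thesis unfolding has_field_derivative_def by metis
  qed
  have n: "norm (s *\<^sub>R a + r *\<^sub>R b) < d" if "0 \<le> s" "s \<le> h" "0 \<le> r" "r \<le> h" for s r
  proof -
    have "norm (s *\<^sub>R a + r *\<^sub>R b) \<le> s + r" using norm_triangle_ineq[of "s *\<^sub>R a" "r *\<^sub>R b"] ab that by simp
    then show ?thesis using that h by simp
  qed
  have inb: "z + s *\<^sub>R a + r *\<^sub>R b \<in> ball z d" if "0 \<le> s" "s \<le> h" "0 \<le> r" "r \<le> h" for s r
    using n[OF that] by (simp add: dist_norm add.assoc norm_minus_commute add.commute)
  then have inS: "z + s *\<^sub>R a + r *\<^sub>R b \<in> S" if "0 \<le> s" "s \<le> h" "0 \<le> r" "r \<le> h" for s r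
    using S(2) that by blast
  define \<phi> where "\<phi> = (\<lambda>s. f (z + s *\<^sub>R a + h *\<^sub>R b) - f (z + s *\<^sub>R a))"
  have "(\<phi> has_real_derivative D a f (z + s *\<^sub>R a + h *\<^sub>R b) - D a f (z + s *\<^sub>R a)) (at s)" if "0 \<le> s" "s \<le> h" for s
  proof -
    have "((\<lambda>s. f ((z + h *\<^sub>R b) + s *\<^sub>R a)) has_real_derivative D a f ((z + h *\<^sub>R b) + s *\<^sub>R a)) (at s)"
      using inS[OF that, of h] h by (intro D f) (simp_all add: algebra_simps)
    moreover have "((\<lambda>s. f (z + s *\<^sub>R a)) has_real_derivative D a f (z + s *\<^sub>R a)) (at s)"
      using inS[OF that, of 0] h by (intro D f) (simp_all add: algebra_simps)
    ultimately show ?thesis unfolding \<phi>_def by (auto intro!: derivative_eq_intros simp: algebra_simps)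
  qed
  then obtain s where s: "0 < s" "s < h" "\<phi> h - \<phi> 0 = (h - 0) * (D a f (z + s *\<^sub>R a + h *\<^sub>R b) - D a f (z + s *\<^sub>R a))"
    using MVT2[OF h(1), of \<phi> "\<lambda>s. D a f (z + s *\<^sub>R a + h *\<^sub>R b) - D a f (z + s *\<^sub>R a)"] by blast
  have Da: "smooth_on S (D a f)" unfolding D_def using smooth_on_frechet[OF f S(1) ab(1)] .
  have "((\<lambda>r. D a f (z + s *\<^sub>R a + r *\<^sub>R b)) has_real_derivative D b (D a f) (z + s *\<^sub>R a + r *\<^sub>R b)) (at r)"
    if "0 \<le> r" "r \<le> h" for r
    using inS[of s r] that s by (intro D Da) auto
  then obtain r where r: "0 < r" "r < h"
    "D a f (z + s *\<^sub>R a + h *\<^sub>R b) - D a f (z + s *\<^sub>R a + 0 *\<^sub>R b) = (h - 0) * D b (D a f) (z + s *\<^sub>R a + r *\<^sub>R b)"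
    using MVT2[OF h(1), of "\<lambda>r. D a f (z + s *\<^sub>R a + r *\<^sub>R b)" "\<lambda>r. D b (D a f) (z + s *\<^sub>R a + r *\<^sub>R b)"] by blast
  have "f (z + h *\<^sub>R a + h *\<^sub>R b) - f (z + h *\<^sub>R a) - f (z + h *\<^sub>R b) + f z = h * (h * D b (D a f) (z + s *\<^sub>R a + r *\<^sub>R b))"
    using s(3) r(3) by (simp add: \<phi>_def)
  with inb[of s r] s r show ?thesis by (intro bexI[of _ "z + s *\<^sub>R a + r *\<^sub>R b"]) auto
qed

lemma mixed_partials:
  fixes f :: "'a::euclidean_space \<Rightarrow> real"
  defines "D \<equiv> \<lambda>b f z. frechet_derivative f (at z) b"
  assumes f: "smooth_on S f" and S: "open S" "z \<in> S" and ab: "a \<in> Basis" "b \<in> Basis"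
  shows "D a (D b f) z = D b (D a f) z"
proof (rule ccontr)
  assume ne: "D a (D b f) z \<noteq> D b (D a f) z"
  define e where "e = \<bar>D a (D b f) z - D b (D a f) z\<bar> / 2"
  have e: "e > 0" using ne by (simp add: e_def)
  have sm: "smooth_on S (D c (D c' f))" if "c \<in> Basis" "c' \<in> Basis" for c c'
    unfolding D_def by (intro smooth_on_frechet f S that)
  have "isCont (D c (D c' f)) z" if "c \<in> Basis" "c' \<in> Basis" for c c'
    using smooth_on_imp_continuous_on[OF sm[OF that]] S by (simp add: continuous_on_eq_continuous_at)
  then have ev: "\<forall>\<^sub>F w in nhds z. dist (D c (D c' f) w) (D c (D c' f) z) < e" if "c \<in> Basis" "c' \<in> Basis" for c c'
    using that e by (metis isCont_def tendsto_at_iff_tendsto_nhds tendstoD)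
  have "\<forall>\<^sub>F w in nhds z. w \<in> S \<and> dist (D a (D b f) w) (D a (D b f) z) < e \<and> dist (D b (D a f) w) (D b (D a f) z) < e"
    using eventually_nhds_in_open[OF S] ev[OF ab] ev[OF ab(2,1)] by eventually_elim auto
  then obtain d where d: "d > 0" "\<And>w. dist w z < d \<Longrightarrow> w \<in> S \<and> dist (D a (D b f) w) (D a (D b f) z) < e \<and> dist (D b (D a f) w) (D b (D a f) z) < e"
    unfolding eventually_nhds_metric by blast
  have bS: "ball z d \<subseteq> S" using d(2) by (auto simp: dist_commute)
  define h where "h = d / 3"
  have h: "0 < h" "2 * h < d" using d(1) by (auto simp: h_def)
  obtain w1 where w1: "w1 \<in> ball z d" "f (z + h *\<^sub>R a + h *\<^sub>R b) - f (z + h *\<^sub>R a) - f (z + h *\<^sub>R b) + f z = h * (h * D b (D a f) w1)"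
    using second_difference_mean_value[OF f S(1) bS ab h] unfolding D_def by blast
  obtain w2 where w2: "w2 \<in> ball z d" "f (z + h *\<^sub>R b + h *\<^sub>R a) - f (z + h *\<^sub>R b) - f (z + h *\<^sub>R a) + f z = h * (h * D a (D b f) w2)"
    using second_difference_mean_value[OF f S(1) bS ab(2,1) h] unfolding D_def by blast
  have c: "z + h *\<^sub>R b + h *\<^sub>R a = z + h *\<^sub>R a + h *\<^sub>R b" by simp
  have "h * (h * D b (D a f) w1) = h * (h * D a (D b f) w2)" using w1(2) w2(2)[unfolded c] by linarith
  then have "D b (D a f) w1 = D a (D b f) w2" using h by simp
  with d(2)[of w1] d(2)[of w2] w1(1) w2(1) show False
    by (auto simp: e_def dist_real_def dist_commute abs_if split: if_splits)
qed

lemma axis_Basis: "(axis j 1, 0) \<in> (Basis :: ((real^3) \<times> real) set)" "(0, 1) \<in> (Basis :: ((real^3) \<times> real) set)"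
  by (auto simp: Basis_prod_def axis_in_Basis_iff)

section \<open>Derivatives in space and time\<close>

text \<open>
  The operators \<open>dx\<close> and \<open>dt\<close> are derivatives along coordinate lines.  For smooth functions on
  space times an open set of times they are the corresponding values of the Frechet derivative, so that they
  inherit smoothness and symmetry from it.
\<close>

locale strip =
  fixes I :: "real set"
  assumes open_I: "open I"
begin

abbreviation smooth :: "((real^3) \<times> real \<Rightarrow> 'b::real_normed_vector) \<Rightarrow> bool" where
  "smooth \<equiv> smooth_on (UNIV \<times> I)"

lemma open_strip: "open (UNIV \<times> I :: ((real^3) \<times> real) set)"
  using open_I by (simp add: open_Times)

lemmas du = diff_unique_open[OF open_strip]

lemma frechet_slice:
  assumes "smooth f" "t \<in> I"
  shows "((\<lambda>h. f (x + h *\<^sub>R axis j 1, t)) has_vector_derivative frechet_derivative f (at (x, t)) (axis j 1, 0)) (at 0)"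
    "((\<lambda>s. f (x, s)) has_vector_derivative frechet_derivative f (at (x, t)) (0, 1)) (at t)"
proof -
  have *: "(f has_derivative frechet_derivative f (at (x, t))) (at (x, t))"
    using smooth_on_has_derivative[OF assms(1) open_strip] assms(2) by simp
  then interpret bounded_linear "frechet_derivative f (at (x, t))" by (rule has_derivative_bounded_linear)
  have 1: "((\<lambda>h. f (x + h *\<^sub>R axis j 1, t)) has_derivative (\<lambda>h. frechet_derivative f (at (x, t)) (h *\<^sub>R axis j 1, 0))) (at 0)"
    by (rule has_derivative_compose[of "\<lambda>h. (x + h *\<^sub>R axis j 1, t)" _ _ _ f])
      (auto intro!: derivative_eq_intros simp: *)
  have "(\<lambda>h. frechet_derivative f (at (x, t)) (h *\<^sub>R axis j 1, 0)) = (\<lambda>h. h *\<^sub>R frechet_derivative f (at (x, t)) (axis j 1, 0))"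
    by (rule ext) (simp add: scaleR[symmetric])
  with 1 show "((\<lambda>h. f (x + h *\<^sub>R axis j 1, t)) has_vector_derivative frechet_derivative f (at (x, t)) (axis j 1, 0)) (at 0)"
    by (simp add: has_vector_derivative_def)
  have 1: "((\<lambda>s. f (x, s)) has_derivative (\<lambda>h. frechet_derivative f (at (x, t)) (0, h))) (at t)"
    by (rule has_derivative_compose[of "\<lambda>s. (x, s)" _ _ _ f])
      (auto intro!: derivative_eq_intros simp: *)
  have "(\<lambda>h. frechet_derivative f (at (x, t)) (0, h)) = (\<lambda>h. h *\<^sub>R frechet_derivative f (at (x, t)) (0, 1))"
    by (rule ext) (simp add: scaleR[symmetric])
  with 1 show "((\<lambda>s. f (x, s)) has_vector_derivative frechet_derivative f (at (x, t)) (0, 1)) (at t)"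
    by (simp add: has_vector_derivative_def)
qed

lemma dx_eq_frechet: "smooth f \<Longrightarrow> t \<in> I \<Longrightarrow> dx j f (x, t) = frechet_derivative f (at (x, t)) (axis j 1, 0)"
  using vector_derivative_at[OF frechet_slice(1)] by (simp add: dx_def partial_def)

lemma dt_eq_frechet: "smooth f \<Longrightarrow> t \<in> I \<Longrightarrow> dt f (x, t) = frechet_derivative f (at (x, t)) (0, 1)"
  using vector_derivative_at[OF frechet_slice(2)] by (simp add: dt_def)

lemma dx_vector: "smooth f \<Longrightarrow> t \<in> I \<Longrightarrow> ((\<lambda>h. f (x + h *\<^sub>R axis j 1, t)) has_vector_derivative dx j f (x, t)) (at 0)"
  using frechet_slice(1) dx_eq_frechet by metis

lemma dt_vector: "smooth f \<Longrightarrow> t \<in> I \<Longrightarrow> ((\<lambda>s. f (x, s)) has_vector_derivative dt f (x, t)) (at t)"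
  using frechet_slice(2) dt_eq_frechet by metis

lemma dx_real: "smooth f \<Longrightarrow> t \<in> I \<Longrightarrow> ((\<lambda>h. f (x + h *\<^sub>R axis j 1, t)) has_real_derivative dx j f (x, t)) (at 0)"
  using dx_vector by (simp add: has_real_derivative_iff_has_vector_derivative)

lemma dt_real: "smooth f \<Longrightarrow> t \<in> I \<Longrightarrow> ((\<lambda>s. f (x, s)) has_real_derivative dt f (x, t)) (at t)"
  using dt_vector by (simp add: has_real_derivative_iff_has_vector_derivative)

lemma dx_real_at:
  assumes "smooth f" "t \<in> I"
  shows "((\<lambda>h. f (x + h *\<^sub>R axis j 1, t)) has_real_derivative dx j f (x + h *\<^sub>R axis j 1, t)) (at h)"
proof -
  have "((\<lambda>k. f ((x + h *\<^sub>R axis j 1) + k *\<^sub>R axis j 1, t)) has_real_derivative dx j f (x + h *\<^sub>R axis j 1, t)) (at 0)"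
    by (rule dx_real[OF assms])
  then have "((\<lambda>k. f (x + (k + h) *\<^sub>R axis j 1, t)) has_real_derivative dx j f (x + h *\<^sub>R axis j 1, t)) (at 0)"
    by (simp add: algebra_simps)
  then show ?thesis using DERIV_shift[of "\<lambda>k. f (x + k *\<^sub>R axis j 1, t)" _ 0 h] by simp
qed

lemma dx_realI: "((\<lambda>h. f (x + h *\<^sub>R axis j 1, t)) has_real_derivative D) (at 0) \<Longrightarrow> dx j f (x, t) = D"
  by (simp add: dx_def partial_def has_real_derivative_iff_has_vector_derivative vector_derivative_at)

lemma dt_realI: "((\<lambda>s. f (x, s)) has_real_derivative D) (at t) \<Longrightarrow> dt f (x, t) = D"
  by (simp add: dt_def has_real_derivative_iff_has_vector_derivative vector_derivative_at)

lemma smooth_dx: assumes "smooth f" shows "smooth (dx j f)"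
proof -
  have eq: "dx j f z = frechet_derivative f (at z) (axis j 1, 0)" if "z \<in> UNIV \<times> I" for z
    using that dx_eq_frechet[OF assms] by (cases z) auto
  have "smooth (\<lambda>z. frechet_derivative f (at z) (axis j 1, 0))"
    by (rule smooth_on_frechet[OF assms open_strip axis_Basis(1)])
  then show ?thesis using smooth_on_cong[of "UNIV \<times> I" "dx j f", OF eq] by blast
qed

lemma smooth_dt: assumes "smooth f" shows "smooth (dt f)"
proof -
  have eq: "dt f z = frechet_derivative f (at z) (0, 1)" if "z \<in> UNIV \<times> I" for z
    using that dt_eq_frechet[OF assms] by (cases z) auto
  have "smooth (\<lambda>z. frechet_derivative f (at z) (0, 1))"
    by (rule smooth_on_frechet[OF assms open_strip axis_Basis(2)])
  then show ?thesis using smooth_on_cong[of "UNIV \<times> I" "dt f", OF eq] by blast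
qed

lemma frechet_cong_open:
  assumes "open S" "z \<in> S" "\<And>w. w \<in> S \<Longrightarrow> f w = g w"
  shows "frechet_derivative f (at z) = frechet_derivative g (at z)"
proof -
  have "(f has_derivative f') (at z) \<longleftrightarrow> (g has_derivative f') (at z)" for f'
    using has_derivative_transform_within_open[OF _ assms(1,2), of f f' UNIV g]
      has_derivative_transform_within_open[OF _ assms(1,2), of g f' UNIV f] assms(3) by auto
  then show ?thesis by (simp add: frechet_derivative_def)
qed

lemma dx_commute:
  fixes f :: "(real^3) \<times> real \<Rightarrow> real"
  assumes f: "smooth f" and t: "t \<in> I"
  shows "dx i (dx j f) (x, t) = dx j (dx i f) (x, t)"
proof -
  have z: "(x, t) \<in> UNIV \<times> I" using t by simp
  have eq: "dx j f w = frechet_derivative f (at w) (axis j 1, 0)" if "w \<in> UNIV \<times> I" for w j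
    using that dx_eq_frechet[OF f] by (cases w) auto
  have "dx i (dx j f) (x, t) = frechet_derivative (\<lambda>w. frechet_derivative f (at w) (axis j 1, 0)) (at (x, t)) (axis i 1, 0)" for i j
    using dx_eq_frechet[OF smooth_dx[OF f] t] frechet_cong_open[OF open_strip z eq] by simp
  then show ?thesis
    using mixed_partials[OF f open_strip z axis_Basis(1)[of i] axis_Basis(1)[of j]] by simp
qed

lemma dx_dt_commute:
  fixes f :: "(real^3) \<times> real \<Rightarrow> real"
  assumes f: "smooth f" and t: "t \<in> I"
  shows "dt (dx j f) (x, t) = dx j (dt f) (x, t)"
proof -
  have z: "(x, t) \<in> UNIV \<times> I" using t by simp
  have eq: "dx j f w = frechet_derivative f (at w) (axis j 1, 0)" if "w \<in> UNIV \<times> I" for w j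
    using that dx_eq_frechet[OF f] by (cases w) auto
  have eq2: "dt f w = frechet_derivative f (at w) (0, 1)" if "w \<in> UNIV \<times> I" for w
    using that dt_eq_frechet[OF f] by (cases w) auto
  have "dt (dx j f) (x, t) = frechet_derivative (\<lambda>w. frechet_derivative f (at w) (axis j 1, 0)) (at (x, t)) (0, 1)"
    using dt_eq_frechet[OF smooth_dx[OF f] t] frechet_cong_open[OF open_strip z eq] by simp
  moreover have "dx j (dt f) (x, t) = frechet_derivative (\<lambda>w. frechet_derivative f (at w) (0, 1)) (at (x, t)) (axis j 1, 0)"
    using dx_eq_frechet[OF smooth_dt[OF f] t] frechet_cong_open[OF open_strip z eq2] by simp
  ultimately show ?thesis
    using mixed_partials[OF f open_strip z axis_Basis(1)[of j] axis_Basis(2)] by simp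
qed

lemma dx_cong: "(\<And>y. f (y, t) = g (y, t)) \<Longrightarrow> dx j f (x, t) = dx j g (x, t)"
  by (simp add: dx_def partial_def)

lemmas smooth_intros = smooth_on_const[OF du] smooth_on_add[OF du] smooth_on_diff[OF du] smooth_on_uminus[OF du]
  smooth_on_mult[OF du] smooth_on_sum[OF du] smooth_on_power[OF du] smooth_on_coord[OF du] smooth_on_snd[OF du]
  smooth_dx smooth_dt smooth_on_nth[OF du]

lemma dx_const: "dx j (\<lambda>z. c) (x, t) = (0::real)"
  by (rule dx_realI) simp

lemma dx_time: "dx j (\<lambda>z. g (snd z)) (x, t) = (0::real)"
  by (rule dx_realI) simp

lemma dt_time: "(g has_real_derivative g') (at t) \<Longrightarrow> dt (\<lambda>z. g (snd z)) (x, t) = g'"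
  by (rule dt_realI) simp

lemma dt_const: "dt (\<lambda>z. c) (x, t) = (0::real)"
  by (rule dt_realI) simp

lemma dx_coord: "dx j (\<lambda>z. fst z $ i) (x, t) = (if i = j then 1 else 0::real)"
  by (rule dx_realI) (auto intro!: derivative_eq_intros simp: axis_def)

lemma dt_coord: "dt (\<lambda>z. fst z $ i) (x, t) = (0::real)"
  by (rule dt_realI) simp

context
  fixes f g :: "(real^3) \<times> real \<Rightarrow> real" and t :: real
  assumes t: "t \<in> I" and f: "smooth f"
begin

lemma dx_cmult: "dx j (\<lambda>z. c * f z) (x, t) = c * dx j f (x, t)"
  by (rule dx_realI) (auto intro!: derivative_eq_intros dx_real[OF f t])

lemma dt_cmult: "dt (\<lambda>z. c * f z) (x, t) = c * dt f (x, t)"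
  by (rule dt_realI) (auto intro!: derivative_eq_intros dt_real[OF f t])

lemma dx_minus: "dx j (\<lambda>z. - f z) (x, t) = - dx j f (x, t)"
  by (rule dx_realI) (auto intro!: derivative_eq_intros dx_real[OF f t])

lemma dx_compose:
  assumes "\<And>r. (\<phi> has_real_derivative \<phi>' r) (at r)"
  shows "dx j (\<lambda>z. \<phi> (f z)) (x, t) = \<phi>' (f (x, t)) * dx j f (x, t)"
  using DERIV_chain2[OF assms dx_real[OF f t]] by (intro dx_realI) simp

context
  assumes g: "smooth g"
begin

lemma dx_add: "dx j (\<lambda>z. f z + g z) (x, t) = dx j f (x, t) + dx j g (x, t)"
  by (rule dx_realI) (auto intro!: derivative_eq_intros dx_real[OF f t] dx_real[OF g t])

lemma dt_add: "dt (\<lambda>z. f z + g z) (x, t) = dt f (x, t) + dt g (x, t)"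
  by (rule dt_realI) (auto intro!: derivative_eq_intros dt_real[OF f t] dt_real[OF g t])

lemma dx_diff: "dx j (\<lambda>z. f z - g z) (x, t) = dx j f (x, t) - dx j g (x, t)"
  by (rule dx_realI) (auto intro!: derivative_eq_intros dx_real[OF f t] dx_real[OF g t])

lemma dt_diff: "dt (\<lambda>z. f z - g z) (x, t) = dt f (x, t) - dt g (x, t)"
  by (rule dt_realI) (auto intro!: derivative_eq_intros dt_real[OF f t] dt_real[OF g t])

lemma dx_mult: "dx j (\<lambda>z. f z * g z) (x, t) = f (x, t) * dx j g (x, t) + g (x, t) * dx j f (x, t)"
  by (rule dx_realI) (auto intro!: derivative_eq_intros dx_real[OF f t] dx_real[OF g t])

lemma dt_mult: "dt (\<lambda>z. f z * g z) (x, t) = f (x, t) * dt g (x, t) + g (x, t) * dt f (x, t)"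
  by (rule dt_realI) (auto intro!: derivative_eq_intros dt_real[OF f t] dt_real[OF g t])

end

end

lemma dx_sum:
  fixes f :: "'i \<Rightarrow> (real^3) \<times> real \<Rightarrow> real"
  assumes "t \<in> I" "\<And>i. i \<in> X \<Longrightarrow> smooth (f i)"
  shows "dx j (\<lambda>z. \<Sum>i\<in>X. f i z) (x, t) = (\<Sum>i\<in>X. dx j (f i) (x, t))"
  by (rule dx_realI) (rule DERIV_sum[OF dx_real[OF assms(2,1)]])

lemma dx_nth: "smooth f \<Longrightarrow> t \<in> I \<Longrightarrow> dx j f (x, t) $ i = dx j (\<lambda>z. f z $ i) (x, t)"
  using bounded_linear.has_vector_derivative[OF bounded_linear_vec_nth[of i] dx_vector[of f t x j]]
  by (simp add: dx_def partial_def vector_derivative_at)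

lemma dt_nth: "smooth f \<Longrightarrow> t \<in> I \<Longrightarrow> dt f (x, t) $ i = dt (\<lambda>z. f z $ i) (x, t)"
  using bounded_linear.has_vector_derivative[OF bounded_linear_vec_nth[of i] dt_vector[of f t x]]
  by (simp add: dt_def vector_derivative_at)

end

section \<open>The transport-diffusion operator\<close>

locale strip_L = strip +
  fixes \<nu> :: real and u :: "(real^3) \<times> real \<Rightarrow> real^3"
begin

abbreviation L :: "((real^3) \<times> real \<Rightarrow> 'b::real_normed_vector) \<Rightarrow> (real^3) \<times> real \<Rightarrow> 'b" where
  "L \<equiv> transport_diffusion \<nu> u"

lemma L_real: "L f z = dt f z + (\<Sum>j\<in>UNIV. u z $ j * dx j f z) - \<nu> * (\<Sum>k\<in>UNIV. dx k (dx k f) z)" for f :: "_ \<Rightarrow> real"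
  by (simp add: transport_diffusion_def)

lemma L_nth:
  assumes f: "smooth f" and t: "t \<in> I"
  shows "L f (x, t) $ i = L (\<lambda>z. f z $ i) (x, t)"
proof -
  have dd: "dx k (dx k f) (x, t) $ i = dx k (dx k (\<lambda>z. f z $ i)) (x, t)" for k
    unfolding dx_nth[OF smooth_dx[OF f] t] by (rule dx_cong) (rule dx_nth[OF f t])
  show ?thesis
    by (simp add: transport_diffusion_def dx_nth[OF f t] dt_nth[OF f t] dd)
qed

lemma L_const: "L (\<lambda>z. c) (x, t) = (0::real)"
proof -
  have "dx k (dx k (\<lambda>z. c)) (x, t) = 0" for k
    using dx_cong[of "dx k (\<lambda>z. c)" t "\<lambda>z. 0"] by (simp add: dx_const)
  then show ?thesis by (simp add: L_real dx_const dt_const)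
qed

lemma L_time: "(g has_real_derivative g') (at t) \<Longrightarrow> L (\<lambda>z. g (snd z)) (x, t) = g'"
proof -
  assume g: "(g has_real_derivative g') (at t)"
  have "dx k (dx k (\<lambda>z. g (snd z))) (x, t) = 0" for k
    using dx_cong[of "dx k (\<lambda>z. g (snd z))" t "\<lambda>z. 0"] by (simp add: dx_time dx_const)
  then show ?thesis by (simp add: L_real dx_time dt_time[OF g])
qed

lemma L_coord: "L (\<lambda>z. fst z $ i) (x, t) = u (x, t) $ i"
proof -
  have "dx k (dx k (\<lambda>z. fst z $ i)) (x, t) = 0" for k
    using dx_cong[of "dx k (\<lambda>z. fst z $ i)" t "\<lambda>z. if i = k then 1 else 0"] by (simp add: dx_coord dx_const)
  then show ?thesis by (simp add: L_real dx_coord dt_coord if_distrib[of "\<lambda>r. u (x, t) $ _ * r"] cong: if_cong)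
qed

context
  fixes f g :: "(real^3) \<times> real \<Rightarrow> real" and t :: real
  assumes t: "t \<in> I" and f: "smooth f"
begin

lemma L_cmult: "L (\<lambda>z. c * f z) (x, t) = c * L f (x, t)"
proof -
  have "dx k (dx k (\<lambda>z. c * f z)) (x, t) = c * dx k (dx k f) (x, t)" for k
    unfolding dx_cmult[OF t smooth_dx[OF f], symmetric] by (rule dx_cong) (rule dx_cmult[OF t f])
  then show ?thesis
    by (simp add: L_real dx_cmult[OF t f] dt_cmult[OF t f] algebra_simps sum_distrib_left)
qed

lemma dxdx_compose:
  assumes "\<And>r. (\<phi> has_real_derivative \<phi>' r) (at r)" "\<And>r. (\<phi>' has_real_derivative \<phi>'' r) (at r)" "smooth_on UNIV \<phi>'"
  shows "dx k (dx k (\<lambda>z. \<phi> (f z))) (x, t) = \<phi>'' (f (x, t)) * (dx k f (x, t))^2 + \<phi>' (f (x, t)) * dx k (dx k f) (x, t)"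
proof -
  have "dx k (dx k (\<lambda>z. \<phi> (f z))) (x, t) = dx k (\<lambda>z. \<phi>' (f z) * dx k f z) (x, t)"
    by (rule dx_cong) (rule dx_compose[OF t f assms(1)])
  also have "\<dots> = \<phi>' (f (x, t)) * dx k (dx k f) (x, t) + dx k f (x, t) * dx k (\<lambda>z. \<phi>' (f z)) (x, t)"
    by (rule dx_mult[OF t smooth_on_compose[OF du assms(3) f] smooth_dx[OF f]])
  also have "dx k (\<lambda>z. \<phi>' (f z)) (x, t) = \<phi>'' (f (x, t)) * dx k f (x, t)"
    by (rule dx_compose[OF t f assms(2)])
  finally show ?thesis by (simp add: power2_eq_square algebra_simps)
qed

context
  assumes g: "smooth g"
begin

lemma L_add: "L (\<lambda>z. f z + g z) (x, t) = L f (x, t) + L g (x, t)"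
proof -
  have "dx k (dx k (\<lambda>z. f z + g z)) (x, t) = dx k (dx k f) (x, t) + dx k (dx k g) (x, t)" for k
    unfolding dx_add[OF t smooth_dx[OF f] smooth_dx[OF g], symmetric] by (rule dx_cong) (rule dx_add[OF t f g])
  then show ?thesis
    by (simp add: L_real dx_add[OF t f g] dt_add[OF t f g] algebra_simps sum.distrib)
qed

lemma L_diff: "L (\<lambda>z. f z - g z) (x, t) = L f (x, t) - L g (x, t)"
proof -
  have "dx k (dx k (\<lambda>z. f z - g z)) (x, t) = dx k (dx k f) (x, t) - dx k (dx k g) (x, t)" for k
    unfolding dx_diff[OF t smooth_dx[OF f] smooth_dx[OF g], symmetric] by (rule dx_cong) (rule dx_diff[OF t f g])
  then show ?thesis
    by (simp only: L_real dx_diff[OF t f g] dt_diff[OF t f g]) (simp add: algebra_simps sum_subtractf)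
qed

text \<open>
  The product rule, with the cross term of the Laplacian.  All estimates below that gain a derivative live on
  this term.
\<close>

lemma L_mult: "L (\<lambda>z. f z * g z) (x, t) = f (x, t) * L g (x, t) + g (x, t) * L f (x, t)
    - 2 * \<nu> * (\<Sum>k\<in>UNIV. dx k f (x, t) * dx k g (x, t))"
proof -
  have "dx k (dx k (\<lambda>z. f z * g z)) (x, t) = f (x, t) * dx k (dx k g) (x, t) + g (x, t) * dx k (dx k f) (x, t)
    + 2 * (dx k f (x, t) * dx k g (x, t))" for k
  proof -
    have "dx k (dx k (\<lambda>z. f z * g z)) (x, t) = dx k (\<lambda>z. f z * dx k g z + g z * dx k f z) (x, t)"
      by (rule dx_cong) (rule dx_mult[OF t f g])
    also have "\<dots> = dx k (\<lambda>z. f z * dx k g z) (x, t) + dx k (\<lambda>z. g z * dx k f z) (x, t)"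
      by (intro dx_add t smooth_intros f g)
    also have "\<dots> = f (x, t) * dx k (dx k g) (x, t) + g (x, t) * dx k (dx k f) (x, t)
      + 2 * (dx k f (x, t) * dx k g (x, t))"
      by (simp add: dx_mult[OF t f smooth_dx[OF g]] dx_mult[OF t g smooth_dx[OF f]])
    finally show ?thesis .
  qed
  then show ?thesis
    by (simp add: L_real dx_mult[OF t f g] dt_mult[OF t f g] algebra_simps sum.distrib sum_distrib_left)
qed

end

end

lemma L_square:
  fixes f :: "(real^3) \<times> real \<Rightarrow> real"
  assumes "t \<in> I" "smooth f"
  shows "L (\<lambda>z. (f z)^2) (x, t) = 2 * f (x, t) * L f (x, t) - 2 * \<nu> * (\<Sum>k\<in>UNIV. (dx k f (x, t))^2)"
  using L_mult[OF assms assms(2), of x] by (simp add: power2_eq_square algebra_simps)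

lemma L_sum:
  fixes f :: "'i \<Rightarrow> (real^3) \<times> real \<Rightarrow> real"
  assumes "t \<in> I" "\<And>i. i \<in> X \<Longrightarrow> smooth (f i)"
  shows "L (\<lambda>z. \<Sum>i\<in>X. f i z) (x, t) = (\<Sum>i\<in>X. L (f i) (x, t))"
  using assms(2)
  by (induction X rule: infinite_finite_induct) (auto simp: L_const L_add[OF assms(1)] smooth_intros)

text \<open>
  Differentiating \<open>L f = h\<close> in space: all terms commute with the derivative except the transport term, where
  it falls on the coefficients.
\<close>

lemma L_dx:
  fixes f :: "(real^3) \<times> real \<Rightarrow> real"
  assumes f: "smooth f" and u: "\<And>j. smooth (\<lambda>z. u z $ j)" and t: "t \<in> I"
    and h: "\<And>y. L f (y, t) = h (y, t)"
  shows "L (dx j f) (x, t) = dx j h (x, t) - (\<Sum>k\<in>UNIV. dx j (\<lambda>z. u z $ k) (x, t) * dx k f (x, t))"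
proof -
  have "dx j h (x, t) = dx j (L f) (x, t)"
    by (rule dx_cong) (simp add: h)
  also have "\<dots> = dx j (\<lambda>z. (dt f z + (\<Sum>k\<in>UNIV. u z $ k * dx k f z)) - \<nu> * (\<Sum>k\<in>UNIV. dx k (dx k f) z)) (x, t)"
    by (rule dx_cong) (rule L_real)
  also have "\<dots> = dx j (\<lambda>z. dt f z + (\<Sum>k\<in>UNIV. u z $ k * dx k f z)) (x, t) - dx j (\<lambda>z. \<nu> * (\<Sum>k\<in>UNIV. dx k (dx k f) z)) (x, t)"
    by (intro dx_diff t smooth_intros f u)
  also have "dx j (\<lambda>z. dt f z + (\<Sum>k\<in>UNIV. u z $ k * dx k f z)) (x, t) = dx j (dt f) (x, t) + dx j (\<lambda>z. \<Sum>k\<in>UNIV. u z $ k * dx k f z) (x, t)"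
    by (intro dx_add t smooth_intros f u)
  also have "dx j (\<lambda>z. \<Sum>k\<in>UNIV. u z $ k * dx k f z) (x, t) = (\<Sum>k\<in>UNIV. dx j (\<lambda>z. u z $ k * dx k f z) (x, t))"
    by (intro dx_sum t smooth_intros f u)
  also have "\<dots> = (\<Sum>k\<in>UNIV. u (x, t) $ k * dx j (dx k f) (x, t) + dx k f (x, t) * dx j (\<lambda>z. u z $ k) (x, t))"
    by (intro sum.cong refl dx_mult t smooth_intros f u)
  also have "dx j (\<lambda>z. \<nu> * (\<Sum>k\<in>UNIV. dx k (dx k f) z)) (x, t) = \<nu> * dx j (\<lambda>z. \<Sum>k\<in>UNIV. dx k (dx k f) z) (x, t)"
    by (intro dx_cmult t smooth_intros f u)
  also have "dx j (\<lambda>z. \<Sum>k\<in>UNIV. dx k (dx k f) z) (x, t) = (\<Sum>k\<in>UNIV. dx j (dx k (dx k f)) (x, t))"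
    by (intro dx_sum t smooth_intros f u)
  also have "(\<Sum>k\<in>UNIV. dx j (dx k (dx k f)) (x, t)) = (\<Sum>k\<in>UNIV. dx k (dx k (dx j f)) (x, t))"
  proof (rule sum.cong[OF refl])
    fix k
    have "dx j (dx k (dx k f)) (x, t) = dx k (dx j (dx k f)) (x, t)" by (rule dx_commute[OF smooth_dx[OF f] t])
    also have "\<dots> = dx k (dx k (dx j f)) (x, t)" by (rule dx_cong) (rule dx_commute[OF f t])
    finally show "dx j (dx k (dx k f)) (x, t) = dx k (dx k (dx j f)) (x, t)" .
  qed
  finally have "dx j h (x, t) = dt (dx j f) (x, t)
      + (\<Sum>k\<in>UNIV. u (x, t) $ k * dx k (dx j f) (x, t) + dx k f (x, t) * dx j (\<lambda>z. u z $ k) (x, t))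
      - \<nu> * (\<Sum>k\<in>UNIV. dx k (dx k (dx j f)) (x, t))"
    by (simp add: dx_commute[OF f t, of j] dx_dt_commute[OF f t])
  then show ?thesis by (simp add: L_real sum.distrib algebra_simps)
qed

end

section \<open>Smooth steps and cutoff functions of one variable\<close>

lemmas du_UNIV = diff_unique_open[OF open_UNIV]

lemma smooth_on_exp: "smooth_on UNIV (exp :: real \<Rightarrow> real)"
  unfolding smooth_on_def
proof
  fix k show "C_k_on k UNIV (exp :: real \<Rightarrow> real)"
  proof (induction k)
    case 0 show ?case by (simp add: continuous_on_exp)
  next
    case (Suc k)
    have "C_k_on k UNIV (\<lambda>z. exp z * b)" if "b \<in> Basis" for b :: real using Suc that by simp
    then show ?case
      by (intro C_k_on_SucI[OF du_UNIV, of _ "\<lambda>z b. exp z * b"]) (auto intro!: derivative_eq_intros)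
  qed
qed

lemma smooth_on_sin_cos: "smooth_on UNIV (sin :: real \<Rightarrow> real)" "smooth_on UNIV (cos :: real \<Rightarrow> real)"
proof -
  have "C_k_on k UNIV (sin :: real \<Rightarrow> real) \<and> C_k_on k UNIV (cos :: real \<Rightarrow> real)" for k
  proof (induction k)
    case 0 show ?case by (simp add: continuous_on_sin continuous_on_cos)
  next
    case (Suc k)
    have s: "C_k_on k UNIV (\<lambda>z. cos z * b)" if "b \<in> Basis" for b :: real using Suc that by simp
    have "C_k_on k UNIV (\<lambda>z::real. - sin z)"
      using C_k_on_bounded_linear[OF du_UNIV bounded_linear_minus[OF bounded_linear_ident]] Suc by blast
    then have c: "C_k_on k UNIV (\<lambda>z. - sin z * b)" if "b \<in> Basis" for b :: real using that by simp
    have "C_k_on (Suc k) UNIV (sin :: real \<Rightarrow> real)"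
      by (rule C_k_on_SucI[OF du_UNIV _ s]) (auto intro!: derivative_eq_intros)
    moreover have "C_k_on (Suc k) UNIV (cos :: real \<Rightarrow> real)"
      by (rule C_k_on_SucI[OF du_UNIV _ c]) (auto intro!: derivative_eq_intros)
    ultimately show ?case by blast
  qed
  then show "smooth_on UNIV (sin :: real \<Rightarrow> real)" "smooth_on UNIV (cos :: real \<Rightarrow> real)"
    by (simp_all add: smooth_on_def)
qed

text \<open>
  The classical function that is flat at \<open>0\<close>, together with its quotients by powers: this family is closed
  under differentiation, which makes its smoothness an easy induction.
\<close>

definition flat :: "nat \<Rightarrow> real \<Rightarrow> real" where
  "flat n x = (if x > 0 then exp (- 1 / x) / x ^ n else 0)"

lemma flat_tendsto_0: "(flat n \<longlongrightarrow> 0) (at 0)"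
proof -
  have "((\<lambda>x. inverse x ^ n / exp (inverse x)) \<longlongrightarrow> (0::real)) (at_right 0)"
    by (rule filterlim_compose[OF tendsto_power_div_exp_0 filterlim_inverse_at_top_right])
  then have "(flat n \<longlongrightarrow> 0) (at_right 0)"
    by (rule Lim_transform_eventually)
      (auto simp: eventually_at_filter flat_def exp_minus field_simps)
  moreover have "(flat n \<longlongrightarrow> 0) (at_left 0)"
    by (rule Lim_transform_eventually[OF tendsto_const]) (auto simp: eventually_at_filter flat_def)
  ultimately show ?thesis by (rule filterlim_split_at[rotated])
qed

lemma flat_derivative: "(flat n has_real_derivative - real n * flat (Suc n) x + flat (Suc (Suc n)) x) (at x)"
proof (cases "x = 0")
  case True
  have "((\<lambda>h. (flat n (0 + h) - flat n 0) / h) \<longlongrightarrow> 0) (at 0)"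
    by (rule Lim_transform_eventually[OF flat_tendsto_0[of "Suc n"]]) (auto simp: flat_def eventually_at_filter)
  then show ?thesis using True by (simp add: DERIV_def flat_def)
next
  case False
  show ?thesis
  proof (cases "x > 0")
    case True
    have "((\<lambda>x. exp (- 1 / x) / x ^ n) has_real_derivative - real n * (exp (- 1 / x) / x ^ Suc n) + exp (- 1 / x) / x ^ Suc (Suc n)) (at x)"
    proof (cases n)
      case 0 then show ?thesis using True by (auto intro!: derivative_eq_intros simp: power2_eq_square)
    next
      case (Suc m) then show ?thesis using True power_eq_if[of x m]
        by (auto intro!: derivative_eq_intros simp: field_simps power2_eq_square power_add)
    qed
    then have "((\<lambda>x. exp (- 1 / x) / x ^ n) has_real_derivative - real n * flat (Suc n) x + flat (Suc (Suc n)) x) (at x)"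
      using True by (simp add: flat_def)
    then show ?thesis
      by (rule has_field_derivative_transform_within_open[of _ _ _ "{0<..}"]) (use True in \<open>auto simp: flat_def\<close>)
  next
    case nonpos: False
    have "((\<lambda>x. 0) has_real_derivative - real n * flat (Suc n) x + flat (Suc (Suc n)) x) (at x)"
      using nonpos by (simp add: flat_def)
    then show ?thesis
      by (rule has_field_derivative_transform_within_open[of _ _ _ "{..<0}"]) (use nonpos False in \<open>auto simp: flat_def\<close>)
  qed
qed

lemma smooth_on_flat: "smooth_on UNIV (flat n)"
proof -
  have "C_k_on k UNIV (flat n)" for k n
  proof (induction k arbitrary: n)
    case 0 show ?case using flat_derivative by (auto intro!: continuous_at_imp_continuous_on DERIV_isCont)
  next
    case (Suc k)
    have "C_k_on k UNIV (\<lambda>x. - real n * flat (Suc n) x + flat (Suc (Suc n)) x)"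
      by (intro C_k_on_add C_k_on_mult C_k_on_const du_UNIV Suc)
    then have *: "C_k_on k UNIV (\<lambda>x. (- real n * flat (Suc n) x + flat (Suc (Suc n)) x) * b)" if "b \<in> Basis" for b
      using that by simp
    show ?case
      by (rule C_k_on_SucI[OF du_UNIV _ *]) (use flat_derivative in \<open>auto simp: has_field_derivative_def\<close>)
  qed
  then show ?thesis by (simp add: smooth_on_def)
qed

lemma flat_0_bounds: "0 \<le> flat 0 x" "flat 0 x \<le> 1" "x > 0 \<Longrightarrow> flat 0 x > 0" "x \<le> 0 \<Longrightarrow> flat 0 x = 0"
  by (auto simp: flat_def)

text \<open>
  The antiderivative that vanishes at \<open>0\<close>; choosing it abstractly avoids the orientation of integrals over
  \<open>[0, x]\<close>.
\<close>

definition antideriv :: "(real \<Rightarrow> real) \<Rightarrow> real \<Rightarrow> real" where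
  "antideriv f = (SOME F. F 0 = 0 \<and> (\<forall>x. (F has_real_derivative f x) (at x)))"

lemma antideriv:
  assumes "continuous_on UNIV f"
  shows "antideriv f 0 = 0" "(antideriv f has_real_derivative f x) (at x)"
proof -
  obtain F where F: "\<And>x::real. (F has_vector_derivative f x) (at x)"
    using einterval_antiderivative[of "-\<infinity>" "\<infinity>" f] assms
    by (auto simp: continuous_on_eq_continuous_at)
  have "\<exists>F. F 0 = 0 \<and> (\<forall>x. (F has_real_derivative f x) (at x))"
  proof (intro exI[of _ "\<lambda>x. F x - F 0"] conjI allI)
    fix x
    have "(F has_real_derivative f x) (at x)" using F by (simp add: has_real_derivative_iff_has_vector_derivative)
    then show "((\<lambda>x. F x - F 0) has_real_derivative f x) (at x)" by (auto intro!: derivative_eq_intros)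
  qed simp
  then have "antideriv f 0 = 0 \<and> (\<forall>x. (antideriv f has_real_derivative f x) (at x))"
    unfolding antideriv_def by (rule someI_ex)
  then show "antideriv f 0 = 0" "(antideriv f has_real_derivative f x) (at x)" by auto
qed

lemma smooth_on_antideriv: "smooth_on UNIV f \<Longrightarrow> smooth_on UNIV (antideriv f)"
  using smooth_on_realI[of "antideriv f" f] antideriv(2)[OF smooth_on_imp_continuous_on] by blast

lemma antideriv_mono:
  assumes "continuous_on UNIV f" "\<And>x. f x \<ge> 0" "a \<le> b"
  shows "antideriv f a \<le> antideriv f b"
  using assms(3) by (rule DERIV_nonneg_imp_nondecreasing) (use antideriv(2)[OF assms(1)] assms(2) in blast)

lemma antideriv_const:
  assumes "continuous_on UNIV f" "\<And>x. a \<le> x \<Longrightarrow> x \<le> b \<Longrightarrow> f x = 0" "a \<le> b"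
  shows "antideriv f a = antideriv f b"
proof (cases "a = b")
  case False
  with assms(3) have "a < b" by simp
  then show ?thesis
    using MVT2[of a b "antideriv f" f] antideriv(2)[OF assms(1)] assms(2) by fastforce
qed simp

lemma antideriv_pos:
  assumes "continuous_on UNIV f" "\<And>x. f x \<ge> 0" "\<And>x. 0 < x \<Longrightarrow> x < c \<Longrightarrow> f x > 0" "x > 0" "c > 0"
  shows "antideriv f x > 0"
proof -
  define y where "y = min x c"
  have y: "0 < y" "y \<le> x" "y \<le> c" using assms by (auto simp: y_def)
  obtain z where z: "0 < z" "z < y" "antideriv f y - antideriv f 0 = (y - 0) * f z"
    using MVT2[of 0 y "antideriv f" f] antideriv(2)[OF assms(1)] y by blast
  then have "antideriv f y > 0" using antideriv(1)[OF assms(1)] assms(3)[of z] y by simp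
  then show ?thesis using antideriv_mono[OF assms(1,2) y(2)] by linarith
qed

definition bump :: "real \<Rightarrow> real" where "bump x = flat 0 x * flat 0 (1 - x)"

lemma smooth_on_flip: "smooth_on UNIV f \<Longrightarrow> smooth_on UNIV (\<lambda>x. f (c - x))" for f :: "real \<Rightarrow> real" and c :: real
  using smooth_on_compose[OF du_UNIV, of f "\<lambda>x. c - x"]
    smooth_on_diff[OF du_UNIV smooth_on_const[OF du_UNIV] smooth_on_linear[OF du_UNIV bounded_linear_ident], of c] by simp

lemma smooth_on_bump: "smooth_on UNIV bump"
  unfolding bump_def[abs_def] by (intro smooth_on_mult du_UNIV smooth_on_flat smooth_on_flip)

lemma bump_bounds: "0 \<le> bump x" "bump x \<le> 1" "0 < x \<Longrightarrow> x < 1 \<Longrightarrow> bump x > 0" "x \<le> 0 \<Longrightarrow> bump x = 0" "x \<ge> 1 \<Longrightarrow> bump x = 0"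
  using flat_0_bounds[of x] flat_0_bounds[of "1 - x"] by (auto simp: bump_def mult_le_one)

lemmas cont_bump = smooth_on_imp_continuous_on[OF smooth_on_bump]

definition step_mass :: real where "step_mass = antideriv bump 1"
definition step :: "real \<Rightarrow> real" where "step x = antideriv bump x / step_mass"
definition step' :: "real \<Rightarrow> real" where "step' x = bump x / step_mass"

lemma step_mass_pos: "step_mass > 0"
  unfolding step_mass_def by (rule antideriv_pos[OF cont_bump, of 1]) (auto simp: bump_bounds)

lemma step_derivative: "(step has_real_derivative step' x) (at x)"
  unfolding step_def[abs_def] step'_def
  using step_mass_pos by (auto intro!: derivative_eq_intros antideriv(2)[OF cont_bump])

lemma smooth_on_step': "smooth_on UNIV step'"
proof -
  have "smooth_on UNIV (\<lambda>x. bump x * (1 / step_mass))"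
    by (intro smooth_on_mult du_UNIV smooth_on_bump smooth_on_const)
  then show ?thesis by (simp add: step'_def[abs_def])
qed

lemma smooth_on_step: "smooth_on UNIV step"
  using smooth_on_realI[OF step_derivative smooth_on_step'] .

lemma step_le_0: "x \<le> 0 \<Longrightarrow> step x = 0"
  using antideriv_const[OF cont_bump, of x 0] antideriv(1)[OF cont_bump] by (simp add: step_def bump_bounds)

lemma step_ge_1: "x \<ge> 1 \<Longrightarrow> step x = 1"
  using antideriv_const[OF cont_bump, of 1 x] step_mass_pos by (simp add: step_def step_mass_def bump_bounds)

lemma step_pos: "x > 0 \<Longrightarrow> step x > 0"
  using antideriv_pos[OF cont_bump, of 1 x] step_mass_pos by (simp add: step_def bump_bounds)

lemma step_bounds: "0 \<le> step x" "step x \<le> 1"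
proof -
  have m: "step a \<le> step b" if "a \<le> b" for a b
    using antideriv_mono[OF cont_bump bump_bounds(1) that] step_mass_pos by (simp add: step_def divide_right_mono)
  show "0 \<le> step x" using m[of "min x 0" x] step_le_0[of "min x 0"] by simp
  show "step x \<le> 1" using m[of x "max x 1"] step_ge_1[of "max x 1"] by simp
qed

lemma step'_bounds: "0 \<le> step' x" "step' x \<le> 1 / step_mass" "x \<le> 0 \<Longrightarrow> step' x = 0" "x \<ge> 1 \<Longrightarrow> step' x = 0"
  using step_mass_pos by (auto simp: step'_def bump_bounds divide_right_mono)

text \<open>
  A smooth convex substitute for the square of the positive part: \<open>hinge\<close> vanishes for negative arguments, is
  positive for positive ones and is bounded by the square.
\<close>

definition hinge' :: "real \<Rightarrow> real" where "hinge' = antideriv (flat 0)"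
definition hinge :: "real \<Rightarrow> real" where "hinge = antideriv hinge'"

lemmas cont_flat = smooth_on_imp_continuous_on[OF smooth_on_flat]

lemma smooth_on_hinge': "smooth_on UNIV hinge'"
  unfolding hinge'_def by (rule smooth_on_antideriv[OF smooth_on_flat])

lemma smooth_on_hinge: "smooth_on UNIV hinge"
  unfolding hinge_def by (rule smooth_on_antideriv[OF smooth_on_hinge'])

lemma hinge_derivative: "(hinge has_real_derivative hinge' x) (at x)" "(hinge' has_real_derivative flat 0 x) (at x)"
  unfolding hinge_def hinge'_def
  by (rule antideriv(2), rule smooth_on_imp_continuous_on, rule smooth_on_antideriv[OF smooth_on_flat])
    (rule antideriv(2)[OF cont_flat])

lemma hinge'_nonneg: "hinge' x \<ge> 0" and hinge'_le: "hinge' x \<le> max 0 x" and hinge'_pos: "x > 0 \<Longrightarrow> hinge' x > 0"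
proof -
  have z: "hinge' y = 0" if "y \<le> 0" for y
    using antideriv_const[OF cont_flat, of y 0 0] antideriv(1)[OF cont_flat, of 0] that flat_0_bounds
    by (simp add: hinge'_def)
  show p: "hinge' x > 0" if "x > 0" for x
    unfolding hinge'_def by (rule antideriv_pos[OF cont_flat _ _ that, of _ 1]) (auto simp: flat_0_bounds)
  show "hinge' x \<ge> 0" using z[of x] p[of x] by fastforce
  show "hinge' x \<le> max 0 x"
  proof (cases "x \<le> 0")
    case False
    then obtain y where "hinge' x - hinge' 0 = (x - 0) * flat 0 y"
      using MVT2[of 0 x hinge' "flat 0"] hinge_derivative(2) by force
    then show ?thesis using z[of 0] flat_0_bounds(2)[of y] False mult_left_le[of "flat 0 y" x] by simp
  qed (simp add: z)
qed

lemma hinge_nonneg: "hinge x \<ge> 0" and hinge_le: "hinge x \<le> (max 0 x)^2" and hinge_pos: "x > 0 \<Longrightarrow> hinge x > 0"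
  and hinge_0: "x \<le> 0 \<Longrightarrow> hinge x = 0"
proof -
  note c = smooth_on_imp_continuous_on[OF smooth_on_hinge']
  have z': "hinge' y = 0" if "y \<le> 0" for y using hinge'_nonneg[of y] hinge'_le[of y] that by simp
  show z: "hinge y = 0" if "y \<le> 0" for y
    using antideriv_const[OF c, of y 0] antideriv(1)[OF c] that z' by (simp add: hinge_def)
  show p: "hinge x > 0" if "x > 0" for x
    unfolding hinge_def by (rule antideriv_pos[OF c _ _ that, of 1]) (auto simp: hinge'_nonneg hinge'_pos)
  show "hinge x \<ge> 0" using z[of x] p[of x] by fastforce
  show "hinge x \<le> (max 0 x)^2"
  proof (cases "x \<le> 0")
    case False
    then obtain y where y: "0 < y" "y < x" "hinge x - hinge 0 = (x - 0) * hinge' y"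
      using MVT2[of 0 x hinge hinge'] hinge_derivative(1) by force
    have "hinge' y \<le> x" using hinge'_le[of y] y by simp
    then have "x * hinge' y \<le> x * x" using False by (intro mult_left_mono) auto
    then show ?thesis using z[of 0] y False by (simp add: power2_eq_square max_def)
  qed (simp add: z)
qed

section \<open>Weak derivatives and the Sobolev norm\<close>

lemma smooth_on_vec_nth: "diff_unique S \<Longrightarrow> smooth_on S (\<lambda>x. x $ i)" for S :: "(real^'n) set"
  by (intro smooth_on_linear bounded_linear_vec_nth)

lemma smooth_on_step_affine:
  assumes "diff_unique S" "smooth_on S f"
  shows "smooth_on S (\<lambda>x. step (c * f x + d))" "smooth_on S (\<lambda>x. step' (c * f x + d))"
proof -
  have "smooth_on S (\<lambda>x. c * f x + d)" by (intro smooth_on_add smooth_on_mult smooth_on_const assms)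
  then show "smooth_on S (\<lambda>x. step (c * f x + d))" "smooth_on S (\<lambda>x. step' (c * f x + d))"
    using smooth_on_compose[OF assms(1) smooth_on_step] smooth_on_compose[OF assms(1) smooth_on_step'] by auto
qed

text \<open>
  Test functions that converge to the indicator function of a box as \<open>n\<close> tends to infinity.
\<close>

definition box_bump :: "real^3 \<Rightarrow> real^3 \<Rightarrow> nat \<Rightarrow> real^3 \<Rightarrow> real" where
  "box_bump a b n x = (\<Prod>i\<in>UNIV. step (real n * x $ i + - real n * a $ i) * step (- real n * x $ i + real n * b $ i))"

lemma box_bump_bounds: "0 \<le> box_bump a b n x" "box_bump a b n x \<le> 1"
  unfolding box_bump_def by (auto intro!: prod_nonneg prod_le_1 mult_nonneg_nonneg mult_le_one step_bounds)

lemma box_bump_outside: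
  assumes "x \<notin> box a b" shows "box_bump a b n x = 0"
proof -
  obtain i where "x $ i \<le> a $ i \<or> b $ i \<le> x $ i" using assms by (auto simp: mem_box_cart not_less)
  then have "step (real n * x $ i + - real n * a $ i) * step (- real n * x $ i + real n * b $ i) = 0"
    using step_le_0[of "real n * x $ i + - real n * a $ i"] step_le_0[of "- real n * x $ i + real n * b $ i"]
      mult_left_mono[of "x $ i" "a $ i" "real n"] mult_left_mono[of "b $ i" "x $ i" "real n"] by auto
  then show ?thesis unfolding box_bump_def by (intro prod_zero) auto
qed

lemma test_function_box_bump: "test_function (box_bump a b n)"
  unfolding test_function_def
proof
  show "smooth_on UNIV (box_bump a b n)"
    unfolding box_bump_def[abs_def]
    by (intro smooth_on_prod smooth_on_mult smooth_on_step_affine smooth_on_vec_nth du_UNIV)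
  have "{x. box_bump a b n x \<noteq> 0} \<subseteq> cbox a b" using box_bump_outside[of _ a b n] box_subset_cbox by blast
  then have "bounded {x. box_bump a b n x \<noteq> 0}" using bounded_cbox bounded_subset by blast
  then show "compact (closure {x. box_bump a b n x \<noteq> 0})" by (simp add: compact_closure)
qed

lemma box_bump_tendsto: "(\<lambda>n. box_bump a b n x) \<longlonglongrightarrow> indicator (box a b) x"
proof (cases "x \<in> box a b")
  case False then show ?thesis by (simp add: box_bump_outside)
next
  case True
  have t: "(\<lambda>n. step (real n * c)) \<longlonglongrightarrow> 1" if "c > 0" for c
  proof (rule tendsto_eventually)
    obtain N :: nat where N: "1 / c < N" using reals_Archimedean2 by blast
    have "1 \<le> real n * c" if "n \<ge> N" for n
    proof -
      have "1 < real N * c" using N \<open>c > 0\<close> by (simp add: field_simps)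
      also have "\<dots> \<le> real n * c" using that \<open>c > 0\<close> by (intro mult_right_mono) auto
      finally show ?thesis by simp
    qed
    then show "\<forall>\<^sub>F n in sequentially. step (real n * c) = 1"
      using step_ge_1 by (auto simp: eventually_sequentially)
  qed
  have "(\<lambda>n. step (real n * (x $ i - a $ i)) * step (real n * (b $ i - x $ i))) \<longlonglongrightarrow> 1 * 1" for i
    using True by (intro tendsto_mult t) (auto simp: mem_box_cart)
  then have "(\<lambda>n. box_bump a b n x) \<longlonglongrightarrow> (\<Prod>i\<in>(UNIV::3 set). 1 * 1)"
    unfolding box_bump_def by (intro tendsto_prod) (simp add: algebra_simps)
  then show ?thesis using True by simp
qed

lemma box_integral_zero:
  fixes h :: "real^3 \<Rightarrow> 'b::euclidean_space"
  assumes h: "locally_integrable h" and z: "\<And>\<phi>. test_function \<phi> \<Longrightarrow> (\<integral>x. \<phi> x *\<^sub>R h x \<partial>lborel) = 0"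
  shows "(LINT x:box a b|lborel. h x) = 0"
proof -
  have int: "integrable lborel (\<lambda>x. indicat_real (cbox a b) x *\<^sub>R h x)"
    using h by (simp add: locally_integrable_def set_integrable_def)
  have int': "integrable lborel (\<lambda>x. indicat_real (box a b) x *\<^sub>R h x)"
  proof -
    have "(\<lambda>x. indicat_real (box a b) x *\<^sub>R (indicat_real (cbox a b) x *\<^sub>R h x)) = (\<lambda>x. indicat_real (box a b) x *\<^sub>R h x)"
      using box_subset_cbox[of a b] by (auto simp: indicator_def fun_eq_iff)
    with integrable_mult_indicator[OF _ int, of "box a b"] show ?thesis by simp
  qed
  have m: "box_bump a b n \<in> borel_measurable borel" for n
    using test_function_box_bump[of a b n]
    by (auto simp: test_function_def intro!: borel_measurable_continuous_onI smooth_on_imp_continuous_on)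
  have eq: "box_bump a b n x *\<^sub>R h x = box_bump a b n x *\<^sub>R (indicat_real (box a b) x *\<^sub>R h x)" for n x
    using box_bump_outside[of x a b n] by (cases "x \<in> box a b") auto
  have "(\<lambda>n. \<integral>x. box_bump a b n x *\<^sub>R h x \<partial>lborel) \<longlonglongrightarrow> (\<integral>x. indicat_real (box a b) x *\<^sub>R h x \<partial>lborel)"
  proof (rule integral_dominated_convergence)
    show "(\<lambda>x. indicat_real (box a b) x *\<^sub>R h x) \<in> borel_measurable lborel" using int' by auto
    show "(\<lambda>x. box_bump a b n x *\<^sub>R h x) \<in> borel_measurable lborel" for n
      unfolding eq by (rule borel_measurable_scaleR) (use m borel_measurable_integrable[OF int'] in auto)
    show "integrable lborel (\<lambda>x. norm (indicat_real (box a b) x *\<^sub>R h x))" using int' by (rule integrable_norm)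
    show "AE x in lborel. (\<lambda>n. box_bump a b n x *\<^sub>R h x) \<longlonglongrightarrow> indicat_real (box a b) x *\<^sub>R h x"
      by (intro AE_I2 tendsto_scaleR box_bump_tendsto tendsto_const)
    show "AE x in lborel. norm (box_bump a b n x *\<^sub>R h x) \<le> norm (indicat_real (box a b) x *\<^sub>R h x)" for n
      unfolding eq using box_bump_bounds[of a b n] by (intro AE_I2) (simp add: mult_left_le_one_le mult.assoc)
  qed
  then show ?thesis
    unfolding z[OF test_function_box_bump] set_lebesgue_integral_def
    by (rule LIMSEQ_unique[OF tendsto_const, symmetric])
qed

text \<open>
  Boxes form a generator of the Borel sets that is stable under intersections, so vanishing integrals extend
  from boxes to all Borel sets.
\<close>

lemma set_integral_zero_if_box:
  fixes k :: "real^3 \<Rightarrow> 'b::euclidean_space"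
  assumes k: "integrable lborel k" and z: "\<And>a b. (LINT x:box a b|lborel. k x) = 0" and tot: "(\<integral>x. k x \<partial>lborel) = 0"
    and A: "A \<in> sets lborel"
  shows "(LINT x:A|lborel. k x) = 0"
proof -
  let ?G = "range (\<lambda>(a, b). box a b :: (real^3) set)"
  have sets: "sets lborel = sigma_sets UNIV ?G" by (simp add: borel_eq_box)
  have si: "set_integrable lborel B k" if "B \<in> sets lborel" for B
    unfolding set_integrable_def using k that by (simp add: integrable_mult_indicator)
  have "Int_stable ?G" by (auto simp: Int_stable_def box_Int_box)
  moreover have "?G \<subseteq> Pow UNIV" by simp
  moreover have "A \<in> sigma_sets UNIV ?G" using A sets by simp
  ultimately show ?thesis
  proof (induction rule: sigma_sets_induct_disjoint)
    case (basic A) then show ?case using z by auto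
  next
    case empty then show ?case by (simp add: set_lebesgue_integral_def)
  next
    case (compl A)
    have A: "A \<in> sets lborel" using compl sets by simp
    have "UNIV - A \<in> sets lborel" using A sets.compl_sets[of A lborel] by simp
    have "(LINT x:(UNIV - A) \<union> A|lborel. k x) = (LINT x:UNIV - A|lborel. k x) + (LINT x:A|lborel. k x)"
      by (rule set_integral_Un) (use si A \<open>UNIV - A \<in> sets lborel\<close> in auto)
    moreover have "(UNIV - A) \<union> A = UNIV" by auto
    ultimately show ?case using compl tot by (simp add: set_lebesgue_integral_def)
  next
    case (union A)
    have A: "A i \<in> sets lborel" for i using union sets by auto
    have "(LINT x:(\<Union>i. A i)|lborel. k x) = (\<Sum>i. (LINT x:(A i)|lborel. k x))"
    proof (rule lebesgue_integral_countable_add)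
      show "A i \<inter> A j = {}" if "i \<noteq> j" for i j using union(1) that by (auto simp: disjoint_family_on_def)
      show "set_integrable lborel (\<Union> (range A)) k" using A by (intro si sets.countable_UN) auto
    qed (rule A)
    then show ?case using union by simp
  qed
qed

text \<open>
  The fundamental lemma of the calculus of variations: testing with \<open>box_bump\<close> gives that the integrals over
  all boxes vanish, hence those over all bounded Borel sets.
\<close>

lemma AE_zero_if_test_zero:
  fixes h :: "real^3 \<Rightarrow> 'b::euclidean_space"
  assumes h: "locally_integrable h" and z: "\<And>\<phi>. test_function \<phi> \<Longrightarrow> (\<integral>x. \<phi> x *\<^sub>R h x \<partial>lborel) = 0"
  shows "AE x in lborel. h x = 0"
proof -
  define B where "B n = (box (\<chi> i. - real n) (\<chi> i. real n) :: (real^3) set)" for n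
  have "AE x in lborel. indicat_real (B n) x *\<^sub>R h x = 0" for n
  proof -
    let ?k = "\<lambda>x. indicat_real (B n) x *\<^sub>R h x"
    have int: "integrable lborel ?k"
    proof -
      have "integrable lborel (\<lambda>x. indicat_real (cbox (\<chi> i. - real n) (\<chi> i. real n)) x *\<^sub>R h x)"
        using h by (simp add: locally_integrable_def set_integrable_def)
      then have "integrable lborel (\<lambda>x. indicat_real (B n) x *\<^sub>R (indicat_real (cbox (\<chi> i. - real n) (\<chi> i. real n)) x *\<^sub>R h x))"
        by (rule integrable_mult_indicator[rotated]) (simp add: B_def)
      moreover have "indicat_real (B n) x *\<^sub>R (indicat_real (cbox (\<chi> i. - real n) (\<chi> i. real n)) x *\<^sub>R h x) = ?k x" for x
        using box_subset_cbox[of "\<chi> i. - real n" "\<chi> i. real n :: real^3"] by (auto simp: indicator_def B_def)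
      ultimately show ?thesis by (simp only:)
    qed
    have "(LINT x:box a b|lborel. ?k x) = 0" for a b
    proof -
      obtain c d where cd: "box a b \<inter> B n = box c d" unfolding B_def box_Int_box by blast
      have "(LINT x:box a b|lborel. ?k x) = (LINT x:box c d|lborel. h x)"
        unfolding set_lebesgue_integral_def cd[symmetric] by (intro Bochner_Integration.integral_cong) (auto simp: indicator_def)
      then show ?thesis using box_integral_zero[OF h z] by simp
    qed
    moreover have "(\<integral>x. ?k x \<partial>lborel) = 0"
      using box_integral_zero[OF h z, of "\<chi> i. - real n" "\<chi> i. real n"] by (simp add: set_lebesgue_integral_def B_def)
    ultimately have "(LINT x:A|lborel. ?k x) = 0" if "A \<in> sets lborel" for A
      using set_integral_zero_if_box[OF int _ _ that] by blast
    then show ?thesis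
      by (intro sigma_finite_measure.density_unique_banach[OF lborel.sigma_finite_measure_axioms int, of "\<lambda>x. 0"]) (simp_all add: set_lebesgue_integral_def)
  qed
  then have "AE x in lborel. \<forall>n. indicat_real (B n) x *\<^sub>R h x = 0" unfolding AE_all_countable by blast
  then show ?thesis
  proof eventually_elim
    case (elim x)
    obtain n where n: "norm x < real n" using reals_Archimedean2 by blast
    have "\<bar>x $ i\<bar> < real n" for i using component_le_norm_cart[of x i] n by simp
    then have "x \<in> B n" unfolding B_def mem_box_cart by (auto simp: abs_less_iff minus_less_iff)
    with elim show ?case by (auto simp: indicator_def)
  qed
qed

lemma weak_derivative_order_zero:
  fixes f g :: "real^3 \<Rightarrow> 'b::euclidean_space"
  assumes "weak_derivative (\<lambda>_. 0) f g"
  shows "AE x in lborel. g x = f x"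
proof -
  have li: "locally_integrable (\<lambda>x. g x - f x)"
    using assms by (auto simp: weak_derivative_def locally_integrable_def)
  have sc: "integrable lborel (\<lambda>x. \<phi> x *\<^sub>R k x)" if k: "locally_integrable k" and \<phi>: "test_function \<phi>" for \<phi> and k :: "real^3 \<Rightarrow> 'b"
  proof -
    let ?K = "closure {x. \<phi> x \<noteq> 0}"
    have K: "compact ?K" and cont: "continuous_on UNIV \<phi>"
      using \<phi> by (auto simp: test_function_def smooth_on_imp_continuous_on)
    have "bounded (\<phi> ` ?K)" by (intro compact_imp_bounded compact_continuous_image K continuous_on_subset[OF cont]) auto
    then obtain C where C: "\<And>x. x \<in> ?K \<Longrightarrow> \<bar>\<phi> x\<bar> \<le> C" by (auto simp: bounded_iff)
    have i: "integrable lborel (\<lambda>x. indicat_real ?K x *\<^sub>R k x)"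
      using k K by (simp add: locally_integrable_def set_integrable_def)
    have eq: "\<phi> x *\<^sub>R k x = \<phi> x *\<^sub>R (indicat_real ?K x *\<^sub>R k x)" for x
      using closure_subset[of "{x. \<phi> x \<noteq> 0}"] by (cases "x \<in> ?K") (auto simp: indicator_def)
    have "integrable lborel (\<lambda>x. \<phi> x *\<^sub>R (indicat_real ?K x *\<^sub>R k x))"
    proof (rule Bochner_Integration.integrable_bound[OF integrable_scaleR_right[OF i, of C]])
      have "\<phi> \<in> borel_measurable lborel" using borel_measurable_continuous_onI[OF cont] by simp
      then show "(\<lambda>x. \<phi> x *\<^sub>R (indicat_real ?K x *\<^sub>R k x)) \<in> borel_measurable lborel"
        using borel_measurable_integrable[OF i] by (rule borel_measurable_scaleR)
      show "AE x in lborel. norm (\<phi> x *\<^sub>R (indicat_real ?K x *\<^sub>R k x)) \<le> norm (C *\<^sub>R (indicat_real ?K x *\<^sub>R k x))"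
      proof (rule AE_I2)
        fix x
        show "norm (\<phi> x *\<^sub>R (indicat_real ?K x *\<^sub>R k x)) \<le> norm (C *\<^sub>R (indicat_real ?K x *\<^sub>R k x))"
          using C[of x] by (cases "x \<in> ?K") (auto intro!: mult_right_mono)
      qed
    qed
    then show ?thesis by (simp only: eq[symmetric])
  qed
  have "AE x in lborel. g x - f x = 0"
  proof (rule AE_zero_if_test_zero[OF li])
    fix \<phi> :: "real^3 \<Rightarrow> real" assume \<phi>: "test_function \<phi>"
    have "(\<integral>x. \<phi> x *\<^sub>R f x \<partial>lborel) = (\<integral>x. \<phi> x *\<^sub>R g x \<partial>lborel)"
      using assms \<phi> by (auto simp: weak_derivative_def multi_partial_def multi_order_def)
    then show "(\<integral>x. \<phi> x *\<^sub>R (g x - f x) \<partial>lborel) = 0"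
      using sc[OF _ \<phi>, of f] sc[OF _ \<phi>, of g] assms
      by (simp add: scaleR_diff_right weak_derivative_def)
  qed
  then show ?thesis by eventually_elim simp
qed

text \<open>
  The Sobolev norm refers to chosen weak derivatives.  The one of order zero is only known to be some weak
  derivative, but it agrees almost everywhere with the function.
\<close>

lemma W2_norm_ge:
  fixes f :: "real^3 \<Rightarrow> 'b::euclidean_space"
  assumes "W2 k f"
  shows "(\<integral>\<^sup>+x. ennreal ((norm (f x))^2) \<partial>lborel) \<le> ennreal ((W2_norm k f)^2)"
proof -
  let ?g = "\<lambda>\<alpha>. (SOME g. weak_derivative \<alpha> f g)"
  have sq: "square_integrable f" using assms by (simp add: W2_def)
  have "\<exists>g. weak_derivative (\<lambda>_. 0) f g" using assms unfolding W2_def by (elim conjE allE[of _ "\<lambda>_. 0"]) (auto simp: multi_order_def)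
  then have wd0: "weak_derivative (\<lambda>_. 0) f (?g (\<lambda>_. 0))" by (rule someI_ex)
  define g0 where "g0 = ?g (\<lambda>_. 0)"
  have wd: "weak_derivative (\<lambda>_. 0) f g0" using wd0 by (simp only: g0_def)
  have fin: "finite {\<alpha>::3 \<Rightarrow> nat. multi_order \<alpha> \<le> k}"
  proof (rule finite_subset)
    show "{\<alpha>::3 \<Rightarrow> nat. multi_order \<alpha> \<le> k} \<subseteq> PiE UNIV (\<lambda>_. {..k})"
    proof
      fix \<alpha> :: "3 \<Rightarrow> nat" assume "\<alpha> \<in> {\<alpha>. multi_order \<alpha> \<le> k}"
      then have "\<alpha> i \<le> k" for i
        using member_le_sum[of i UNIV \<alpha>] unfolding multi_order_def by fastforce
      then show "\<alpha> \<in> PiE UNIV (\<lambda>_. {..k})" by auto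
    qed
    show "finite (PiE UNIV (\<lambda>_::3. {..k}))" by (intro finite_PiE) auto
  qed
  have "(\<integral>x. (norm (f x))\<^sup>2 \<partial>lborel) = (\<integral>x. (norm (g0 x))\<^sup>2 \<partial>lborel)"
  proof (rule integral_cong_AE)
    show "(\<lambda>x. (norm (f x))\<^sup>2) \<in> borel_measurable lborel" using sq by (auto simp: square_integrable_def)
    have "g0 \<in> borel_measurable lborel"
    proof -
      have li: "set_integrable lborel K (g0)" if "compact K" for K
        using wd that by (auto simp: weak_derivative_def locally_integrable_def)
      have "(\<lambda>x. indicat_real (cball 0 (real n)) x *\<^sub>R g0 x) \<in> borel_measurable lborel" for n
        using li[of "cball 0 (real n)"] unfolding set_integrable_def by auto
      then show ?thesis
      proof (rule borel_measurable_LIMSEQ_metric)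
        fix x :: "real^3"
        obtain N where N: "norm x < real N" using reals_Archimedean2 by blast
        then show "(\<lambda>n. indicat_real (cball 0 (real n)) x *\<^sub>R g0 x) \<longlonglongrightarrow> g0 x"
          by (intro tendsto_eventually) (auto simp: eventually_sequentially intro!: exI[of _ N])
      qed
    qed
    then show "(\<lambda>x. (norm (g0 x))\<^sup>2) \<in> borel_measurable lborel" by auto
    show "AE x in lborel. (norm (f x))\<^sup>2 = (norm (g0 x))\<^sup>2"
      using weak_derivative_order_zero[OF wd] by eventually_elim simp
  qed
  also have "\<dots> = (\<integral>x. (norm (?g (\<lambda>_. 0) x))\<^sup>2 \<partial>lborel)" by (simp only: g0_def)
  also have "\<dots> \<le> (\<Sum>\<alpha> | multi_order \<alpha> \<le> k. \<integral>x. (norm (?g \<alpha> x))\<^sup>2 \<partial>lborel)"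
    by (rule member_le_sum[OF _ _ fin]) (auto simp: multi_order_def)
  also have "\<dots> = (W2_norm k f)^2"
    unfolding W2_norm_def by (rule real_sqrt_pow2[symmetric]) (auto intro!: sum_nonneg)
  finally have "ennreal (\<integral>x. (norm (f x))\<^sup>2 \<partial>lborel) \<le> ennreal ((W2_norm k f)^2)" by (rule ennreal_leI)
  moreover have "(\<integral>\<^sup>+x. ennreal ((norm (f x))^2) \<partial>lborel) = ennreal (\<integral>x. (norm (f x))\<^sup>2 \<partial>lborel)"
    using sq by (intro nn_integral_eq_integral) (auto simp: square_integrable_def)
  ultimately show ?thesis by simp
qed

text \<open>
  The integrability assumed of the solution is turned into a bound for the square norm in space and time, the
  quantity that controls the energy argument below.
\<close>

lemma L2_W2_finite:
  assumes "L2_W2 T k w"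
  shows "(\<integral>\<^sup>+t. indicator {0<..<T} t * (\<integral>\<^sup>+x. ennreal ((norm (w t x))^2) \<partial>lborel) \<partial>lborel) < \<infinity>"
proof -
  let ?M = "restrict_space lborel {0<..<T}"
  have ae: "AE t in ?M. W2 k (w t)" and fin: "(\<integral>\<^sup>+ t. ennreal ((W2_norm k (w t))\<^sup>2) \<partial>?M) < \<infinity>"
    using assms by (auto simp: L2_W2_def Let_def)
  have "(\<integral>\<^sup>+t. (\<integral>\<^sup>+x. ennreal ((norm (w t x))^2) \<partial>lborel) \<partial>?M) \<le> (\<integral>\<^sup>+ t. ennreal ((W2_norm k (w t))\<^sup>2) \<partial>?M)"
    by (rule nn_integral_mono_AE) (use ae in eventually_elim, rule W2_norm_ge)
  also note fin
  finally show ?thesis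
    by (subst (asm) nn_integral_restrict_space) (auto simp: mult.commute)
qed

context strip begin

lemma continuous_on_slice:
  assumes "continuous_on (UNIV \<times> J) f" "t \<in> J"
  shows "continuous_on S (\<lambda>x. f (x, t))"
  by (rule continuous_on_compose2[OF assms(1)]) (use assms(2) in \<open>auto intro!: continuous_intros\<close>)

text \<open>
  The divergence theorem for functions with support in a cube.  Translating the cube by \<open>h\<close> does not change
  the integral, and differentiation under the integral sign turns this into the claim.
\<close>

lemma integral_dx_zero:
  fixes F :: "(real^3) \<times> real \<Rightarrow> real"
  assumes F: "smooth F" and t: "t \<in> I" and supp: "\<And>x i. \<rho> < \<bar>x $ i\<bar> \<Longrightarrow> F (x, t) = 0"
  shows "integral (cbox (\<chi> i. - \<rho> - 1) (\<chi> i. \<rho> + 1)) (\<lambda>x. dx j F (x, t)) = 0"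
proof -
  let ?a = "(\<chi> i. - \<rho> - 1) :: real^3" and ?b = "(\<chi> i. \<rho> + 1) :: real^3"
  let ?c = "axis j 1 :: real^3"
  have contF: "continuous_on S (\<lambda>x. F (x, t))" for S
    by (rule continuous_on_slice[OF smooth_on_imp_continuous_on[OF F] t])
  have contD: "continuous_on (UNIV \<times> I) (dx j F)"
    by (rule smooth_on_imp_continuous_on[OF smooth_dx[OF F]])
  define K where "K = integral (cbox (\<chi> i. - \<rho>) (\<chi> i. \<rho>)) (\<lambda>x. F (x, t))"
  have const: "integral (cbox ?a ?b) (\<lambda>x. F (x + h *\<^sub>R ?c, t)) = K" if h: "h \<in> {-1..1}" for h
  proof -
    have sub: "cbox (\<chi> i. - \<rho>) (\<chi> i. \<rho>) \<subseteq> cbox (?a + h *\<^sub>R ?c) (?b + h *\<^sub>R ?c)"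
    proof
      fix x :: "real^3" assume "x \<in> cbox (\<chi> i. - \<rho>) (\<chi> i. \<rho>)"
      then have x: "- \<rho> \<le> x $ i" "x $ i \<le> \<rho>" for i by (auto simp: mem_box_cart)
      have "\<bar>(h *\<^sub>R ?c) $ i\<bar> \<le> 1" for i using h by (auto simp: axis_def)
      then have hc: "- 1 \<le> (h *\<^sub>R ?c) $ i" "(h *\<^sub>R ?c) $ i \<le> 1" for i by (metis abs_le_D2 minus_le_iff, metis abs_le_D1)
      show "x \<in> cbox (?a + h *\<^sub>R ?c) (?b + h *\<^sub>R ?c)"
        unfolding mem_box_cart
      proof
        fix i
        show "(?a + h *\<^sub>R ?c) $ i \<le> x $ i \<and> x $ i \<le> (?b + h *\<^sub>R ?c) $ i"
          using x[of i] hc[of i] unfolding vector_add_component by simp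
      qed
    qed
    have "((\<lambda>x. F (x, t)) has_integral K) (cbox (\<chi> i. - \<rho>) (\<chi> i. \<rho>))"
      unfolding K_def by (rule integrable_integral[OF integrable_continuous[OF contF]])
    then have "((\<lambda>x. F (x, t)) has_integral K) (cbox (?a + h *\<^sub>R ?c) (?b + h *\<^sub>R ?c))"
    proof (rule has_integral_on_superset[OF _ _ sub])
      fix x :: "real^3" assume "x \<notin> cbox (\<chi> i. - \<rho>) (\<chi> i. \<rho>)"
      have "\<not> (\<forall>i. \<bar>x $ i\<bar> \<le> \<rho>)"
      proof
        assume "\<forall>i. \<bar>x $ i\<bar> \<le> \<rho>"
        then have "- \<rho> \<le> x $ i \<and> x $ i \<le> \<rho>" for i by (metis abs_le_D1 abs_le_D2 minus_le_iff)
        with \<open>x \<notin> cbox (\<chi> i. - \<rho>) (\<chi> i. \<rho>)\<close> show False by (simp add: mem_box_cart)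
      qed
      then obtain i where "\<rho> < \<bar>x $ i\<bar>" by (auto simp: not_le)
      then show "F (x, t) = 0" by (rule supp)
    qed
    then have "((\<lambda>x. F (x + h *\<^sub>R ?c, t)) has_integral K) (cbox (?a + h *\<^sub>R ?c - h *\<^sub>R ?c) (?b + h *\<^sub>R ?c - h *\<^sub>R ?c))"
      by (rule has_integral_shift_cbox)
    then show ?thesis by (simp add: integral_unique)
  qed
  have "((\<lambda>h. integral (cbox ?a ?b) (\<lambda>x. F (x + h *\<^sub>R ?c, t))) has_vector_derivative
      integral (cbox ?a ?b) (\<lambda>x. dx j F (x + 0 *\<^sub>R ?c, t))) (at 0 within {-1..1})"
  proof (rule leibniz_rule_vector_derivative)
    show "((\<lambda>h. F (x + h *\<^sub>R ?c, t)) has_vector_derivative dx j F (x + h *\<^sub>R ?c, t)) (at h within {-1..1})" for h x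
      using dx_real_at[OF F t, of x j h]
      by (simp add: has_real_derivative_iff_has_vector_derivative has_vector_derivative_at_within)
    show "(\<lambda>x. F (x + h *\<^sub>R ?c, t)) integrable_on cbox ?a ?b" for h
      by (intro integrable_continuous continuous_on_compose2[OF contF[of UNIV]] continuous_intros) auto
    show "continuous_on ({-1..1} \<times> cbox ?a ?b) (\<lambda>(h, x). dx j F (x + h *\<^sub>R ?c, t))"
      unfolding split_beta by (rule continuous_on_compose2[OF contD]) (use t in \<open>auto intro!: continuous_intros\<close>)
  qed auto
  then have 1: "((\<lambda>h. K) has_vector_derivative integral (cbox ?a ?b) (\<lambda>x. dx j F (x, t))) (at 0 within {-1..1})"
    unfolding scale_zero_left add_0_right
    by (rule has_vector_derivative_transform[rotated 2]) (use const in auto)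
  show ?thesis
    using vector_derivative_unique_within[OF _ 1 has_vector_derivative_const] by (simp add: trivial_limit_within islimpt_Icc)
qed

end

section \<open>Spatial cutoff functions\<close>

text \<open>
  The cutoff is \<open>1\<close> on the ball of radius \<open>R\<close> and \<open>0\<close> outside the ball of radius \<open>2 R\<close>.  It is a function of
  \<open>|x|^2\<close>, which keeps it smooth at the origin.
\<close>

definition cutoff :: "real \<Rightarrow> (real^3) \<times> real \<Rightarrow> real" where
  "cutoff R z = step (2 - (\<Sum>i\<in>UNIV. (fst z $ i)^2) / R^2)"

definition step'' :: "real \<Rightarrow> real" where
  "step'' x = (flat 2 x * flat 0 (1 - x) - flat 0 x * flat 2 (1 - x)) / step_mass"

lemma step'_derivative: "(step' has_real_derivative step'' x) (at x)"
proof -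
  have f: "(flat 0 has_real_derivative flat 2 y) (at y)" for y
    using flat_derivative[of 0 y] by (simp add: numeral_2_eq_2)
  have "((\<lambda>x. flat 0 (1 - x)) has_real_derivative flat 2 (1 - x) * (0 - 1)) (at x)"
    by (rule DERIV_chain2[OF f]) (auto intro!: derivative_eq_intros)
  then show ?thesis
    unfolding step'_def[abs_def] bump_def[abs_def] step''_def using step_mass_pos
    by (auto intro!: derivative_eq_intros f simp: field_simps)
qed

lemma step''_bounded: "\<exists>C>0. \<forall>x. \<bar>step'' x\<bar> \<le> C"
proof -
  have c: "continuous_on S (flat n)" for S n using cont_flat continuous_on_subset by blast
  have "continuous_on {0..1} step''"
    unfolding step''_def[abs_def] using step_mass_pos
    by (intro continuous_intros c continuous_on_compose2[OF c[of UNIV]]) auto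
  then have "bounded (step'' ` {0..1})" by (intro compact_imp_bounded compact_continuous_image) auto
  then obtain C where C: "\<forall>x\<in>{0..1}. \<bar>step'' x\<bar> \<le> C" by (auto simp: bounded_iff)
  have "\<bar>step'' x\<bar> \<le> max C 1" for x
    using C by (cases "x \<in> {0..1}") (force, auto simp: step''_def flat_def)
  then show ?thesis by (intro exI[of _ "max C 1"]) auto
qed

lemma norm_sq_sum: "(\<Sum>i\<in>UNIV. (x $ i)^2) = (norm x)^2" for x :: "real^3"
  by (simp add: norm_vec_def L2_set_def sum_nonneg)

lemma cutoff_bounds: "0 \<le> cutoff R z" "cutoff R z \<le> 1"
  by (simp_all add: cutoff_def step_bounds)

lemma cutoff_eq_1: "R > 0 \<Longrightarrow> norm x \<le> R \<Longrightarrow> cutoff R (x, t) = 1"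
  unfolding cutoff_def norm_sq_sum fst_conv by (rule step_ge_1) (simp add: power_mono)

lemma cutoff_eq_0: "R > 0 \<Longrightarrow> norm x \<ge> 2 * R \<Longrightarrow> cutoff R (x, t) = 0"
proof -
  assume R: "R > 0" and x: "norm x \<ge> 2 * R"
  have "2 * R^2 \<le> (2 * R)^2" by (simp add: power2_eq_square)
  also have "\<dots> \<le> (norm x)^2" using x R by (intro power_mono) auto
  finally show ?thesis unfolding cutoff_def norm_sq_sum fst_conv using R by (intro step_le_0) (simp add: field_simps)
qed

lemma smooth_on_cutoff_arg: "diff_unique S \<Longrightarrow> smooth_on S (\<lambda>z::(real^3) \<times> real. 2 - (\<Sum>i\<in>UNIV. (fst z $ i)^2) / R^2)"
  unfolding divide_inverse
  by (intro smooth_on_diff smooth_on_const smooth_on_mult smooth_on_sum smooth_on_power smooth_on_coord)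

lemma smooth_on_cutoff: "diff_unique S \<Longrightarrow> smooth_on S (cutoff R)"
  using smooth_on_compose[OF _ smooth_on_step smooth_on_cutoff_arg, of S R] by (simp add: cutoff_def[abs_def])

context strip begin

lemma dx_cutoff_arg:
  assumes "t \<in> I"
  shows "dx k (\<lambda>z. 2 - (\<Sum>i\<in>UNIV. (fst z $ i)^2) / R^2) (x, t) = - 2 * x $ k / R^2"
proof -
  have "((\<lambda>h. (\<Sum>i\<in>UNIV. ((x + h *\<^sub>R axis k 1) $ i)^2)) has_real_derivative (\<Sum>i\<in>UNIV. 2 * x $ i * axis k 1 $ i)) (at 0)"
    by (intro DERIV_sum) (auto intro!: derivative_eq_intros)
  also have "(\<Sum>i\<in>UNIV. 2 * x $ i * axis k 1 $ i) = 2 * x $ k" by (simp add: axis_def if_distrib[of "(*) _"] cong: if_cong)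
  finally show ?thesis
    using DERIV_diff[OF DERIV_const DERIV_cdivide, of _ _ 0 UNIV 2 "R^2"] by (intro dx_realI) simp
qed

lemma dx_cutoff:
  assumes "t \<in> I" shows "dx k (cutoff R) (x, t) = step' (2 - (norm x)^2 / R^2) * (- 2 * x $ k / R^2)"
  unfolding cutoff_def[abs_def]
  by (subst dx_compose[OF assms smooth_on_cutoff_arg[OF du] step_derivative])
    (simp only: dx_cutoff_arg[OF assms], simp add: norm_sq_sum)

lemma dxdx_cutoff:
  assumes t: "t \<in> I"
  shows "dx k (dx k (cutoff R)) (x, t) = step'' (2 - (norm x)^2 / R^2) * (2 * x $ k / R^2)^2 + step' (2 - (norm x)^2 / R^2) * (- 2 / R^2)"
proof -
  interpret strip_L I 0 "\<lambda>_. 0" by unfold_locales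
  let ?f = "\<lambda>z::(real^3)\<times>real. 2 - (\<Sum>i\<in>UNIV. (fst z $ i)^2) / R^2"
  have "dx k (dx k ?f) (x, t) = dx k (\<lambda>z. (- 2 / R^2) * (fst z $ k)) (x, t)"
    by (rule dx_cong) (simp add: dx_cutoff_arg[OF t])
  also have "\<dots> = - 2 / R^2" by (subst dx_cmult[OF t]) (auto intro: smooth_intros simp: dx_coord)
  finally have dd: "dx k (dx k ?f) (x, t) = - 2 / R^2" .
  show ?thesis unfolding cutoff_def[abs_def]
    by (subst dxdx_compose[OF t smooth_on_cutoff_arg[OF du] step_derivative step'_derivative smooth_on_step'])
      (simp only: dd dx_cutoff_arg[OF t], simp add: norm_sq_sum)
qed

lemma dx_cutoff_inner: "t \<in> I \<Longrightarrow> R > 0 \<Longrightarrow> norm x \<le> R \<Longrightarrow> dx k (cutoff R) (x, t) = 0"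
  by (subst dx_cutoff) (auto intro!: step'_bounds(4) simp: power_mono)

lemma dx_cutoff_bound:
  assumes t: "t \<in> I" and R: "R > 0"
  shows "\<bar>dx k (cutoff R) (x, t)\<bar> \<le> 4 / (step_mass * R)"
proof (cases "norm x \<le> 2 * R")
  case True
  have "\<bar>x $ k\<bar> \<le> 2 * R" using component_le_norm_cart[of x k] True by simp
  then have "\<bar>- 2 * x $ k / R^2\<bar> \<le> 4 / R" using R by (simp add: abs_mult field_simps power2_eq_square)
  moreover have "\<bar>step' (2 - (norm x)^2 / R^2)\<bar> \<le> 1 / step_mass" using step'_bounds by simp
  ultimately have "\<bar>step' (2 - (norm x)^2 / R^2) * (- 2 * x $ k / R^2)\<bar> \<le> 1 / step_mass * (4 / R)"
    unfolding abs_mult[of "step' _"] using step_mass_pos by (intro mult_mono) auto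
  then show ?thesis by (simp add: dx_cutoff[OF t])
next
  case False
  have "2 * R^2 \<le> (2 * R)^2" by (simp add: power2_eq_square)
  also have "\<dots> \<le> (norm x)^2" using False R by (intro power_mono) auto
  finally have "step' (2 - (norm x)^2 / R^2) = 0" using R by (intro step'_bounds(3)) (simp add: field_simps)
  then show ?thesis using step_mass_pos R by (simp add: dx_cutoff[OF t])
qed

text \<open>
  The constant does not depend on \<open>R\<close>; this decay is what makes the localisation error disappear.
\<close>

lemma laplace_cutoff_bound:
  shows "\<exists>C>0. \<forall>R>0. \<forall>t\<in>I. \<forall>x. \<bar>\<Sum>k\<in>UNIV. dx k (dx k (cutoff R)) (x, t)\<bar> \<le> C / R^2"
proof -
  obtain C where C: "C > 0" "\<And>x. \<bar>step'' x\<bar> \<le> C" using step''_bounded by blast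
  have "\<bar>\<Sum>k\<in>UNIV. dx k (dx k (cutoff R)) (x, t)\<bar> \<le> (3 * (16 * C + 2 / step_mass)) / R^2" if R: "R > 0" and t: "t \<in> I" for R t x
  proof -
    have k: "\<bar>dx k (dx k (cutoff R)) (x, t)\<bar> \<le> (16 * C + 2 / step_mass) / R^2" for k
    proof (cases "norm x \<le> 2 * R")
      case True
      have "\<bar>x $ k\<bar> \<le> 2 * R" using component_le_norm_cart[of x k] True by simp
      then have "\<bar>2 * x $ k / R^2\<bar> \<le> 4 / R" using R by (simp add: abs_mult field_simps power2_eq_square)
      then have "\<bar>2 * x $ k / R^2\<bar>^2 \<le> (4 / R)^2" by (intro power_mono) auto
      then have sq: "(2 * x $ k / R^2)^2 \<le> 16 / R^2" by (simp only: power2_abs) (simp add: power_divide)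
      have "\<bar>step'' (2 - (norm x)^2 / R^2) * (2 * x $ k / R^2)^2\<bar> \<le> C * (16 / R^2)"
        unfolding abs_mult[of "step'' _"] using sq C by (intro mult_mono) auto
      moreover have "\<bar>step' (2 - (norm x)^2 / R^2) * (- 2 / R^2)\<bar> \<le> 1 / step_mass * (2 / R^2)"
        unfolding abs_mult[of "step' _"] using step'_bounds step_mass_pos by (intro mult_mono) auto
      ultimately show ?thesis unfolding dxdx_cutoff[OF t]
        by (intro order_trans[OF abs_triangle_ineq]) (simp add: add_divide_distrib mult.commute[of C])
    next
      case False
      have "2 * R^2 \<le> (2 * R)^2" by (simp add: power2_eq_square)
      also have "\<dots> \<le> (norm x)^2" using False R by (intro power_mono) auto
      finally have le: "2 - (norm x)^2 / R^2 \<le> 0" using R by (simp add: field_simps)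
      then have "step' (2 - (norm x)^2 / R^2) = 0" "step'' (2 - (norm x)^2 / R^2) = 0"
        by (simp_all add: step'_bounds step''_def flat_def)
      then show ?thesis using C step_mass_pos R by (simp add: dxdx_cutoff[OF t])
    qed
    have "\<bar>\<Sum>k\<in>UNIV. dx k (dx k (cutoff R)) (x, t)\<bar> \<le> (\<Sum>k\<in>(UNIV::3 set). (16 * C + 2 / step_mass) / R^2)"
      by (rule order_trans[OF sum_abs sum_mono[OF k]])
    then show ?thesis by simp
  qed
  then show ?thesis using C step_mass_pos
    by (intro exI[of _ "3 * (16 * C + 2 / step_mass)"]) (auto intro!: add_pos_pos)
qed

end

section \<open>A maximum principle for square integrable functions\<close>

lemma continuous_on_swap:
  assumes "continuous_on (UNIV \<times> J) f"
  shows "continuous_on (J \<times> S) (\<lambda>(t, x). f (x, t))"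
proof -
  have "continuous_on (J \<times> S) (\<lambda>p. f (snd p, fst p))"
    by (rule continuous_on_compose2[OF assms, of _ "\<lambda>p. (snd p, fst p)"]) (auto intro!: continuous_intros)
  then show ?thesis by (simp add: split_beta)
qed

lemma nn_integral_continuous_box:
  fixes f :: "'a::euclidean_space \<Rightarrow> real"
  assumes "continuous_on (cbox a b) f" "\<And>x. x \<in> cbox a b \<Longrightarrow> f x \<ge> 0"
  shows "ennreal (integral (cbox a b) f) = (\<integral>\<^sup>+x. ennreal (indicator (cbox a b) x * f x) \<partial>lborel)"
proof -
  have i: "set_integrable lborel (cbox a b) f"
    unfolding set_integrable_def by (rule borel_integrable_compact) (use assms in auto)
  have "integral (cbox a b) f = (\<integral>x. indicator (cbox a b) x * f x \<partial>lborel)"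
    using set_borel_integral_eq_integral(2)[OF i] by (simp add: set_lebesgue_integral_def)
  moreover have "(\<integral>\<^sup>+x. ennreal (indicator (cbox a b) x * f x) \<partial>lborel) = ennreal (\<integral>x. indicator (cbox a b) x * f x \<partial>lborel)"
    by (rule nn_integral_eq_integral) (use i assms(2) in \<open>auto simp: set_integrable_def indicator_def\<close>)
  ultimately show ?thesis by simp
qed

locale drift =
  fixes \<nu> :: real and u :: "(real^3) \<times> real \<Rightarrow> real^3"
  assumes nu: "\<nu> > 0"
    and u_smooth_vec: "smooth_on UNIV u"
    and u_div: "\<And>x t. (\<Sum>i\<in>UNIV. dx i (\<lambda>z. u z $ i) (x, t)) = 0"
    and u_supp: "\<exists>\<rho>>0. \<forall>z. norm z > \<rho> \<longrightarrow> u z = 0"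
begin

lemma u_smooth: "smooth_on UNIV (\<lambda>z. u z $ i)"
  by (rule smooth_on_nth[OF du_UNIV u_smooth_vec])

end

locale drift_strip = drift + strip_L
begin

lemma u_smooth': "smooth (\<lambda>z. u z $ i)"
  by (rule smooth_on_restrict[OF u_smooth du]) simp

text \<open>
  The pointwise identity behind the energy estimate.  The fluxes \<open>X k\<close> are compactly supported, so their
  divergence integrates to zero; the hypothesis \<open>un\<close> holds when the cutoff is constant on the support of the
  drift, and divergence-freeness of the drift removes its remaining contribution.
\<close>

lemma flux_divergence:
  assumes v: "smooth v" and t: "t \<in> I" and un: "\<And>k. u (x, t) $ k * dx k (cutoff R) (x, t) = 0"
  defines "X k \<equiv> (\<lambda>z. cutoff R z * (\<nu> * (hinge' (v z) * dx k v z) - u z $ k * hinge (v z)) - \<nu> * (hinge (v z) * dx k (cutoff R) z))"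
  shows "(\<Sum>k\<in>UNIV. dx k (X k) (x, t)) = cutoff R (x, t) * hinge' (v (x, t)) * (dt v (x, t) - L v (x, t))
     + \<nu> * cutoff R (x, t) * flat 0 (v (x, t)) * (\<Sum>k\<in>UNIV. (dx k v (x, t))^2)
     - \<nu> * hinge (v (x, t)) * (\<Sum>k\<in>UNIV. dx k (dx k (cutoff R)) (x, t))"
proof -
  let ?\<eta> = "cutoff R"
  have sm: "smooth ?\<eta>" "smooth (\<lambda>z. hinge (v z))" "smooth (\<lambda>z. hinge' (v z))"
    using smooth_on_compose[OF du smooth_on_hinge v] smooth_on_compose[OF du smooth_on_hinge' v] smooth_on_cutoff[OF du] by auto
  have k: "dx k (X k) (x, t) = ?\<eta> (x, t) * (\<nu> * (flat 0 (v (x, t)) * (dx k v (x, t))^2 + hinge' (v (x, t)) * dx k (dx k v) (x, t))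
      - dx k (\<lambda>z. u z $ k) (x, t) * hinge (v (x, t)) - u (x, t) $ k * (hinge' (v (x, t)) * dx k v (x, t)))
      - \<nu> * hinge (v (x, t)) * dx k (dx k ?\<eta>) (x, t)" for k
  proof -
    have "dx k (X k) (x, t) = dx k (\<lambda>z. ?\<eta> z * (\<nu> * (hinge' (v z) * dx k v z) - u z $ k * hinge (v z))) (x, t)
      - dx k (\<lambda>z. \<nu> * (hinge (v z) * dx k ?\<eta> z)) (x, t)"
      unfolding X_def by (intro dx_diff t smooth_intros(1-11) sm v u_smooth')
    also have "dx k (\<lambda>z. \<nu> * (hinge (v z) * dx k ?\<eta> z)) (x, t) = \<nu> * dx k (\<lambda>z. hinge (v z) * dx k ?\<eta> z) (x, t)"
      by (intro dx_cmult t smooth_intros(1-11) sm v u_smooth')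
    also have "dx k (\<lambda>z. hinge (v z) * dx k ?\<eta> z) (x, t) = hinge (v (x, t)) * dx k (dx k ?\<eta>) (x, t) + dx k ?\<eta> (x, t) * dx k (\<lambda>z. hinge (v z)) (x, t)"
      by (intro dx_mult t smooth_intros(1-11) sm v)
    also have "dx k (\<lambda>z. ?\<eta> z * (\<nu> * (hinge' (v z) * dx k v z) - u z $ k * hinge (v z))) (x, t)
      = ?\<eta> (x, t) * dx k (\<lambda>z. \<nu> * (hinge' (v z) * dx k v z) - u z $ k * hinge (v z)) (x, t)
       + (\<nu> * (hinge' (v (x, t)) * dx k v (x, t)) - u (x, t) $ k * hinge (v (x, t))) * dx k ?\<eta> (x, t)"
      by (intro dx_mult t smooth_intros(1-11) sm v u_smooth')
    also have "dx k (\<lambda>z. \<nu> * (hinge' (v z) * dx k v z) - u z $ k * hinge (v z)) (x, t)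
      = dx k (\<lambda>z. \<nu> * (hinge' (v z) * dx k v z)) (x, t) - dx k (\<lambda>z. u z $ k * hinge (v z)) (x, t)"
      by (intro dx_diff t smooth_intros(1-11) sm v u_smooth')
    also have "dx k (\<lambda>z. \<nu> * (hinge' (v z) * dx k v z)) (x, t) = \<nu> * dx k (\<lambda>z. hinge' (v z) * dx k v z) (x, t)"
      by (intro dx_cmult t smooth_intros(1-11) sm v u_smooth')
    also have "dx k (\<lambda>z. hinge' (v z) * dx k v z) (x, t) = hinge' (v (x, t)) * dx k (dx k v) (x, t) + dx k v (x, t) * dx k (\<lambda>z. hinge' (v z)) (x, t)"
      by (intro dx_mult t smooth_intros(1-11) sm v u_smooth')
    also have "dx k (\<lambda>z. u z $ k * hinge (v z)) (x, t) = u (x, t) $ k * dx k (\<lambda>z. hinge (v z)) (x, t) + hinge (v (x, t)) * dx k (\<lambda>z. u z $ k) (x, t)"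
      by (intro dx_mult t smooth_intros(1-11) sm v u_smooth')
    also have "dx k (\<lambda>z. hinge (v z)) (x, t) = hinge' (v (x, t)) * dx k v (x, t)"
      by (rule dx_compose[OF t v hinge_derivative(1)])
    also have "dx k (\<lambda>z. hinge' (v z)) (x, t) = flat 0 (v (x, t)) * dx k v (x, t)"
      by (rule dx_compose[OF t v hinge_derivative(2)])
    finally show ?thesis using un[of k] by (simp add: algebra_simps power2_eq_square)
  qed
  have "(\<Sum>k\<in>UNIV. dx k (X k) (x, t)) = ?\<eta> (x, t) * hinge' (v (x, t)) * (\<nu> * (\<Sum>k\<in>UNIV. dx k (dx k v) (x, t)) - (\<Sum>k\<in>UNIV. u (x, t) $ k * dx k v (x, t)))
     + \<nu> * ?\<eta> (x, t) * flat 0 (v (x, t)) * (\<Sum>k\<in>UNIV. (dx k v (x, t))^2)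
     - ?\<eta> (x, t) * hinge (v (x, t)) * (\<Sum>k\<in>UNIV. dx k (\<lambda>z. u z $ k) (x, t))
     - \<nu> * hinge (v (x, t)) * (\<Sum>k\<in>UNIV. dx k (dx k ?\<eta>) (x, t))"
    unfolding k by (simp add: sum.distrib sum_subtractf sum_distrib_left algebra_simps)
  then show ?thesis by (simp add: u_div L_real algebra_simps)
qed

end

text \<open>
  For subsolutions whose positive part is square integrable in space and time.  The localised energy
  \<open>m(t)\<close>, the integral of \<open>cutoff R * hinge v\<close>, vanishes at time \<open>0\<close>, and by \<open>flux_divergence\<close> its derivative
  is at most \<open>\<nu> C / R^2\<close> times the integral of \<open>hinge v\<close>.  Hence \<open>m\<close> is at most \<open>\<nu> C J / R^2\<close>, with \<open>J\<close>
  the square norm.  Were \<open>v\<close> positive at some point, \<open>m\<close> would be bounded below uniformly in \<open>R\<close>.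
\<close>

lemma (in drift) energy_max_principle:
  assumes T: "T > 0" and v: "smooth_on (UNIV \<times> {0<..<T}) v" and cont: "continuous_on (UNIV \<times> {0..<T}) v"
    and init: "\<And>x. v (x, 0) \<le> 0" and sub: "\<And>x t. 0 < t \<Longrightarrow> t < T \<Longrightarrow> transport_diffusion \<nu> u v (x, t) \<le> 0"
    and fin: "(\<integral>\<^sup>+t. indicator {0<..<T} t * (\<integral>\<^sup>+x. ennreal ((max 0 (v (x, t)))^2) \<partial>lborel) \<partial>lborel) < \<infinity>"
    and t1: "0 \<le> t1" "t1 < T"
  shows "v (x1, t1) \<le> 0"
proof (rule ccontr)
  assume "\<not> v (x1, t1) \<le> 0"
  then have pos: "v (x1, t1) > 0" by simp
  interpret drift_strip \<nu> u "{0<..<T}" by unfold_locales auto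
  let ?J = "{0..<T}"
  obtain \<rho> where \<rho>: "\<rho> > 0" "\<And>z. norm z > \<rho> \<Longrightarrow> u z = 0" using u_supp by blast
  obtain C where C: "C > 0" "\<And>R t x. R > 0 \<Longrightarrow> t \<in> {0<..<T} \<Longrightarrow> \<bar>\<Sum>k\<in>UNIV. dx k (dx k (cutoff R)) (x, t)\<bar> \<le> C / R^2"
    using laplace_cutoff_bound by blast
  have smh: "smooth (\<lambda>z. hinge (v z))" "smooth (\<lambda>z. hinge' (v z))"
    using smooth_on_compose[OF du smooth_on_hinge v] smooth_on_compose[OF du smooth_on_hinge' v] by auto
  have smc: "smooth (cutoff R)" for R by (rule smooth_on_cutoff[OF du])
  define w where "w z = hinge (v z)" for z
  have w_nonneg: "w z \<ge> 0" for z by (simp add: w_def hinge_nonneg)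
  have w_le: "w z \<le> (max 0 (v z))^2" for z by (simp add: w_def hinge_le)
  have contw: "continuous_on (UNIV \<times> ?J) w"
    unfolding w_def by (rule continuous_on_compose2[OF smooth_on_imp_continuous_on[OF smooth_on_hinge] cont]) simp
  obtain J where J: "(\<integral>\<^sup>+t. indicator {0<..<T} t * (\<integral>\<^sup>+x. ennreal ((max 0 (v (x, t)))^2) \<partial>lborel) \<partial>lborel) = ennreal J" "J \<ge> 0"
    using fin by (cases "(\<integral>\<^sup>+t. indicator {0<..<T} t * (\<integral>\<^sup>+x. ennreal ((max 0 (v (x, t)))^2) \<partial>lborel) \<partial>lborel)") auto
  define B where "B \<rho>' = (cbox (\<chi> i. - (2 * \<rho>') - 1) (\<chi> i. 2 * \<rho>' + 1) :: (real^3) set)" for \<rho>'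
  have slice: "continuous_on S (\<lambda>x. w (x, t))" if "t \<in> ?J" for S t
    by (rule continuous_on_slice[OF contw that])
  \<comment> \<open>the localized energy is small\<close>
  have main: "integral (B R) (\<lambda>x. cutoff R (x, t1) * w (x, t1)) \<le> \<nu> * C / R^2 * J" if R: "R \<ge> \<rho>" for R
  proof -
    have R0: "R > 0" using R \<rho> by simp
    define m where "m t = integral (B R) (\<lambda>x. cutoff R (x, t) * w (x, t))" for t
    define n where "n t = integral (B R) (\<lambda>x. w (x, t))" for t
    have contcw: "continuous_on (UNIV \<times> ?J) (\<lambda>z. cutoff R z * w z)"
      by (intro continuous_on_mult contw smooth_on_imp_continuous_on[THEN continuous_on_subset, OF smooth_on_cutoff[OF du_UNIV]]) simp
    have contsw: "continuous_on (?J \<times> B R) (\<lambda>(t, x). w (x, t))"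
      by (rule continuous_on_swap[OF contw])
    have contsc: "continuous_on (?J \<times> B R) (\<lambda>(t, x). cutoff R (x, t) * w (x, t))"
      by (rule continuous_on_swap[OF contcw])
    have contm: "continuous_on ?J m" unfolding m_def B_def
      by (rule integral_continuous_on_param) (use contsc in \<open>simp add: B_def\<close>)
    have contn: "continuous_on ?J n" unfolding n_def B_def
      by (rule integral_continuous_on_param) (use contsw in \<open>simp add: B_def\<close>)
    have derm: "(m has_real_derivative integral (B R) (\<lambda>x. cutoff R (x, t) * (hinge' (v (x, t)) * dt v (x, t)))) (at t)" if t: "t \<in> {0<..<T}" for t
    proof -
      have sm: "smooth (\<lambda>z. cutoff R z * (hinge' (v z) * dt v z))"
        by (intro smooth_intros(1-11) smh smc v)
      have "((\<lambda>t. integral (cbox (\<chi> i. - (2 * R) - 1) (\<chi> i. 2 * R + 1)) (\<lambda>x::real^3. cutoff R (x, t) * w (x, t))) has_field_derivative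
         integral (cbox (\<chi> i. - (2 * R) - 1) (\<chi> i. 2 * R + 1)) (\<lambda>x. cutoff R (x, t) * (hinge' (v (x, t)) * dt v (x, t)))) (at t within {0<..<T})"
      proof (rule leibniz_rule_field_derivative)
        fix s x assume s: "s \<in> {0<..<T}"
        have "((\<lambda>s. w (x, s)) has_real_derivative hinge' (v (x, s)) * dt v (x, s)) (at s)"
          unfolding w_def by (rule DERIV_chain2[OF hinge_derivative(1) dt_real[OF v s]])
        then have "((\<lambda>s. cutoff R (x, s) * w (x, s)) has_real_derivative cutoff R (x, s) * (hinge' (v (x, s)) * dt v (x, s))) (at s)"
          by (simp add: cutoff_def DERIV_cmult)
        then show "((\<lambda>s. cutoff R (x, s) * w (x, s)) has_real_derivative cutoff R (x, s) * (hinge' (v (x, s)) * dt v (x, s))) (at s within {0<..<T})"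
          by (rule has_field_derivative_at_within)
      next
        fix s assume "s \<in> {0<..<T}"
        then show "(\<lambda>x. cutoff R (x, s) * w (x, s)) integrable_on cbox (\<chi> i. - (2 * R) - 1) (\<chi> i. 2 * R + 1)"
          by (intro integrable_continuous continuous_on_slice[OF contcw]) auto
      next
        show "continuous_on ({0<..<T} \<times> cbox (\<chi> i. - (2 * R) - 1) (\<chi> i. 2 * R + 1)) (\<lambda>(s, x). cutoff R (x, s) * (hinge' (v (x, s)) * dt v (x, s)))"
          by (rule continuous_on_swap[OF smooth_on_imp_continuous_on[OF sm]])
      next
        show "t \<in> {0<..<T}" by (rule t)
        show "convex {0<..<T}" by simp
      qed
      then show ?thesis unfolding m_def B_def at_within_open[OF t open_greaterThanLessThan] .
    qed
    have derm_le: "integral (B R) (\<lambda>x. cutoff R (x, t) * (hinge' (v (x, t)) * dt v (x, t))) \<le> \<nu> * C / R^2 * n t" if t: "t \<in> {0<..<T}" for t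
    proof -
      define X where "X k = (\<lambda>z. cutoff R z * (\<nu> * (hinge' (v z) * dx k v z) - u z $ k * hinge (v z)) - \<nu> * (hinge (v z) * dx k (cutoff R) z))" for k
      have smX: "smooth (X k)" for k
        unfolding X_def by (intro smooth_intros(1-11) smh smc v u_smooth')
      have out: "cutoff R (x, t) = 0" "dx k (cutoff R) (x, t) = 0" if "2 * R < \<bar>x $ i\<bar>" for x i k
      proof -
        have x: "norm x > 2 * R" using component_le_norm_cart[of x i] that by simp
        show "cutoff R (x, t) = 0" using x by (intro cutoff_eq_0 R0) auto
        have "2 * R^2 \<le> (2 * R)^2" by (simp add: power2_eq_square)
        also have "\<dots> \<le> (norm x)^2" using x R0 by (intro power_mono) auto
        finally have "step' (2 - (norm x)^2 / R^2) = 0" using R0 by (intro step'_bounds(3)) (simp add: field_simps)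
        then show "dx k (cutoff R) (x, t) = 0" by (simp add: dx_cutoff[OF t])
      qed
      have intX: "integral (B R) (\<lambda>x. dx k (X k) (x, t)) = 0" for k
        unfolding B_def by (rule integral_dx_zero[OF smX t]) (simp add: X_def out)
      have contX: "continuous_on S (\<lambda>x. dx k (X k) (x, t))" for k S
        by (rule continuous_on_slice[OF smooth_on_imp_continuous_on[OF smooth_dx[OF smX]] t])
      have sm: "smooth (\<lambda>z. cutoff R z * (hinge' (v z) * dt v z))"
        by (intro smooth_intros(1-11) smh smc v)
      have "integral (B R) (\<lambda>x. cutoff R (x, t) * (hinge' (v (x, t)) * dt v (x, t)))
        \<le> integral (B R) (\<lambda>x. (\<Sum>k\<in>UNIV. dx k (X k) (x, t)) + \<nu> * C / R^2 * w (x, t))"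
      proof (rule integral_le)
        show "(\<lambda>x. cutoff R (x, t) * (hinge' (v (x, t)) * dt v (x, t))) integrable_on B R"
          unfolding B_def by (intro integrable_continuous continuous_on_slice[OF smooth_on_imp_continuous_on[OF sm] t])
        show "(\<lambda>x. (\<Sum>k\<in>UNIV. dx k (X k) (x, t)) + \<nu> * C / R^2 * w (x, t)) integrable_on B R"
          unfolding B_def using t by (intro integrable_continuous continuous_on_add continuous_on_sum continuous_on_mult continuous_on_const contX slice) auto
        fix x
        have un: "u (x, t) $ k * dx k (cutoff R) (x, t) = 0" for k
        proof (cases "norm x \<le> R")
          case True then show ?thesis by (simp add: dx_cutoff_inner[OF t R0])
        next
          case False
          then have "norm (x, t) > \<rho>" using R norm_fst_le[of x t] by simp
          then show ?thesis using \<rho>(2) by simp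
        qed
        have "L v (x, t) \<le> 0" using sub t by simp
        then have "cutoff R (x, t) * hinge' (v (x, t)) * L v (x, t) \<le> 0"
          by (intro mult_nonneg_nonpos mult_nonneg_nonneg cutoff_bounds hinge'_nonneg)
        moreover have "0 \<le> \<nu> * cutoff R (x, t) * flat 0 (v (x, t)) * (\<Sum>k\<in>UNIV. (dx k v (x, t))^2)"
          using nu by (intro mult_nonneg_nonneg cutoff_bounds flat_0_bounds sum_nonneg) auto
        moreover have "\<nu> * hinge (v (x, t)) * (\<Sum>k\<in>UNIV. dx k (dx k (cutoff R)) (x, t)) \<le> \<nu> * C / R^2 * w (x, t)"
        proof -
          have "(\<Sum>k\<in>UNIV. dx k (dx k (cutoff R)) (x, t)) \<le> C / R^2" using C(2)[OF R0 t] abs_le_D1 by blast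
          then have "\<nu> * hinge (v (x, t)) * (\<Sum>k\<in>UNIV. dx k (dx k (cutoff R)) (x, t)) \<le> \<nu> * hinge (v (x, t)) * (C / R^2)"
            using nu hinge_nonneg by (intro mult_left_mono) auto
          then show ?thesis by (simp add: w_def mult.commute mult.left_commute)
        qed
        moreover note flux_divergence[OF v t un, folded X_def]
        ultimately show "cutoff R (x, t) * (hinge' (v (x, t)) * dt v (x, t)) \<le> (\<Sum>k\<in>UNIV. dx k (X k) (x, t)) + \<nu> * C / R^2 * w (x, t)"
          by (simp add: algebra_simps)
      qed
      also have "\<dots> = integral (B R) (\<lambda>x. \<Sum>k\<in>UNIV. dx k (X k) (x, t)) + integral (B R) (\<lambda>x. \<nu> * C / R^2 * w (x, t))"
        unfolding B_def using t by (intro integral_add integrable_continuous continuous_on_sum continuous_on_mult continuous_on_const contX slice) auto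
      also have "integral (B R) (\<lambda>x. \<Sum>k\<in>UNIV. dx k (X k) (x, t)) = (\<Sum>k\<in>UNIV. integral (B R) (\<lambda>x. dx k (X k) (x, t)))"
        unfolding B_def by (intro integral_sum integrable_continuous contX) auto
      finally show ?thesis by (simp add: intX n_def)
    qed
    define N where "N t = integral {0..t} n" for t
    have contn': "continuous_on {0..t1} n" by (rule continuous_on_subset[OF contn]) (use t1 in auto)
    have N: "(N has_real_derivative n t) (at t within {0..t1})" if "t \<in> {0..t1}" for t
      unfolding N_def by (rule integral_has_real_derivative[OF contn' that])
    have Nle: "N t1 \<le> J"
    proof -
      have n_nonneg: "n t \<ge> 0" if "t \<in> ?J" for t
        unfolding n_def by (rule integral_nonneg) (use that w_nonneg in \<open>auto simp: B_def intro!: integrable_continuous slice\<close>)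
      have "ennreal (N t1) = (\<integral>\<^sup>+t. ennreal (indicator (cbox 0 t1) t * n t) \<partial>lborel)"
        unfolding N_def using nn_integral_continuous_box[of 0 t1 n] contn' n_nonneg t1 by simp
      also have "\<dots> \<le> (\<integral>\<^sup>+t. indicator {0<..<T} t * (\<integral>\<^sup>+x. ennreal ((max 0 (v (x, t)))^2) \<partial>lborel) \<partial>lborel)"
      proof (rule nn_integral_mono_AE)
        have "AE t in lborel. t \<noteq> (0::real)" by (rule AE_lborel_singleton)
        then show "AE t in lborel. ennreal (indicator (cbox 0 t1) t * n t) \<le> indicator {0<..<T} t * (\<integral>\<^sup>+x. ennreal ((max 0 (v (x, t)))^2) \<partial>lborel)"
        proof eventually_elim
          case (elim t)
          show ?case
          proof (cases "t \<in> cbox 0 t1")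
            case True
            then have t: "t \<in> {0<..<T}" using elim t1 by auto
            have "ennreal (n t) = (\<integral>\<^sup>+x. ennreal (indicator (B R) x * w (x, t)) \<partial>lborel)"
              unfolding n_def B_def by (rule nn_integral_continuous_box) (use t w_nonneg in \<open>auto intro!: slice\<close>)
            also have "\<dots> \<le> (\<integral>\<^sup>+x. ennreal ((max 0 (v (x, t)))^2) \<partial>lborel)"
            proof (intro nn_integral_mono ennreal_leI)
              fix x show "indicator (B R) x * w (x, t) \<le> (max 0 (v (x, t)))^2"
                using w_le[of "(x, t)"] by (cases "x \<in> B R") auto
            qed
            finally show ?thesis using True t by simp
          qed simp
        qed
      qed
      finally have "ennreal (N t1) \<le> ennreal J" using J by simp
      then show ?thesis using J(2) by (simp add: ennreal_le_iff)
    qed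
    have "m t1 - \<nu> * C / R^2 * N t1 \<le> m 0 - \<nu> * C / R^2 * N 0"
    proof (cases "t1 = 0")
      case False
      then have t1': "0 < t1" using t1 by simp
      have contf: "continuous_on {0..t1} (\<lambda>t. m t - \<nu> * C / R^2 * N t)"
      proof (intro continuous_on_diff continuous_on_mult continuous_on_const)
        show "continuous_on {0..t1} m" by (rule continuous_on_subset[OF contm]) (use t1 in auto)
        show "continuous_on {0..t1} N" using N DERIV_continuous_on by blast
      qed
      have "\<exists>y. ((\<lambda>t. m t - \<nu> * C / R^2 * N t) has_real_derivative y) (at t) \<and> y \<le> 0" if "0 < t" "t < t1" for t
      proof (intro exI conjI)
        have "(N has_real_derivative n t) (at t)"
          using N[of t] that at_within_Icc_at[of 0 t t1] by simp
        then show "((\<lambda>t. m t - \<nu> * C / R^2 * N t) has_real_derivative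
            (integral (B R) (\<lambda>x. cutoff R (x, t) * (hinge' (v (x, t)) * dt v (x, t))) - \<nu> * C / R^2 * n t)) (at t)"
          using derm[of t] that t1 by (intro DERIV_diff DERIV_cmult) auto
        show "integral (B R) (\<lambda>x. cutoff R (x, t) * (hinge' (v (x, t)) * dt v (x, t))) - \<nu> * C / R^2 * n t \<le> 0"
          using derm_le[of t] that t1 by simp
      qed
      then show ?thesis using DERIV_nonpos_imp_decreasing_open[OF _ _ contf] t1' by simp
    qed simp
    moreover have "m 0 = 0" unfolding m_def using init by (simp add: w_def hinge_0)
    moreover have "N 0 = 0" by (simp add: N_def)
    moreover have "\<nu> * C / R^2 * N t1 \<le> \<nu> * C / R^2 * J" using Nle nu C by (intro mult_left_mono) auto
    ultimately show ?thesis by (simp add: m_def)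
  qed
  \<comment> \<open>but it is bounded below near the point of positivity\<close>
  have t1J: "t1 \<in> ?J" using t1 by simp
  have "w (x1, t1) > 0" using pos by (simp add: w_def hinge_pos)
  moreover have "isCont (\<lambda>x. w (x, t1)) x1"
    using slice[OF t1J, of UNIV] by (simp add: continuous_on_eq_continuous_at)
  ultimately obtain r where r: "r > 0" "\<And>x. dist x x1 < r \<Longrightarrow> w (x, t1) > w (x1, t1) / 2"
  proof -
    have "\<forall>\<^sub>F x in nhds x1. w (x, t1) > w (x1, t1) / 2"
      using \<open>isCont (\<lambda>x. w (x, t1)) x1\<close> \<open>w (x1, t1) > 0\<close>
      by (intro order_tendstoD(1)[of _ "w (x1, t1)"]) (simp_all add: isCont_def tendsto_at_iff_tendsto_nhds[of "\<lambda>x. w (x, t1)" x1])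
    then show ?thesis using that unfolding eventually_nhds_metric by blast
  qed
  define e where "e = r / 4"
  have e: "e > 0" using r by (simp add: e_def)
  define B0 where "B0 = cbox (x1 - (\<chi> i. e)) (x1 + (\<chi> i. e))"
  have B0: "dist x x1 < r" if "x \<in> B0" for x
  proof -
    have c: "\<bar>(x - x1) $ i\<bar> \<le> e" for i
      using that unfolding B0_def mem_box_cart by (auto simp: abs_le_iff algebra_simps dest!: spec[of _ i])
    have "norm (x - x1) \<le> (\<Sum>i\<in>UNIV. \<bar>(x - x1) $ i\<bar>)" by (rule norm_le_l1_cart)
    also have "\<dots> \<le> (\<Sum>i\<in>(UNIV::3 set). e)" by (intro sum_mono c)
    also have "\<dots> < r" using r by (simp add: e_def)
    finally show ?thesis by (simp add: dist_norm)
  qed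
  define c0 where "c0 = integral B0 (\<lambda>x. w (x1, t1) / 2)"
  have "c0 > 0"
  proof -
    have "measure lborel B0 > 0" unfolding B0_def
      by (subst content_pos_lt_eq) (auto simp: Basis_vec_def inner_axis e algebra_simps)
    then show ?thesis using \<open>w (x1, t1) > 0\<close> by (simp add: c0_def B0_def)
  qed
  have low: "c0 \<le> integral (B R) (\<lambda>x. cutoff R (x, t1) * w (x, t1))" if R: "R \<ge> norm x1 + r" "R > 0" for R
  proof -
    have nx: "norm x \<le> R" if "x \<in> B0" for x
      using B0[OF that] R norm_triangle_sub[of x x1] by (simp add: dist_norm)
    have sub: "B0 \<subseteq> B R"
    proof
      fix x assume "x \<in> B0"
      then have "\<bar>x $ i\<bar> \<le> R" for i using nx component_le_norm_cart[of x i] by (meson order_trans)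
      then have "- R \<le> x $ i" "x $ i \<le> R" for i by (auto simp: abs_le_iff minus_le_iff)
      then have "- (2 * R) - 1 \<le> x $ i" "x $ i \<le> 2 * R + 1" for i
        using R(2) by (smt (verit))+
      then show "x \<in> B R" by (simp add: B_def mem_box_cart)
    qed
    have cw: "continuous_on S (\<lambda>x. cutoff R (x, t1) * w (x, t1))" for S
      by (intro continuous_on_mult slice t1J continuous_on_slice[of UNIV] smooth_on_imp_continuous_on)
        (auto intro!: smooth_on_cutoff simp: du_UNIV)
    have "c0 \<le> integral B0 (\<lambda>x. cutoff R (x, t1) * w (x, t1))"
      unfolding c0_def
    proof (rule integral_le)
      show "(\<lambda>x. w (x1, t1) / 2) integrable_on B0" unfolding B0_def by (rule integrable_const)
      show "(\<lambda>x. cutoff R (x, t1) * w (x, t1)) integrable_on B0" unfolding B0_def by (rule integrable_continuous[OF cw])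
      fix x assume x: "x \<in> B0"
      show "w (x1, t1) / 2 \<le> cutoff R (x, t1) * w (x, t1)"
        using r(2)[OF B0[OF x]] by (simp add: cutoff_eq_1[OF R(2) nx[OF x]])
    qed
    also have "\<dots> \<le> integral (B R) (\<lambda>x. cutoff R (x, t1) * w (x, t1))"
      by (rule integral_subset_le[OF sub])
        (auto simp: B0_def B_def intro!: integrable_continuous[OF cw] mult_nonneg_nonneg cutoff_bounds w_nonneg)
    finally show ?thesis .
  qed
  define K where "K = \<nu> * C * J"
  have K: "K \<ge> 0" using nu C J by (simp add: K_def)
  define R where "R = max \<rho> (norm x1 + r) + 1 + K / c0"
  have R: "R \<ge> \<rho>" "R \<ge> norm x1 + r" "R \<ge> 1" "R > K / c0"
  proof -
    have "K / c0 \<ge> 0" using \<open>c0 > 0\<close> K by simp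
    moreover have "\<rho> \<le> max \<rho> (norm x1 + r)" "norm x1 + r \<le> max \<rho> (norm x1 + r)" by simp_all
    ultimately show "R \<ge> \<rho>" "R \<ge> norm x1 + r" "R \<ge> 1" "R > K / c0" using \<rho>(1) unfolding R_def by linarith+
  qed
  have "c0 \<le> \<nu> * C / R^2 * J" using main[OF R(1)] low[OF R(2)] R(3) by simp
  then have "c0 * R^2 \<le> K" using R(3) by (simp add: K_def field_simps)
  moreover have "K < c0 * R" using R(4) \<open>c0 > 0\<close> by (simp add: field_simps)
  moreover have "c0 * R \<le> c0 * R^2" using R(3) \<open>c0 > 0\<close> by (intro mult_left_mono) (auto simp: power2_eq_square)
  ultimately show False by simp
qed

section \<open>The maximum principle on cylinders and interior estimates\<close>

context strip begin

lemma second_derivative_at_max: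
  fixes F :: "(real^3) \<times> real \<Rightarrow> real"
  assumes F: "smooth F" and t: "t \<in> I" and d: "d > 0" and max: "\<And>y. dist x y < d \<Longrightarrow> F (y, t) \<le> F (x, t)"
  shows "dx k F (x, t) = 0" "dx k (dx k F) (x, t) \<le> 0"
proof -
  let ?g = "\<lambda>h. F (x + h *\<^sub>R axis k 1, t)" and ?g' = "\<lambda>h. dx k F (x + h *\<^sub>R axis k 1, t)"
  have g: "(?g has_real_derivative ?g' h) (at h)" for h by (rule dx_real_at[OF F t])
  have le: "?g h \<le> ?g 0" if "\<bar>h\<bar> < d" for h
    using max[of "x + h *\<^sub>R axis k 1"] that by (simp add: dist_norm)
  have "?g' 0 = 0"
    by (rule DERIV_local_max[OF g d]) (use le in auto)
  then show z: "dx k F (x, t) = 0" by simp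
  show "dx k (dx k F) (x, t) \<le> 0"
  proof (rule ccontr)
    assume "\<not> dx k (dx k F) (x, t) \<le> 0"
    then have pos: "0 < dx k (dx k F) (x, t)" by simp
    have "(?g' has_real_derivative dx k (dx k F) (x, t)) (at 0)" by (rule dx_real[OF smooth_dx[OF F] t])
    from DERIV_pos_inc_right[OF this pos] obtain e where e: "e > 0" "\<And>h. 0 < h \<Longrightarrow> h < e \<Longrightarrow> ?g' 0 < ?g' h"
      by (metis add_0)
    define h where "h = min d e / 2"
    have h: "0 < h" "h < d" "h < e" using d e by (auto simp: h_def min_def)
    obtain s where s: "0 < s" "s < h" "?g h - ?g 0 = (h - 0) * ?g' s" using MVT2[OF h(1), of ?g ?g'] g by blast
    have "?g' s > 0" using e(2)[of s] s h z by simp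
    then have "?g h - ?g 0 > 0" unfolding s(3) using h by simp
    then show False using le[of h] h by simp
  qed
qed

end

text \<open>
  A positive maximum over the closed cylinder can only occur off the base and the lateral boundary.  There the
  first space derivatives vanish, the second ones are nonpositive and the time derivative is nonnegative
  (one-sidedly at the top), which contradicts \<open>L F < 0\<close>.  That the sign of \<open>L F\<close> matters only where
  \<open>F > 0\<close> gives room for discarding lower order terms.
\<close>

lemma (in strip_L) cylinder_max_principle:
  fixes F :: "(real^3) \<times> real \<Rightarrow> real"
  assumes nu: "\<nu> > 0" and F: "smooth F" and I: "{t0<..t1} \<subseteq> I"
    and cont: "continuous_on (cball x0 r \<times> {t0..t1}) F"
    and bottom: "\<And>x. dist x0 x \<le> r \<Longrightarrow> F (x, t0) \<le> 0"
    and side: "\<And>x t. dist x0 x = r \<Longrightarrow> t0 \<le> t \<Longrightarrow> t \<le> t1 \<Longrightarrow> F (x, t) \<le> 0"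
    and int: "\<And>x t. dist x0 x < r \<Longrightarrow> t0 < t \<Longrightarrow> t \<le> t1 \<Longrightarrow> F (x, t) > 0 \<Longrightarrow> L F (x, t) < 0"
    and x: "dist x0 x \<le> r" and t: "t0 \<le> t" "t \<le> t1"
  shows "F (x, t) \<le> 0"
proof (rule ccontr)
  assume neg: "\<not> F (x, t) \<le> 0"
  have "compact (cball x0 r \<times> {t0..t1})" by (intro compact_Times) auto
  moreover have "(x, t) \<in> cball x0 r \<times> {t0..t1}" using x t by simp
  ultimately obtain z where z: "z \<in> cball x0 r \<times> {t0..t1}" "\<And>w. w \<in> cball x0 r \<times> {t0..t1} \<Longrightarrow> F w \<le> F z"
    using continuous_attains_sup[OF _ _ cont] by blast
  obtain y s where ys: "z = (y, s)" by (cases z)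
  have pos: "F (y, s) > 0" using z(2)[of "(x, t)"] neg x t ys by simp
  have y: "dist x0 y < r" "t0 < s" "s \<le> t1"
    using pos bottom[of y] side[of y s] z(1) ys by (auto simp: less_le)
  have sI: "s \<in> I" using y I by auto
  have max: "F (y', s) \<le> F (y, s)" if "dist y y' < r - dist x0 y" for y'
    using z(2)[of "(y', s)"] y that dist_triangle[of x0 y' y] ys by simp
  have d: "dx k F (y, s) = 0" "dx k (dx k F) (y, s) \<le> 0" for k
    using second_derivative_at_max[OF F sI _ max, of "r - dist x0 y"] y(1) by simp_all
  have "dt F (y, s) \<ge> 0"
  proof (rule ccontr)
    assume "\<not> dt F (y, s) \<ge> 0"
    then have "dt F (y, s) < 0" by simp
    from DERIV_neg_dec_left[OF dt_real[OF F sI] this] obtain e where e: "e > 0" "\<And>h. 0 < h \<Longrightarrow> h < e \<Longrightarrow> F (y, s) < F (y, s - h)"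
      by blast
    define h where "h = min e (s - t0) / 2"
    have h: "0 < h" "h < e" "h < s - t0" using e y by (auto simp: h_def min_def field_simps)
    show False using e(2)[OF h(1,2)] z(2)[of "(y, s - h)"] y h ys by auto
  qed
  moreover have "\<nu> * (\<Sum>k\<in>UNIV. dx k (dx k F) (y, s)) \<le> 0"
    using nu d(2) by (intro mult_nonneg_nonpos sum_nonpos) auto
  ultimately have "L F (y, s) \<ge> 0" by (simp add: L_real d(1))
  then show False using int[OF y(1) y(2) y(3) pos] by simp
qed

context strip_L begin

lemma smooth_shift_coord: "smooth (\<lambda>z. fst z $ i - c)"
  by (intro smooth_intros)

lemma smooth_norm_sq: "smooth (\<lambda>z. \<Sum>i\<in>UNIV. (fst z $ i - c $ i)^2)"
  by (intro smooth_on_sum du smooth_on_power smooth_shift_coord)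

lemma L_shift_coord: "t \<in> I \<Longrightarrow> L (\<lambda>z. fst z $ i - c) (x, t) = u (x, t) $ i"
  by (simp add: L_diff smooth_on_coord[OF du] smooth_on_const[OF du] L_coord L_const)

lemma dx_shift_coord: "t \<in> I \<Longrightarrow> dx k (\<lambda>z. fst z $ i - c) (x, t) = (if i = k then 1 else 0)"
  by (simp add: dx_diff smooth_on_coord[OF du] smooth_on_const[OF du] dx_coord dx_const)

lemma L_norm_sq:
  assumes t: "t \<in> I"
  shows "L (\<lambda>z. \<Sum>i\<in>UNIV. (fst z $ i - c $ i)^2) (x, t) = 2 * (\<Sum>i\<in>UNIV. (x $ i - c $ i) * u (x, t) $ i) - 6 * \<nu>"
proof -
  have li: "L (\<lambda>z. (fst z $ i - c $ i)^2) (x, t) = 2 * ((x $ i - c $ i) * u (x, t) $ i) - 2 * \<nu>" for i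
    by (simp add: L_square[OF t smooth_shift_coord] L_shift_coord[OF t] dx_shift_coord[OF t] if_distrib[of "\<lambda>r. r^2"] cong: if_cong)
  show ?thesis
    unfolding L_sum[OF t smooth_on_power[OF du smooth_shift_coord]] li by (simp add: sum_subtractf sum_distrib_left)
qed

lemma dx_norm_sq:
  assumes t: "t \<in> I"
  shows "dx k (\<lambda>z. \<Sum>i\<in>UNIV. (fst z $ i - c $ i)^2) (x, t) = 2 * (x $ k - c $ k)"
proof -
  have "dx k (\<lambda>z. (fst z $ i - c $ i)^2) (x, t) = (if i = k then 2 * (x $ i - c $ i) else 0)" for i
    unfolding power2_eq_square by (simp add: dx_mult[OF t smooth_shift_coord smooth_shift_coord] dx_shift_coord[OF t])
  then show ?thesis
    by (subst dx_sum[OF t smooth_on_power[OF du smooth_shift_coord]]) simp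
qed

text \<open>
  For a finite family, such as the components of a gradient: the sum of squares \<open>p\<close> satisfies an equation with
  the good term \<open>- 2 \<nu> r\<close>, and by Cauchy-Schwarz its gradient is controlled by \<open>p\<close> and \<open>r\<close>.
\<close>

lemma sum_squares_family:
  fixes v :: "'i::finite \<Rightarrow> (real^3) \<times> real \<Rightarrow> real"
  assumes v: "\<And>i. smooth (v i)" and t: "t \<in> I"
  defines "p \<equiv> \<lambda>z. \<Sum>i\<in>UNIV. (v i z)^2" and "r \<equiv> \<lambda>z. \<Sum>i\<in>UNIV. \<Sum>k\<in>UNIV. (dx k (v i) z)^2"
  shows "smooth p"
    "L p (x, t) = (\<Sum>i\<in>UNIV. 2 * v i (x, t) * L (v i) (x, t)) - 2 * \<nu> * r (x, t)"
    "(\<Sum>k\<in>UNIV. (dx k p (x, t))^2) \<le> 4 * p (x, t) * r (x, t)"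
proof -
  have sq: "smooth (\<lambda>z. (v i z)^2)" for i by (intro smooth_on_power du v)
  show "smooth p" unfolding p_def by (intro smooth_on_sum du sq)
  show "L p (x, t) = (\<Sum>i\<in>UNIV. 2 * v i (x, t) * L (v i) (x, t)) - 2 * \<nu> * r (x, t)"
    unfolding p_def r_def by (simp add: L_sum[OF t sq] L_square[OF t v] sum_subtractf sum_distrib_left)
  have "dx k p (x, t) = 2 * (\<Sum>i\<in>UNIV. v i (x, t) * dx k (v i) (x, t))" for k
  proof -
    have "dx k (\<lambda>z. (v i z)^2) (x, t) = 2 * (v i (x, t) * dx k (v i) (x, t))" for i
      unfolding power2_eq_square by (simp add: dx_mult[OF t v v])
    then show ?thesis unfolding p_def by (simp add: dx_sum[OF t sq] sum_distrib_left)
  qed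
  moreover have "(2 * (\<Sum>i\<in>UNIV. v i (x, t) * dx k (v i) (x, t)))^2 \<le> 4 * p (x, t) * (\<Sum>i\<in>UNIV. (dx k (v i) (x, t))^2)" for k
    using Cauchy_Schwarz_ineq_sum[of "\<lambda>i. v i (x, t)" "\<lambda>i. dx k (v i) (x, t)" UNIV]
    by (simp add: p_def power_mult_distrib)
  ultimately have "(\<Sum>k\<in>UNIV. (dx k p (x, t))^2) \<le> (\<Sum>k\<in>UNIV. 4 * p (x, t) * (\<Sum>i\<in>UNIV. (dx k (v i) (x, t))^2))"
    by (intro sum_mono) simp
  also have "\<dots> = 4 * p (x, t) * r (x, t)"
    unfolding r_def by (subst sum.swap) (simp add: sum_distrib_left)
  finally show "(\<Sum>k\<in>UNIV. (dx k p (x, t))^2) \<le> 4 * p (x, t) * r (x, t)" .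
qed

text \<open>
  Bernstein's technique.  Here \<open>p\<close> is the quantity to be estimated, \<open>r\<close> stands for the squares of its next
  derivatives, and \<open>q\<close> is a bounded quantity whose equation contains the good term \<open>- 2 \<nu> p\<close>.  With a cutoff
  \<open>\<phi>\<close> in space and the factor \<open>t - (t1 - 1)\<close> in time, the maximum principle applies to
  \<open>(t - (t1 - 1)) * \<phi>^2 * p + lam * q\<close>: the term \<open>r\<close> absorbs the cross term of \<open>\<phi>^2\<close> and \<open>p\<close>, and the good
  term of \<open>lam * q\<close> absorbs all multiples of \<open>p\<close>.  The estimate at \<open>(x0, t1)\<close> requires no information
  about \<open>p\<close> on the boundary of the cylinder.
\<close>

lemma bernstein:
  fixes p q r :: "(real^3) \<times> real \<Rightarrow> real"
  assumes nu: "\<nu> > 0" and p: "smooth p" and q: "smooth q" and I: "{t1 - 1..t1} \<subseteq> I"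
    and nonneg: "U \<ge> 0" "K0 \<ge> 0" "K1 \<ge> 0" "K0' \<ge> 0" "\<And>z. p z \<ge> 0" "\<And>z. r z \<ge> 0" "\<And>z. q z \<ge> 0"
    and region: "\<And>x t. dist x0 x \<le> 1 \<Longrightarrow> t1 - 1 \<le> t \<Longrightarrow> t \<le> t1 \<Longrightarrow>
      q (x, t) \<le> Q0 \<and> (\<forall>j. \<bar>u (x, t) $ j\<bar> \<le> U) \<and> L p (x, t) \<le> K1 * p (x, t) + K0 - 2 * \<nu> * r (x, t)
      \<and> (\<Sum>k\<in>UNIV. (dx k p (x, t))^2) \<le> 4 * p (x, t) * r (x, t) \<and> L q (x, t) \<le> K0' - 2 * \<nu> * p (x, t)"
  defines "lam \<equiv> (1 + K1 + 12 * U + 44 * \<nu>) / (2 * \<nu>)"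
  shows "p (x0, t1) \<le> lam * Q0 + K0 + lam * K0'"
proof (rule field_le_epsilon)
  fix \<delta> :: real assume \<delta>: "\<delta> > 0"
  have lam_pos: "lam > 0" using nu nonneg by (auto simp: lam_def intro!: divide_pos_pos add_pos_nonneg add_nonneg_pos)
  define n where "n z = (\<Sum>i\<in>UNIV. (fst z $ i - x0 $ i)^2)" for z :: "(real^3) \<times> real"
  define \<phi> where "\<phi> z = 1 - n z" for z
  \<comment> \<open>the term with \<open>\<delta>\<close> makes the inequality for \<open>L F\<close> strict\<close>
  define M where "M = K0 + lam * K0' + \<delta>"
  have M: "M > 0" using nonneg lam_pos \<delta> by (auto simp: M_def intro!: add_nonneg_pos)
  define F where "F z = ((snd z - (t1 - 1)) * ((\<phi> z)^2 * p z) + lam * q z) - (M * (snd z - (t1 - 1)) + lam * Q0)" for z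
  have smn: "smooth n" unfolding n_def by (rule smooth_norm_sq)
  have sm\<phi>: "smooth \<phi>" unfolding \<phi>_def by (intro smooth_intros smn)
  have sm1: "smooth (\<lambda>z. (\<phi> z)^2 * p z)" by (intro smooth_intros(1-8) sm\<phi> p)
  have smt: "smooth (\<lambda>z. snd z - (t1 - 1))" by (intro smooth_intros)
  have smF: "smooth F" unfolding F_def by (intro smooth_intros(1-8) sm1 smt q)
  have n_dist: "n (x, t) = (dist x0 x)^2" for x t
    unfolding n_def by (simp add: dist_norm norm_sq_sum[symmetric] power2_commute)
  have "F (x0, t1) \<le> 0"
  proof (rule cylinder_max_principle[OF nu smF, of "t1 - 1" t1 x0 1])
    show "{t1 - 1<..t1} \<subseteq> I" using I by auto
    show "continuous_on (cball x0 1 \<times> {t1 - 1..t1}) F"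
      by (rule continuous_on_subset[OF smooth_on_imp_continuous_on[OF smF]]) (use I in auto)
    show "F (x, t1 - 1) \<le> 0" if "dist x0 x \<le> 1" for x
      using region[OF that, of "t1 - 1"] lam_pos by (simp add: F_def)
    show "F (x, t) \<le> 0" if "dist x0 x = 1" "t1 - 1 \<le> t" "t \<le> t1" for x t
      using region[of x t] that lam_pos M by (simp add: F_def \<phi>_def n_dist add_increasing)
    fix x t assume x: "dist x0 x < 1" and t: "t1 - 1 < t" "t \<le> t1"
    have tI: "t \<in> I" using t I by auto
    define s where "s = t - (t1 - 1)"
    have s: "0 < s" "s \<le> 1" using t by (auto simp: s_def)
    define y where "y k = x $ k - x0 $ k" for k
    define P where "P = p (x, t)"
    define f where "f = \<phi> (x, t)"
    define G where "G = (\<Sum>k\<in>UNIV. y k * dx k p (x, t))"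
    note reg = region[of x t]
    have reg: "q (x, t) \<le> Q0" "\<And>j. \<bar>u (x, t) $ j\<bar> \<le> U" "L p (x, t) \<le> K1 * P + K0 - 2 * \<nu> * r (x, t)"
      "(\<Sum>k\<in>UNIV. (dx k p (x, t))^2) \<le> 4 * P * r (x, t)" "L q (x, t) \<le> K0' - 2 * \<nu> * P"
      using region[of x t] x t by (auto simp: P_def)
    have P: "P \<ge> 0" using nonneg by (simp add: P_def)
    have r: "r (x, t) \<ge> 0" using nonneg by simp
    have ysq: "(\<Sum>k\<in>UNIV. (y k)^2) = n (x, t)" by (simp add: n_def y_def)
    have n1: "0 \<le> n (x, t)" "n (x, t) \<le> 1" using x by (auto simp: n_dist power_le_one)
    have f: "0 \<le> f" "f \<le> 1" using n1 by (auto simp: f_def \<phi>_def)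
    have dx\<phi>: "dx k \<phi> (x, t) = - 2 * y k" for k
      unfolding \<phi>_def using dx_norm_sq[OF tI, of k x0 x] smooth_norm_sq
      by (subst dx_diff[OF tI smooth_on_const[OF du] smn]) (simp add: dx_const n_def[abs_def] y_def)
    have L\<phi>: "L \<phi> (x, t) = 6 * \<nu> - 2 * (\<Sum>k\<in>UNIV. y k * u (x, t) $ k)"
      unfolding \<phi>_def using L_norm_sq[OF tI, of x0 x]
      by (subst L_diff[OF tI smooth_on_const[OF du] smn]) (simp add: L_const n_def[abs_def] y_def)
    have dx\<phi>2: "dx k (\<lambda>z. (\<phi> z)^2) (x, t) = - 4 * f * y k" for k
      unfolding power2_eq_square by (simp add: dx_mult[OF tI sm\<phi> sm\<phi>] dx\<phi> f_def)
    have L\<phi>2: "L (\<lambda>z. (\<phi> z)^2) (x, t) \<le> 12 * U + 12 * \<nu>"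
    proof -
      have "\<bar>y k\<bar> \<le> 1" for k
      proof -
        have "(y k)^2 \<le> (\<Sum>k\<in>UNIV. (y k)^2)" by (rule member_le_sum) auto
        then have "(y k)^2 \<le> 1" using ysq n1 by simp
        then show ?thesis by (simp add: abs_square_le_1)
      qed
      then have "\<bar>y k * u (x, t) $ k\<bar> \<le> 1 * U" for k
        unfolding abs_mult using reg(2)[of k] nonneg by (intro mult_mono) auto
      then have "\<bar>\<Sum>k\<in>UNIV. y k * u (x, t) $ k\<bar> \<le> (\<Sum>k\<in>(UNIV::3 set). U)"
        by (intro order_trans[OF sum_abs] sum_mono) simp
      then have a: "\<bar>\<Sum>k\<in>UNIV. y k * u (x, t) $ k\<bar> \<le> 3 * U" by simp
      have "L \<phi> (x, t) \<le> 6 * \<nu> + 6 * U" using a unfolding L\<phi> by linarith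
      then have "2 * f * L \<phi> (x, t) \<le> 2 * f * (6 * \<nu> + 6 * U)" using f by (intro mult_left_mono) auto
      also have "\<dots> \<le> 2 * 1 * (6 * \<nu> + 6 * U)" using f nu nonneg by (intro mult_right_mono mult_left_mono) auto
      finally have "2 * f * L \<phi> (x, t) \<le> 12 * U + 12 * \<nu>" by simp
      moreover have "0 \<le> 2 * \<nu> * (\<Sum>k\<in>UNIV. (dx k \<phi> (x, t))^2)" using nu by (intro mult_nonneg_nonneg sum_nonneg) auto
      ultimately show ?thesis by (simp add: L_square[OF tI sm\<phi>] f_def)
    qed
    have G2: "G^2 \<le> 4 * P * r (x, t)"
    proof -
      have "G^2 \<le> (\<Sum>k\<in>UNIV. (y k)^2) * (\<Sum>k\<in>UNIV. (dx k p (x, t))^2)"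
        unfolding G_def by (rule Cauchy_Schwarz_ineq_sum)
      also have "\<dots> \<le> 1 * (\<Sum>k\<in>UNIV. (dx k p (x, t))^2)"
        unfolding ysq using n1 by (intro mult_right_mono sum_nonneg) auto
      finally show ?thesis using reg(4) by simp
    qed
    \<comment> \<open>Young's inequality: the cross term is absorbed by \<open>r\<close> at the price of a multiple of \<open>p\<close>\<close>
    have cross: "4 * f * G \<le> f^2 * r (x, t) + 16 * P"
    proof -
      have "(4 * f * G)^2 = 16 * f^2 * G^2" by (simp add: power_mult_distrib)
      also have "\<dots> \<le> 16 * f^2 * (4 * P * r (x, t))" using G2 by (intro mult_left_mono) auto
      also have "\<dots> = 4 * (f^2 * r (x, t)) * (16 * P)" by simp
      also have "\<dots> \<le> (f^2 * r (x, t) + 16 * P)^2"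
        using sum_squares_ge_zero[of "f^2 * r (x, t) - 16 * P" 0] by (simp add: power2_eq_square algebra_simps)
      finally show ?thesis by (rule power2_le_imp_le) (use P r in auto)
    qed
    have "L (\<lambda>z. (\<phi> z)^2 * p z) (x, t) = f^2 * L p (x, t) + P * L (\<lambda>z. (\<phi> z)^2) (x, t) + 8 * \<nu> * f * G"
      unfolding L_mult[OF tI smooth_on_power[OF du sm\<phi>] p] dx\<phi>2
      by (simp add: f_def P_def G_def sum_distrib_left sum_negf algebra_simps)
    also have "\<dots> \<le> f^2 * (K1 * P + K0 - 2 * \<nu> * r (x, t)) + P * (12 * U + 12 * \<nu>) + 2 * \<nu> * (f^2 * r (x, t) + 16 * P)"
    proof (intro add_mono mult_left_mono reg L\<phi>2 P)
      show "8 * \<nu> * f * G \<le> 2 * \<nu> * (f\<^sup>2 * r (x, t) + 16 * P)"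
        using mult_left_mono[OF cross, of "2 * \<nu>"] nu by (simp add: algebra_simps)
    qed auto
    also have "\<dots> = f^2 * (K1 * P + K0) + P * (12 * U + 44 * \<nu>)" by (simp add: algebra_simps)
    also have "\<dots> \<le> 1 * (K1 * P + K0) + P * (12 * U + 44 * \<nu>)"
      using f P nonneg nu by (intro add_mono mult_right_mono) (auto simp: power_le_one)
    finally have Lp: "L (\<lambda>z. (\<phi> z)^2 * p z) (x, t) \<le> (K1 + 12 * U + 44 * \<nu>) * P + K0" by (simp add: algebra_simps)
    have "L F (x, t) = (f^2 * P + s * L (\<lambda>z. (\<phi> z)^2 * p z) (x, t) + lam * L q (x, t)) - M"
    proof -
      have Lt: "L (\<lambda>z. snd z - (t1 - 1)) (x, t) = 1" by (rule L_time[where g="\<lambda>t. t - (t1 - 1)"]) (auto intro!: derivative_eq_intros)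
      have dt': "dx k (\<lambda>z. snd z - (t1 - 1)) (x, t) = 0" for k by (rule dx_time)
      have "L (\<lambda>z. (snd z - (t1 - 1)) * ((\<phi> z)^2 * p z)) (x, t) = s * L (\<lambda>z. (\<phi> z)^2 * p z) (x, t) + f^2 * P"
        by (simp add: L_mult[OF tI smt sm1] Lt dt' s_def f_def P_def)
      moreover have "L (\<lambda>z. lam * q z) (x, t) = lam * L q (x, t)" by (rule L_cmult[OF tI q])
      moreover have "L (\<lambda>z. M * (snd z - (t1 - 1)) + lam * Q0) (x, t) = M"
        by (rule L_time[where g="\<lambda>t. M * (t - (t1 - 1)) + lam * Q0"]) (auto intro!: derivative_eq_intros)
      ultimately show ?thesis unfolding F_def
        by (subst L_diff[OF tI]; (intro smooth_intros(1-8) sm1 smt q)?; subst L_add[OF tI]; (intro smooth_intros(1-8) sm1 smt q)?; simp)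
    qed
    also have "\<dots> \<le> (P + ((K1 + 12 * U + 44 * \<nu>) * P + K0) + lam * (K0' - 2 * \<nu> * P)) - M"
    proof (intro diff_right_mono add_mono mult_left_mono reg)
      show "f^2 * P \<le> P" using f P by (intro mult_left_le_one_le) (auto simp: power_le_one)
      have "s * L (\<lambda>z. (\<phi> z)^2 * p z) (x, t) \<le> s * ((K1 + 12 * U + 44 * \<nu>) * P + K0)" using Lp s by (intro mult_left_mono) auto
      also have "\<dots> \<le> (K1 + 12 * U + 44 * \<nu>) * P + K0" using s P nonneg nu by (intro mult_left_le_one_le) auto
      finally show "s * L (\<lambda>z. (\<phi> z)^2 * p z) (x, t) \<le> (K1 + 12 * U + 44 * \<nu>) * P + K0" .
    qed (use lam_pos in auto)
    also have "\<dots> = - \<delta>"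
    proof -
      have "lam * (2 * \<nu>) = 1 + K1 + 12 * U + 44 * \<nu>" using nu by (simp add: lam_def)
      then have "lam * (2 * \<nu> * P) = (1 + K1 + 12 * U + 44 * \<nu>) * P" by (metis mult.assoc)
      then show ?thesis by (simp add: M_def algebra_simps)
    qed
    finally show "L F (x, t) < 0" using \<delta> by simp
  qed auto
  then have "p (x0, t1) + lam * q (x0, t1) \<le> M + lam * Q0"
    by (simp add: F_def \<phi>_def n_dist)
  moreover have "lam * q (x0, t1) \<ge> 0" using lam_pos nonneg by simp
  ultimately show "p (x0, t1) \<le> lam * Q0 + K0 + lam * K0' + \<delta>" by (simp add: M_def)
qed

end

context strip_L begin

text \<open>
  Bernstein's technique with \<open>p = |grad v|^2\<close> and \<open>q = v^2\<close>.
\<close>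

lemma gradient_estimate:
  fixes v :: "(real^3) \<times> real \<Rightarrow> real"
  assumes nu: "\<nu> > 0" and v: "smooth v" and u: "\<And>i. smooth (\<lambda>z. u z $ i)" and I: "{t1 - 1..t1} \<subseteq> I"
    and nonneg: "U \<ge> 0" "U1 \<ge> 0"
    and region: "\<And>x t. dist x0 x \<le> 1 \<Longrightarrow> t1 - 1 \<le> t \<Longrightarrow> t \<le> t1 \<Longrightarrow>
      \<bar>v (x, t)\<bar> \<le> V \<and> \<bar>L v (x, t)\<bar> \<le> f0 \<and> (\<forall>j. \<bar>dx j (L v) (x, t)\<bar> \<le> f1) \<and> (\<forall>j. \<bar>u (x, t) $ j\<bar> \<le> U)
      \<and> (\<forall>j k. \<bar>dx j (\<lambda>z. u z $ k) (x, t)\<bar> \<le> U1)"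
  defines "\<Lambda> \<equiv> (2 + 6 * U1 + 12 * U + 44 * \<nu>) / (2 * \<nu>)"
  shows "(\<Sum>j\<in>UNIV. (dx j v (x0, t1))^2) \<le> \<Lambda> * V^2 + 3 * f1^2 + \<Lambda> * (V^2 + f0^2)"
proof -
  define p where "p = (\<lambda>z. \<Sum>i\<in>UNIV. (dx i v z)^2)"
  define r where "r = (\<lambda>z. \<Sum>i\<in>UNIV. \<Sum>k\<in>UNIV. (dx k (dx i v) z)^2)"
  define q where "q = (\<lambda>z. (v z)^2)"
  have sq: "smooth q" unfolding q_def by (intro smooth_on_power du v)
  note fam = sum_squares_family[of "\<lambda>i. dx i v", OF smooth_dx[OF v], folded p_def r_def]
  have b: "p (x0, t1) \<le> (1 + (1 + 6 * U1) + 12 * U + 44 * \<nu>) / (2 * \<nu>) * V^2 + 3 * f1^2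
     + (1 + (1 + 6 * U1) + 12 * U + 44 * \<nu>) / (2 * \<nu>) * (V^2 + f0^2)"
  proof (rule bernstein[OF nu _ sq I, of p U "3 * f1^2" "1 + 6 * U1" "V^2 + f0^2" r x0 "V^2"])
    have "t1 \<in> I" using I by auto
    then show "smooth p" by (rule fam(1))
    fix x t assume xt: "dist x0 x \<le> 1" "t1 - 1 \<le> t" "t \<le> t1"
    have t: "t \<in> I" using xt I by auto
    have reg: "\<bar>v (x, t)\<bar> \<le> V" "\<bar>L v (x, t)\<bar> \<le> f0" "\<And>j. \<bar>dx j (L v) (x, t)\<bar> \<le> f1" "\<And>j. \<bar>u (x, t) $ j\<bar> \<le> U"
      "\<And>j k. \<bar>dx j (\<lambda>z. u z $ k) (x, t)\<bar> \<le> U1" using region[OF xt] by auto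
    have V2: "(v (x, t))^2 \<le> V^2" "(L v (x, t))^2 \<le> f0^2"
      using reg(1,2) by (metis abs_ge_zero power2_abs power_mono)+
    have Lq: "L q (x, t) \<le> V^2 + f0^2 - 2 * \<nu> * p (x, t)"
    proof -
      have "2 * v (x, t) * L v (x, t) \<le> (v (x, t))^2 + (L v (x, t))^2" by (rule sum_squares_bound)
      then show ?thesis using V2 unfolding q_def p_def L_square[OF t v] by simp
    qed
    have Lp: "L p (x, t) \<le> (1 + 6 * U1) * p (x, t) + 3 * f1^2 - 2 * \<nu> * r (x, t)"
    proof -
      let ?d = "\<lambda>j. dx j v (x, t)"
      have "2 * ?d j * L (dx j v) (x, t) \<le> (?d j)^2 + f1^2 + U1 * (\<Sum>k\<in>UNIV. (?d j)^2 + (?d k)^2)" for j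
      proof -
        have e: "L (dx j v) (x, t) = dx j (L v) (x, t) - (\<Sum>k\<in>UNIV. dx j (\<lambda>z. u z $ k) (x, t) * ?d k)"
          by (rule L_dx[OF v u t]) simp
        have 1: "2 * ?d j * dx j (L v) (x, t) \<le> (?d j)^2 + f1^2"
        proof -
          have "(dx j (L v) (x, t))^2 \<le> f1^2" using reg(3)[of j] by (metis abs_ge_zero power2_abs power_mono)
          then show ?thesis using sum_squares_bound[of "?d j" "dx j (L v) (x, t)"] by linarith
        qed
        have 2: "- 2 * ?d j * (dx j (\<lambda>z. u z $ k) (x, t) * ?d k) \<le> U1 * ((?d j)^2 + (?d k)^2)" for k
        proof -
          have "- 2 * ?d j * (dx j (\<lambda>z. u z $ k) (x, t) * ?d k) \<le> \<bar>dx j (\<lambda>z. u z $ k) (x, t)\<bar> * (2 * \<bar>?d j\<bar> * \<bar>?d k\<bar>)"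
            using abs_ge_self[of "- 2 * ?d j * (dx j (\<lambda>z. u z $ k) (x, t) * ?d k)"] by (simp add: abs_mult mult.commute mult.left_commute)
          also have "\<dots> \<le> U1 * (2 * \<bar>?d j\<bar> * \<bar>?d k\<bar>)" using reg(5) by (intro mult_right_mono) auto
          also have "\<dots> \<le> U1 * ((?d j)^2 + (?d k)^2)"
            using sum_squares_bound[of "\<bar>?d j\<bar>" "\<bar>?d k\<bar>"] nonneg by (intro mult_left_mono) auto
          finally show ?thesis .
        qed
        have "2 * ?d j * L (dx j v) (x, t) = 2 * ?d j * dx j (L v) (x, t) + (\<Sum>k\<in>UNIV. - 2 * ?d j * (dx j (\<lambda>z. u z $ k) (x, t) * ?d k))"
          unfolding e by (simp add: right_diff_distrib sum_distrib_left sum_negf)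
        also have "\<dots> \<le> ((?d j)^2 + f1^2) + (\<Sum>k\<in>UNIV. U1 * ((?d j)^2 + (?d k)^2))"
          by (intro add_mono 1 sum_mono 2)
        finally show ?thesis by (simp add: sum_distrib_left)
      qed
      then have "(\<Sum>j\<in>UNIV. 2 * ?d j * L (dx j v) (x, t)) \<le> (\<Sum>j\<in>UNIV. (?d j)^2 + f1^2 + U1 * (\<Sum>k\<in>UNIV. (?d j)^2 + (?d k)^2))"
        by (intro sum_mono)
      also have "\<dots> = p (x, t) + 3 * f1^2 + U1 * (6 * p (x, t))"
        unfolding p_def by (simp add: sum.distrib sum_distrib_left[symmetric])
      finally show ?thesis unfolding fam(2)[OF t] r_def by (simp add: algebra_simps)
    qed
    have f3: "(\<Sum>k\<in>UNIV. (dx k p (x, t))\<^sup>2) \<le> 4 * p (x, t) * r (x, t)"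
      using fam(3)[OF t, of x] by (simp only: p_def r_def)
    show "q (x, t) \<le> V\<^sup>2 \<and> (\<forall>j. \<bar>u (x, t) $ j\<bar> \<le> U) \<and> L p (x, t) \<le> (1 + 6 * U1) * p (x, t) + 3 * f1\<^sup>2 - 2 * \<nu> * r (x, t)
      \<and> (\<Sum>k\<in>UNIV. (dx k p (x, t))\<^sup>2) \<le> 4 * p (x, t) * r (x, t) \<and> L q (x, t) \<le> V\<^sup>2 + f0\<^sup>2 - 2 * \<nu> * p (x, t)"
      using reg Lq Lp f3 V2 by (simp add: q_def)
  qed (use nonneg in \<open>auto simp: p_def q_def r_def sum_nonneg\<close>)
  then show ?thesis by (simp add: \<Lambda>_def p_def)
qed

text \<open>
  Bernstein's technique once more, with the second derivatives in the place of \<open>p\<close> and the gradient in the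
  place of \<open>q\<close>.
\<close>

lemma second_derivative_estimate:
  fixes v :: "(real^3) \<times> real \<Rightarrow> real"
  assumes nu: "\<nu> > 0" and v: "smooth v" and u: "\<And>i. smooth (\<lambda>z. u z $ i)" and I: "{t1 - 1..t1} \<subseteq> I"
    and nonneg: "U \<ge> 0" "U1 \<ge> 0" "U2 \<ge> 0" "G \<ge> 0"
    and Lv: "\<And>x t. t \<in> I \<Longrightarrow> L v (x, t) = 0"
    and region: "\<And>x t. t1 - 1 \<le> t \<Longrightarrow> t \<le> t1 \<Longrightarrow>
      (\<forall>j. \<bar>dx j v (x, t)\<bar> \<le> G) \<and> (\<forall>j. \<bar>u (x, t) $ j\<bar> \<le> U) \<and> (\<forall>j k. \<bar>dx j (\<lambda>z. u z $ k) (x, t)\<bar> \<le> U1)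
      \<and> (\<forall>i j k. \<bar>dx i (dx j (\<lambda>z. u z $ k)) (x, t)\<bar> \<le> U2)"
  defines "\<Lambda> \<equiv> (10 + 36 * U1 + 12 * U + 44 * \<nu>) / (2 * \<nu>)"
  shows "(dx k (dx j v) (x0, t1))^2 \<le> \<Lambda> * (3 * G^2) + 9 * U2^2 * G^2 + \<Lambda> * (18 * U1 * G^2)"
proof -
  define q where "q = (\<lambda>z. \<Sum>i\<in>UNIV. (dx i v z)^2)"
  define w where "w = (\<lambda>(i, j). dx i (dx j v))"
  define p where "p = (\<lambda>z. \<Sum>i\<in>UNIV. (w i z)^2)"
  define r where "r = (\<lambda>z. \<Sum>i\<in>UNIV. \<Sum>k\<in>UNIV. (dx k (w i) z)^2)"
  have smw: "smooth (w i)" for i unfolding w_def by (cases i) (simp add: smooth_dx v)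
  note famq = sum_squares_family[of "\<lambda>i. dx i v", OF smooth_dx[OF v], folded q_def]
  note fam = sum_squares_family[of w, OF smw, folded p_def r_def]
  have p_eq: "p z = (\<Sum>i\<in>UNIV. \<Sum>k\<in>UNIV. (dx k (dx i v) z)^2)" for z
    unfolding p_def w_def UNIV_Times_UNIV[symmetric]
    by (subst sum.swap) (simp add: sum.cartesian_product split_beta)
  have b: "p (x0, t1) \<le> (1 + (9 + 36 * U1) + 12 * U + 44 * \<nu>) / (2 * \<nu>) * (3 * G^2) + 9 * U2^2 * G^2
     + (1 + (9 + 36 * U1) + 12 * U + 44 * \<nu>) / (2 * \<nu>) * (18 * U1 * G^2)"
  proof (rule bernstein[OF nu _ _ I, of p q U "9 * U2^2 * G^2" "9 + 36 * U1" "18 * U1 * G^2" r x0 "3 * G^2"])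
    have t1: "t1 \<in> I" using I by auto
    show "smooth p" "smooth q" using fam(1)[OF t1] famq(1)[OF t1] by auto
    fix x t assume xt: "dist x0 x \<le> 1" "t1 - 1 \<le> t" "t \<le> t1"
    have t: "t \<in> I" using xt I by auto
    let ?d = "\<lambda>j. dx j v (x, t)" and ?u = "\<lambda>j k. dx j (\<lambda>z. u z $ k) (x, t)" and ?w = "\<lambda>i. w i (x, t)"
    have reg: "\<And>j. \<bar>?d j\<bar> \<le> G" "\<And>j. \<bar>u (x, t) $ j\<bar> \<le> U" "\<And>j k. \<bar>?u j k\<bar> \<le> U1"
      "\<And>i j k. \<bar>dx i (dx j (\<lambda>z. u z $ k)) (x, t)\<bar> \<le> U2" using region[OF xt(2,3)] by auto
    have Ldv: "L (dx j v) (y, t) = - (\<Sum>l\<in>UNIV. dx j (\<lambda>z. u z $ l) (y, t) * dx l v (y, t))" for j y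
      using L_dx[OF v u t, of "\<lambda>z. 0" j y] Lv[OF t] by (simp add: dx_const)
    have q_le: "q (x, t) \<le> 3 * G^2"
    proof -
      have "(?d j)^2 \<le> G^2" for j using reg(1)[of j] by (metis abs_ge_zero power2_abs power_mono)
      then have "q (x, t) \<le> (\<Sum>j\<in>(UNIV::3 set). G^2)" unfolding q_def by (intro sum_mono)
      then show ?thesis by simp
    qed
    have Lq: "L q (x, t) \<le> 18 * U1 * G^2 - 2 * \<nu> * p (x, t)"
    proof -
      have "2 * ?d j * L (dx j v) (x, t) \<le> 6 * U1 * G^2" for j
      proof -
        have "- 2 * ?d j * (?u j l * ?d l) \<le> 2 * G * (U1 * G)" for l
        proof -
          have "- 2 * ?d j * (?u j l * ?d l) \<le> 2 * \<bar>?d j\<bar> * (\<bar>?u j l\<bar> * \<bar>?d l\<bar>)"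
            using abs_ge_self[of "- 2 * ?d j * (?u j l * ?d l)"] by (simp add: abs_mult)
          also have "\<dots> \<le> 2 * G * (U1 * G)" using reg nonneg by (intro mult_mono) auto
          finally show ?thesis .
        qed
        then have "(\<Sum>l\<in>UNIV. - 2 * ?d j * (?u j l * ?d l)) \<le> (\<Sum>l\<in>(UNIV::3 set). 2 * G * (U1 * G))" by (intro sum_mono)
        moreover have "2 * ?d j * L (dx j v) (x, t) = (\<Sum>l\<in>UNIV. - 2 * ?d j * (?u j l * ?d l))"
          unfolding Ldv by (simp add: sum_distrib_left sum_negf)
        moreover have "(\<Sum>l\<in>(UNIV::3 set). 2 * G * (U1 * G)) = 6 * U1 * G^2" by (simp add: power2_eq_square)
        ultimately show ?thesis by linarith
      qed
      then have "(\<Sum>j\<in>UNIV. 2 * ?d j * L (dx j v) (x, t)) \<le> (\<Sum>j\<in>(UNIV::3 set). 6 * U1 * G^2)" by (intro sum_mono)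
      then show ?thesis unfolding famq(2)[OF t] p_eq by simp
    qed
    have Lp: "L p (x, t) \<le> (9 + 36 * U1) * p (x, t) + 9 * U2^2 * G^2 - 2 * \<nu> * r (x, t)"
    proof -
      define S where "S = (\<Sum>i\<in>UNIV. \<bar>?w i\<bar>)"
      have S0: "S \<ge> 0" unfolding S_def by (intro sum_nonneg) auto
      have S2: "S^2 \<le> 9 * p (x, t)"
      proof -
        have "S^2 \<le> (\<Sum>i\<in>(UNIV::(3\<times>3) set). 1^2) * (\<Sum>i\<in>UNIV. \<bar>?w i\<bar>^2)"
          unfolding S_def using Cauchy_Schwarz_ineq_sum[of "\<lambda>_. 1" "\<lambda>i. \<bar>?w i\<bar>" UNIV] by simp
        then show ?thesis by (simp add: p_def)
      qed
      have row: "(\<Sum>l\<in>UNIV. \<bar>?w (k, l)\<bar>) \<le> S" for k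
      proof -
        have "(\<Sum>l\<in>UNIV. \<bar>?w (k, l)\<bar>) = (\<Sum>i\<in>range (Pair k). \<bar>?w i\<bar>)" by (subst sum.reindex) (auto simp: inj_on_def)
        also have "\<dots> \<le> S" unfolding S_def by (rule sum_mono2) auto
        finally show ?thesis .
      qed
      have comm: "?w (k, l) = ?w (l, k)" for k l unfolding w_def using dx_commute[OF v t] by simp
      have f: "\<bar>L (w (k, j)) (x, t)\<bar> \<le> 3 * U2 * G + 2 * U1 * S" for k j
      proof -
        define h where "h = (\<lambda>z. - (\<Sum>l\<in>UNIV. dx j (\<lambda>z. u z $ l) z * dx l v z))"
        have "L (w (k, j)) (x, t) = dx k h (x, t) - (\<Sum>l\<in>UNIV. ?u k l * dx l (dx j v) (x, t))"
          unfolding w_def prod.case by (rule L_dx[OF smooth_dx[OF v] u t]) (simp add: Ldv h_def)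
        moreover have "dx k h (x, t) = - (\<Sum>l\<in>UNIV. ?u j l * dx k (dx l v) (x, t) + ?d l * dx k (dx j (\<lambda>z. u z $ l)) (x, t))"
        proof -
          have sm: "smooth (\<lambda>z. dx j (\<lambda>z. u z $ l) z * dx l v z)" for l by (intro smooth_on_mult du smooth_dx u v)
          show ?thesis unfolding h_def
            by (subst dx_minus[OF t smooth_on_sum[OF du sm]], subst dx_sum[OF t sm])
              (simp add: dx_mult[OF t smooth_dx[OF u] smooth_dx[OF v]])
        qed
        ultimately have e: "L (w (k, j)) (x, t) = - ((\<Sum>l\<in>UNIV. ?u j l * ?w (k, l)) + (\<Sum>l\<in>UNIV. ?d l * dx k (dx j (\<lambda>z. u z $ l)) (x, t))
           + (\<Sum>l\<in>UNIV. ?u k l * ?w (j, l)))"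
          using comm by (simp add: w_def sum.distrib)
        have 1: "\<bar>\<Sum>l\<in>UNIV. ?u j l * ?w (k, l)\<bar> \<le> U1 * S" for j k
        proof -
          have "\<bar>\<Sum>l\<in>UNIV. ?u j l * ?w (k, l)\<bar> \<le> (\<Sum>l\<in>UNIV. U1 * \<bar>?w (k, l)\<bar>)"
            using reg(3) by (intro order_trans[OF sum_abs] sum_mono) (auto simp: abs_mult intro!: mult_right_mono)
          also have "\<dots> \<le> U1 * S" using row[of k] nonneg by (simp add: sum_distrib_left[symmetric] mult_left_mono)
          finally show ?thesis .
        qed
        have 2: "\<bar>\<Sum>l\<in>UNIV. ?d l * dx k (dx j (\<lambda>z. u z $ l)) (x, t)\<bar> \<le> 3 * U2 * G"
        proof -
          have "\<bar>\<Sum>l\<in>UNIV. ?d l * dx k (dx j (\<lambda>z. u z $ l)) (x, t)\<bar> \<le> (\<Sum>l\<in>(UNIV::3 set). G * U2)"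
            using reg nonneg by (intro order_trans[OF sum_abs] sum_mono) (auto simp: abs_mult intro!: mult_mono)
          then show ?thesis by (simp add: mult.commute[of G])
        qed
        show ?thesis unfolding e using 1[of j k] 1[of k j] 2 by linarith
      qed
      have "(\<Sum>i\<in>UNIV. 2 * ?w i * L (w i) (x, t)) \<le> (\<Sum>i\<in>UNIV. 2 * \<bar>?w i\<bar> * (3 * U2 * G + 2 * U1 * S))"
      proof (rule sum_mono)
        fix i :: "3 \<times> 3"
        have "2 * ?w i * L (w i) (x, t) \<le> 2 * \<bar>?w i\<bar> * \<bar>L (w i) (x, t)\<bar>"
          using abs_ge_self[of "2 * ?w i * L (w i) (x, t)"] by (simp add: abs_mult)
        also have "\<dots> \<le> 2 * \<bar>?w i\<bar> * (3 * U2 * G + 2 * U1 * S)"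
          using f[of "fst i" "snd i"] by (intro mult_left_mono) auto
        finally show "2 * ?w i * L (w i) (x, t) \<le> 2 * \<bar>?w i\<bar> * (3 * U2 * G + 2 * U1 * S)" .
      qed
      also have "\<dots> = 2 * S * (3 * U2 * G + 2 * U1 * S)"
        by (simp only: sum_distrib_right[symmetric] sum_distrib_left[symmetric] S_def[symmetric])
      also have "\<dots> = 2 * S * (3 * U2 * G) + 4 * U1 * S^2" by (simp add: algebra_simps power2_eq_square)
      also have "2 * S * (3 * U2 * G) \<le> S^2 + (3 * U2 * G)^2" by (rule sum_squares_bound)
      also have "S^2 + (3 * U2 * G)^2 + 4 * U1 * S^2 \<le> 9 * p (x, t) + 9 * U2^2 * G^2 + 4 * U1 * (9 * p (x, t))"
        using S2 nonneg by (intro add_mono mult_left_mono) (auto simp: power_mult_distrib)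
      finally show ?thesis unfolding fam(2)[OF t] r_def by (simp add: algebra_simps)
    qed
    have f3: "(\<Sum>k\<in>UNIV. (dx k p (x, t))\<^sup>2) \<le> 4 * p (x, t) * r (x, t)"
      using fam(3)[OF t, of x] by (simp only: p_def r_def)
    show "q (x, t) \<le> 3 * G\<^sup>2 \<and> (\<forall>j. \<bar>u (x, t) $ j\<bar> \<le> U) \<and> L p (x, t) \<le> (9 + 36 * U1) * p (x, t) + 9 * U2\<^sup>2 * G\<^sup>2 - 2 * \<nu> * r (x, t)
      \<and> (\<Sum>k\<in>UNIV. (dx k p (x, t))\<^sup>2) \<le> 4 * p (x, t) * r (x, t) \<and> L q (x, t) \<le> 18 * U1 * G\<^sup>2 - 2 * \<nu> * p (x, t)"
      using reg(2) q_le Lq Lp f3 by blast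
  qed (use nonneg in \<open>auto simp: p_def q_def r_def sum_nonneg\<close>)
  have "(dx k (dx j v) (x0, t1))^2 \<le> p (x0, t1)"
    using member_le_sum[of "(k, j)" UNIV "\<lambda>i. (w i (x0, t1))^2"] by (simp add: p_def w_def)
  also note b
  finally show ?thesis by (simp add: \<Lambda>_def)
qed

text \<open>
  After removing the exponential growth by the factor \<open>exp (- K t)\<close>, the function is compared with
  \<open>\<delta> * (|x|^2 + K' t)\<close> on large balls, and \<open>\<delta>\<close> tends to \<open>0\<close>.  A bound for \<open>x \<bullet> u\<close> makes the barrier a
  supersolution; it is available since the drift has compact support.
\<close>

lemma whole_space_max_principle:
  fixes \<zeta> :: "(real^3) \<times> real \<Rightarrow> real"
  assumes nu: "\<nu> > 0" and z: "smooth \<zeta>" and I: "{0<..T} \<subseteq> I" and cont: "continuous_on (UNIV \<times> {0..T}) \<zeta>"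
    and bdd: "\<And>x t. 0 \<le> t \<Longrightarrow> t \<le> T \<Longrightarrow> \<zeta> (x, t) \<le> M" and init: "\<And>x. \<zeta> (x, 0) \<le> 0"
    and sub: "\<And>x t. 0 < t \<Longrightarrow> t \<le> T \<Longrightarrow> L \<zeta> (x, t) \<le> K * \<zeta> (x, t)"
    and P: "\<And>x t. \<bar>\<Sum>i\<in>UNIV. x $ i * u (x, t) $ i\<bar> \<le> P" and K: "K \<ge> 0"
    and t: "0 \<le> t" "t \<le> T"
  shows "\<zeta> (x, t) \<le> 0"
proof (rule field_le_epsilon)
  fix e :: real assume e: "e > 0"
  define K' where "K' = 6 * \<nu> + 2 * P + 1"
  have P0: "P \<ge> 0" using P[of 0 0] by simp
  have K': "K' > 0" using nu P0 by (simp add: K'_def)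
  define N where "N = (norm x)^2 + K' * t"
  have N: "N \<ge> 0" using K' t by (simp add: N_def)
  define \<delta> where "\<delta> = e / (exp (K * T) * (N + 1))"
  have \<delta>: "\<delta> > 0" using e N by (simp add: \<delta>_def)
  define n where "n = (\<lambda>z::(real^3) \<times> real. \<Sum>i\<in>UNIV. (fst z $ i - 0 $ i)^2)"
  define F where "F = (\<lambda>z. exp (- K * snd z) * \<zeta> z - \<delta> * (n z + K' * snd z))"
  have n_eq: "n (y, s) = (norm y)^2" for y s unfolding n_def by (simp add: norm_sq_sum)
  have smn: "smooth n" unfolding n_def by (rule smooth_norm_sq)
  have sme: "smooth (\<lambda>z. exp (- K * snd z))"
    by (intro smooth_on_compose[OF du smooth_on_exp] smooth_on_mult smooth_on_const smooth_on_snd du)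
  have smF: "smooth F" unfolding F_def by (intro smooth_intros(1-9) sme z smn)
  define r where "r = norm x + 1 + (max 0 M / \<delta> + 1)"
  have r: "r \<ge> norm x" "r \<ge> 1" "r \<ge> max 0 M / \<delta> + 1" using \<delta> by (auto simp: r_def)
  have "F (x, t) \<le> 0"
  proof (rule cylinder_max_principle[OF nu smF, of 0 T 0 r])
    show "{0<..T} \<subseteq> I" by (rule I)
    show "continuous_on (cball 0 r \<times> {0..T}) F"
      unfolding F_def n_def
      by (intro continuous_intros continuous_on_subset[OF cont]) auto
    show "F (y, 0) \<le> 0" for y
    proof -
      have "F (y, 0) = \<zeta> (y, 0) - \<delta> * (norm y)^2" by (simp add: F_def n_eq)
      moreover have "0 \<le> \<delta> * (norm y)^2" using \<delta> by simp
      ultimately show ?thesis using init[of y] by linarith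
    qed
    show "F (y, s) \<le> 0" if "dist 0 y = r" "0 \<le> s" "s \<le> T" for y s
    proof -
      have "exp (- K * s) * \<zeta> (y, s) \<le> exp (- K * s) * max 0 M" using bdd[OF that(2,3), of y] by (intro mult_left_mono) auto
      also have "\<dots> \<le> 1 * max 0 M" using K that by (intro mult_right_mono) auto
      also have "1 * max 0 M \<le> \<delta> * r"
      proof -
        have "max 0 M / \<delta> \<le> r" using r(3) by linarith
        then have "max 0 M \<le> r * \<delta>" using \<delta> by (simp only: pos_divide_le_eq)
        then show ?thesis by (simp only: mult_1 mult.commute)
      qed
      also have "\<dots> \<le> \<delta> * r^2" using r \<delta> by (intro mult_left_mono) (auto simp: power2_eq_square)
      also have "\<dots> \<le> \<delta> * (n (y, s) + K' * s)" using that K' \<delta> by (simp add: n_eq)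
      finally show ?thesis by (simp add: F_def)
    qed
    fix y s assume s: "0 < s" "s \<le> T" and pos: "F (y, s) > 0"
    have sI: "s \<in> I" using s I by auto
    have Ln: "L n (y, s) = 2 * (\<Sum>i\<in>UNIV. y $ i * u (y, s) $ i) - 6 * \<nu>"
      unfolding n_def using L_norm_sq[OF sI, of 0 y] by simp
    have Le: "L (\<lambda>z. exp (- K * snd z)) (y, s) = - K * exp (- K * s)"
      by (rule L_time[where g="\<lambda>t. exp (- K * t)"]) (auto intro!: derivative_eq_intros)
    have Lt: "L (\<lambda>z. K' * snd z) (y, s) = K'"
      by (rule L_time[where g="\<lambda>t. K' * t"]) (auto intro!: derivative_eq_intros)
    have smt: "smooth (\<lambda>z. K' * snd z)" by (intro smooth_intros)
    have "L F (y, s) = (exp (- K * s) * L \<zeta> (y, s) + \<zeta> (y, s) * (- K * exp (- K * s))) - \<delta> * (L n (y, s) + K')"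
    proof -
      have "L F (y, s) = L (\<lambda>z. exp (- K * snd z) * \<zeta> z) (y, s) - L (\<lambda>z. \<delta> * (n z + K' * snd z)) (y, s)"
        unfolding F_def by (rule L_diff[OF sI]) (intro smooth_intros(1-9) sme z smn)+
      also have "L (\<lambda>z. \<delta> * (n z + K' * snd z)) (y, s) = \<delta> * L (\<lambda>z. n z + K' * snd z) (y, s)"
        by (rule L_cmult[OF sI]) (intro smooth_on_add du smn smt)
      also have "L (\<lambda>z. n z + K' * snd z) (y, s) = L n (y, s) + K'"
        using L_add[OF sI smn smt, of y] Lt by simp
      also have "L (\<lambda>z. exp (- K * snd z) * \<zeta> z) (y, s) = exp (- K * s) * L \<zeta> (y, s) + \<zeta> (y, s) * (- K * exp (- K * s))"
        using L_mult[OF sI sme z, of y] Le dx_time[of _ "\<lambda>t. exp (- K * t)" y s] by simp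
      finally show ?thesis .
    qed
    also have "\<dots> = exp (- K * s) * (L \<zeta> (y, s) - K * \<zeta> (y, s)) - \<delta> * (L n (y, s) + K')" by (simp add: algebra_simps)
    also have "\<dots> < 0"
    proof -
      have "exp (- K * s) * (L \<zeta> (y, s) - K * \<zeta> (y, s)) \<le> 0" using sub[OF s, of y] by (intro mult_nonneg_nonpos) auto
      moreover have "L n (y, s) + K' > 0" using P[of y s] unfolding Ln K'_def by (simp add: abs_le_iff)
      then have "\<delta> * (L n (y, s) + K') > 0" using \<delta> by simp
      ultimately show ?thesis by linarith
    qed
    finally show "L F (y, s) < 0" .
  qed (use r t in auto)
  then have le: "exp (- K * t) * \<zeta> (x, t) \<le> \<delta> * N" by (simp add: F_def n_eq N_def)
  have "\<zeta> (x, t) = exp (K * t) * (exp (- K * t) * \<zeta> (x, t))" by (simp add: mult.assoc[symmetric] exp_add[symmetric])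
  also have "\<dots> \<le> exp (K * t) * (\<delta> * N)" using le by (intro mult_left_mono) auto
  also have "\<dots> \<le> exp (K * T) * (\<delta> * (N + 1))" using K t \<delta> N by (intro mult_mono) (auto intro!: mult_left_mono)
  also have "\<dots> = e" using N by (simp add: \<delta>_def)
  finally show "\<zeta> (x, t) \<le> 0 + e" by simp
qed

end

section \<open>A priori estimates for the solution\<close>

interpretation whole: strip UNIV by unfold_locales simp

lemma dx_zero_outside:
  fixes f :: "(real^3) \<times> real \<Rightarrow> real"
  assumes "\<And>z. norm z > \<rho> \<Longrightarrow> f z = 0" "norm (x, t) > \<rho>"
  shows "dx j f (x, t) = 0"
proof (rule whole.dx_realI)
  have "isCont (\<lambda>h. norm (x + h *\<^sub>R axis j 1, t)) 0" by (intro continuous_intros)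
  then have "((\<lambda>h. norm (x + h *\<^sub>R axis j 1, t)) \<longlongrightarrow> norm (x, t)) (nhds 0)"
    using tendsto_at_iff_tendsto_nhds[of "\<lambda>h. norm (x + h *\<^sub>R axis j 1, t)" 0] by (simp add: isCont_def)
  then have "\<forall>\<^sub>F h in nhds 0. norm (x + h *\<^sub>R axis j 1, t) > \<rho>"
    by (rule order_tendstoD) (rule assms(2))
  then have ev: "\<forall>\<^sub>F h in nhds 0. f (x + h *\<^sub>R axis j 1, t) = 0" by eventually_elim (rule assms(1))
  show "((\<lambda>h. f (x + h *\<^sub>R axis j 1, t)) has_real_derivative 0) (at 0)"
    using DERIV_cong_ev[OF refl ev refl, of 0] by simp
qed

lemma bounded_if_zero_outside:
  fixes f :: "(real^3) \<times> real \<Rightarrow> real"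
  assumes "continuous_on UNIV f" "\<And>z. norm z > \<rho> \<Longrightarrow> f z = 0"
  shows "\<exists>B\<ge>0. \<forall>z. \<bar>f z\<bar> \<le> B"
proof -
  have "bounded (f ` cball 0 \<rho>)"
    by (intro compact_imp_bounded compact_continuous_image continuous_on_subset[OF assms(1)]) auto
  then obtain B where B: "\<forall>z\<in>cball 0 \<rho>. \<bar>f z\<bar> \<le> B" by (auto simp: bounded_iff)
  have "\<bar>f z\<bar> \<le> max B 0" for z using B assms(2)[of z] by (cases "norm z \<le> \<rho>") (auto simp: le_max_iff_disj)
  then show ?thesis by (intro exI[of _ "max B 0"]) auto
qed

lemma finite_family_bound:
  fixes f :: "'i::finite \<Rightarrow> 'a \<Rightarrow> real"
  assumes "\<And>i. \<exists>B\<ge>0. \<forall>z. \<bar>f i z\<bar> \<le> B"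
  shows "\<exists>B\<ge>0. \<forall>i z. \<bar>f i z\<bar> \<le> B"
proof -
  obtain B where B: "\<And>i. B i \<ge> 0" "\<And>i z. \<bar>f i z\<bar> \<le> B i" using assms by metis
  have "\<bar>f i z\<bar> \<le> (\<Sum>i\<in>UNIV. B i)" for i z
    using B(2)[of i z] member_le_sum[of i UNIV B] B(1) by fastforce
  then show ?thesis using B(1) by (intro exI[of _ "\<Sum>i\<in>UNIV. B i"]) (auto intro: sum_nonneg)
qed

context drift begin

lemma u_smooth_whole: "smooth_on (UNIV \<times> UNIV) (\<lambda>z. u z $ i)"
  using u_smooth by simp

lemma u_bounds:
  shows "\<exists>U\<ge>0. \<forall>j z. \<bar>u z $ j\<bar> \<le> U"
    and "\<exists>U\<ge>0. \<forall>j k z. \<bar>dx j (\<lambda>z. u z $ k) z\<bar> \<le> U"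
    and "\<exists>U\<ge>0. \<forall>i j k z. \<bar>dx i (dx j (\<lambda>z. u z $ k)) z\<bar> \<le> U"
    and "\<exists>P. \<forall>x t. \<bar>\<Sum>i\<in>UNIV. x $ i * u (x, t) $ i\<bar> \<le> P"
proof -
  obtain \<rho> where \<rho>: "\<rho> > 0" "\<And>z. norm z > \<rho> \<Longrightarrow> u z = 0" using u_supp by blast
  note sm = u_smooth_whole
  have c0: "continuous_on UNIV (\<lambda>z. u z $ i)" for i using smooth_on_imp_continuous_on[OF u_smooth] .
  have c1: "continuous_on UNIV (dx j (\<lambda>z. u z $ k))" for j k
    using smooth_on_imp_continuous_on[OF whole.smooth_dx[OF sm]] by simp
  have c2: "continuous_on UNIV (dx i (dx j (\<lambda>z. u z $ k)))" for i j k
    using smooth_on_imp_continuous_on[OF whole.smooth_dx[OF whole.smooth_dx[OF sm]]] by simp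
  have z0: "u z $ k = 0" if "norm z > \<rho>" for z k using \<rho>(2)[OF that] by simp
  have z1: "dx j (\<lambda>z. u z $ k) z = 0" if "norm z > \<rho>" for z j k
    using dx_zero_outside[of \<rho> "\<lambda>z. u z $ k"] z0 that by (cases z) auto
  have z2: "dx i (dx j (\<lambda>z. u z $ k)) z = 0" if "norm z > \<rho>" for z i j k
    using dx_zero_outside[of \<rho> "dx j (\<lambda>z. u z $ k)"] z1 that by (cases z) auto
  show "\<exists>U\<ge>0. \<forall>j z. \<bar>u z $ j\<bar> \<le> U"
    by (rule finite_family_bound) (rule bounded_if_zero_outside[OF c0 z0])
  have "\<exists>U\<ge>0. \<forall>p z. \<bar>(\<lambda>(j, k). dx j (\<lambda>z. u z $ k)) p z\<bar> \<le> U"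
  proof (rule finite_family_bound)
    fix p :: "3 \<times> 3"
    show "\<exists>U\<ge>0. \<forall>z. \<bar>(\<lambda>(j, k). dx j (\<lambda>z. u z $ k)) p z\<bar> \<le> U"
      unfolding case_prod_beta by (rule bounded_if_zero_outside[OF c1 z1])
  qed
  then show "\<exists>U\<ge>0. \<forall>j k z. \<bar>dx j (\<lambda>z. u z $ k) z\<bar> \<le> U" by auto
  have "\<exists>U\<ge>0. \<forall>p z. \<bar>(\<lambda>(i, j, k). dx i (dx j (\<lambda>z. u z $ k))) p z\<bar> \<le> U"
  proof (rule finite_family_bound)
    fix p :: "3 \<times> 3 \<times> 3"
    show "\<exists>U\<ge>0. \<forall>z. \<bar>(\<lambda>(i, j, k). dx i (dx j (\<lambda>z. u z $ k))) p z\<bar> \<le> U"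
      unfolding case_prod_beta by (rule bounded_if_zero_outside[OF c2 z2])
  qed
  then show "\<exists>U\<ge>0. \<forall>i j k z. \<bar>dx i (dx j (\<lambda>z. u z $ k)) z\<bar> \<le> U" by auto
  have "\<exists>B\<ge>0. \<forall>z. \<bar>\<Sum>i\<in>UNIV. fst z $ i * u z $ i\<bar> \<le> B"
    by (rule bounded_if_zero_outside[of _ \<rho>]) (auto intro!: continuous_intros c0 simp: z0)
  then show "\<exists>P. \<forall>x t. \<bar>\<Sum>i\<in>UNIV. x $ i * u (x, t) $ i\<bar> \<le> P" by auto
qed

end

text \<open>
  The drift vanishes for \<open>t < 2\<close>, so that the solution is explicitly known for times up to \<open>2\<close>, and every later
  time has one unit of positive time before it for the interior estimates.
\<close>

locale late_drift = drift +
  assumes u_late: "\<And>x t. t < 2 \<Longrightarrow> u (x, t) = 0"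

locale solution = late_drift +
  fixes A :: "(real^3) \<times> real \<Rightarrow> real^3"
  assumes A: "smooth_solution_A \<nu> u A"
begin

lemma A_smooth: "smooth_on (UNIV \<times> {0<..}) A"
  and A_cont: "continuous_on (UNIV \<times> {0..}) A"
  and A_eq: "t > 0 \<Longrightarrow> transport_diffusion \<nu> u A (x, t) = 0"
  and A_init: "A (x, 0) = x"
  and A_L2: "T > 0 \<Longrightarrow> L2_W2 T 2 (\<lambda>t x. A (x, t) - x)"
  using A by (auto simp: smooth_solution_A_def)

sublocale pos: drift_strip \<nu> u "{0<..}"
  by unfold_locales simp

lemma A_nth_smooth: "pos.smooth (\<lambda>z. A z $ i)"
  by (rule smooth_on_nth[OF pos.du A_smooth])

lemma A_nth_eq: "t > 0 \<Longrightarrow> pos.L (\<lambda>z. A z $ i) (x, t) = 0"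
  using pos.L_nth[OF A_smooth, of t x i] A_eq[of t x] by simp

lemma displacement_sq_finite:
  assumes T: "T > 0" and le: "\<And>x t. 0 < t \<Longrightarrow> t < T \<Longrightarrow> max 0 (v (x, t)) \<le> norm (A (x, t) - x)"
  shows "(\<integral>\<^sup>+t. indicator {0<..<T} t * (\<integral>\<^sup>+x. ennreal ((max 0 (v (x, t)))^2) \<partial>lborel) \<partial>lborel) < \<infinity>"
proof -
  have "(\<integral>\<^sup>+t. indicator {0<..<T} t * (\<integral>\<^sup>+x. ennreal ((max 0 (v (x, t)))^2) \<partial>lborel) \<partial>lborel)
    \<le> (\<integral>\<^sup>+t. indicator {0<..<T} t * (\<integral>\<^sup>+x. ennreal ((norm (A (x, t) - x))^2) \<partial>lborel) \<partial>lborel)"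
  proof (rule nn_integral_mono)
    fix t :: real
    show "indicator {0<..<T} t * (\<integral>\<^sup>+x. ennreal ((max 0 (v (x, t)))^2) \<partial>lborel)
      \<le> indicator {0<..<T} t * (\<integral>\<^sup>+x. ennreal ((norm (A (x, t) - x))^2) \<partial>lborel)"
    proof (cases "t \<in> {0<..<T}")
      case True
      then have "ennreal ((max 0 (v (x, t)))^2) \<le> ennreal ((norm (A (x, t) - x))^2)" for x
        using le[of t x] by (intro ennreal_leI power_mono) auto
      then show ?thesis by (intro mult_left_mono nn_integral_mono) auto
    qed simp
  qed
  also have "\<dots> < \<infinity>" by (rule L2_W2_finite[OF A_L2[OF T]])
  finally show ?thesis .
qed

text \<open>
  The function \<open>s * (A_i - x_i) - C t\<close> is a subsolution, because \<open>L x_i = u_i\<close>, and its positive part is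
  dominated by \<open>|A - x|\<close>.
\<close>

lemma displacement_one_sided:
  assumes T: "T > 0" and C: "C \<ge> 0" "\<And>x t. 0 < t \<Longrightarrow> t < T \<Longrightarrow> \<bar>u (x, t) $ i\<bar> \<le> C" and s: "s = 1 \<or> s = -1"
    and t: "0 \<le> t" "t < T"
  shows "s * (A (x, t) $ i - x $ i) \<le> C * t"
proof -
  interpret strip_L "{0<..<T}" \<nu> u by unfold_locales simp
  define v where "v z = s * (A z $ i - fst z $ i) - C * snd z" for z
  have smA: "smooth (\<lambda>z. A z $ i)"
    by (rule smooth_on_restrict[OF A_nth_smooth du]) auto
  have smv: "smooth v" unfolding v_def by (intro smooth_intros(1-9) smA)
  have "v (x, t) \<le> 0"
  proof (rule energy_max_principle[OF T smv])
    show "continuous_on (UNIV \<times> {0..<T}) v"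
      unfolding v_def by (intro continuous_intros continuous_on_subset[OF A_cont]) auto
    show "v (x, 0) \<le> 0" for x by (simp add: v_def A_init)
    show "L v (x, t) \<le> 0" if "0 < t" "t < T" for x t
    proof -
      have tI: "t \<in> {0<..<T}" using that by simp
      have "L v (x, t) = L (\<lambda>z. s * (A z $ i - fst z $ i)) (x, t) - L (\<lambda>z. C * snd z) (x, t)"
        unfolding v_def by (rule L_diff[OF tI]) (intro smooth_intros(1-9) smA)+
      also have "L (\<lambda>z. C * snd z) (x, t) = C"
        by (rule L_time[where g="\<lambda>t. C * t"]) (auto intro!: derivative_eq_intros)
      also have "L (\<lambda>z. s * (A z $ i - fst z $ i)) (x, t) = s * L (\<lambda>z. A z $ i - fst z $ i) (x, t)"
        by (rule L_cmult[OF tI]) (intro smooth_intros(1-9) smA)+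
      also have "L (\<lambda>z. A z $ i - fst z $ i) (x, t) = - u (x, t) $ i"
        unfolding L_diff[OF tI smA smooth_on_coord[OF du]] L_coord using A_nth_eq that by simp
      finally show ?thesis using C(2)[OF that, of x] s by auto
    qed
    show "(\<integral>\<^sup>+t. indicator {0<..<T} t * (\<integral>\<^sup>+x. ennreal ((max 0 (v (x, t)))^2) \<partial>lborel) \<partial>lborel) < \<infinity>"
    proof (rule displacement_sq_finite[OF T])
      fix x t assume "0 < t" "t < T"
      then have "0 \<le> C * t" using C by simp
      then have "v (x, t) \<le> \<bar>(A (x, t) - x) $ i\<bar>"
        using s abs_ge_self[of "(A (x, t) - x) $ i"] abs_ge_minus_self[of "(A (x, t) - x) $ i"] by (auto simp: v_def)
      also have "\<dots> \<le> norm (A (x, t) - x)" by (rule component_le_norm_cart)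
      finally show "max 0 (v (x, t)) \<le> norm (A (x, t) - x)" by simp
    qed
  qed (use t in auto)
  then show ?thesis by (simp add: v_def)
qed

lemma A_early:
  assumes "0 \<le> t" "t < 2" shows "A (x, t) = x"
proof -
  have "A (x, t) $ i = x $ i" for i
    using displacement_one_sided[of 2 0 i 1 t x] displacement_one_sided[of 2 0 i "-1" t x] u_late assms by simp
  then show ?thesis by (simp add: vec_eq_iff)
qed

lemma A_growth:
  assumes "\<And>j z. \<bar>u z $ j\<bar> \<le> U" "t \<ge> 0"
  shows "\<bar>A (x, t) $ i - x $ i\<bar> \<le> U * t"
proof -
  have U: "U \<ge> 0" using assms(1)[of undefined i] by simp
  show ?thesis
    using displacement_one_sided[of "t + 1" U i 1 t x] displacement_one_sided[of "t + 1" U i "-1" t x] U assms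
    by (simp add: abs_le_iff)
qed

lemma dx_A_early: "0 \<le> t \<Longrightarrow> t < 2 \<Longrightarrow> dx j (\<lambda>z. A z $ i) (x, t) = (if i = j then 1 else 0)"
  using whole.dx_cong[of "\<lambda>z. A z $ i" t "\<lambda>z. fst z $ i"] A_early whole.dx_coord by simp

lemma dxdx_A_early: "0 \<le> t \<Longrightarrow> t < 2 \<Longrightarrow> dx k (dx j (\<lambda>z. A z $ i)) (x, t) = 0"
  using whole.dx_cong[of "dx j (\<lambda>z. A z $ i)" t "\<lambda>z. if i = j then 1 else 0"] dx_A_early whole.dx_const by simp

text \<open>
  For \<open>t < 2\<close> the gradient is the identity matrix.  For later times the interior estimate applies to
  \<open>A_i\<close> minus the coordinate of the centre of the cylinder: subtracting this constant makes the bound for the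
  function uniform in the centre.
\<close>

lemma gradient_bounded: "\<exists>G\<ge>0. \<forall>x t i j. 0 < t \<longrightarrow> t \<le> T \<longrightarrow> \<bar>dx j (\<lambda>z. A z $ i) (x, t)\<bar> \<le> G"
proof -
  obtain U where U: "U \<ge> 0" "\<And>j z. \<bar>u z $ j\<bar> \<le> U" using u_bounds(1) by blast
  obtain U1 where U1: "U1 \<ge> 0" "\<And>j k z. \<bar>dx j (\<lambda>z. u z $ k) z\<bar> \<le> U1" using u_bounds(2) by blast
  define V where "V = U * max T 0 + 1"
  define \<Lambda> where "\<Lambda> = (2 + 6 * U1 + 12 * U + 44 * \<nu>) / (2 * \<nu>)"
  define B where "B = \<Lambda> * V^2 + 3 * 0^2 + \<Lambda> * (V^2 + 0^2)"
  have est: "\<bar>dx j (\<lambda>z. A z $ i) (x, t)\<bar> \<le> sqrt B" if t: "1 < t" "t \<le> T" for x t i j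
  proof -
    let ?v = "\<lambda>z. A z $ i - x $ i"
    have smv: "pos.smooth ?v" by (intro pos.smooth_intros(1-9) A_nth_smooth)
    have Lv: "pos.L ?v (y, s) = 0" if "s > 0" for y s
    proof -
      have s: "s \<in> {0<..}" using that by simp
      show ?thesis unfolding pos.L_diff[OF s A_nth_smooth pos.smooth_intros(1)] pos.L_const using A_nth_eq that by simp
    qed
    have "(\<Sum>j\<in>UNIV. (dx j ?v (x, t))^2) \<le> B"
      unfolding B_def \<Lambda>_def
    proof (rule pos.gradient_estimate[OF nu smv pos.u_smooth' _ U(1) U1(1)])
      show "{t - 1..t} \<subseteq> {0<..}" using t by auto
      fix y s assume y: "dist x y \<le> 1" and s: "t - 1 \<le> s" "s \<le> t"
      have s0: "s > 0" using s t by simp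
      have "\<bar>A (y, s) $ i - y $ i\<bar> \<le> U * s" using A_growth[OF U(2)] s0 by simp
      moreover have "U * s \<le> U * max T 0" using s t U by (intro mult_left_mono) auto
      moreover have "\<bar>y $ i - x $ i\<bar> \<le> 1"
        using component_le_norm_cart[of "y - x" i] y by (simp add: dist_norm norm_minus_commute)
      ultimately have "\<bar>A (y, s) $ i - x $ i\<bar> \<le> V" unfolding V_def by linarith
      moreover have "dx j (pos.L ?v) (y, s) = 0" for j
        using whole.dx_cong[of "pos.L ?v" s "\<lambda>z. 0" j y] Lv[OF s0] whole.dx_const by simp
      ultimately show "\<bar>A (y, s) $ i - x $ i\<bar> \<le> V \<and> \<bar>pos.L ?v (y, s)\<bar> \<le> 0 \<and> (\<forall>j. \<bar>dx j (pos.L ?v) (y, s)\<bar> \<le> 0)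
        \<and> (\<forall>j. \<bar>u (y, s) $ j\<bar> \<le> U) \<and> (\<forall>j k. \<bar>dx j (\<lambda>z. u z $ k) (y, s)\<bar> \<le> U1)"
        using U(2) U1(2) Lv[OF s0] by simp
    qed
    moreover have "(dx j ?v (x, t))^2 \<le> (\<Sum>j\<in>UNIV. (dx j ?v (x, t))^2)" by (rule member_le_sum) auto
    moreover have "dx j ?v (x, t) = dx j (\<lambda>z. A z $ i) (x, t)"
    proof -
      have s: "t \<in> {0<..}" using t by simp
      show ?thesis unfolding pos.dx_diff[OF s A_nth_smooth pos.smooth_intros(1)] pos.dx_const by simp
    qed
    ultimately have "(dx j (\<lambda>z. A z $ i) (x, t))^2 \<le> B" by simp
    then show ?thesis by (rule real_le_rsqrt[of "\<bar>_\<bar>", simplified])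
  qed
  have "\<bar>dx j (\<lambda>z. A z $ i) (x, t)\<bar> \<le> max 1 (sqrt B)" if "0 < t" "t \<le> T" for x t i j
    using est[of t j i x] dx_A_early[of t j i x] that by (cases "t < 2") (auto simp: le_max_iff_disj)
  then show ?thesis by (intro exI[of _ "max 1 (sqrt B)"]) auto
qed

lemma second_derivatives_bounded: "\<exists>H\<ge>0. \<forall>x t i j k. 0 < t \<longrightarrow> t \<le> T \<longrightarrow> \<bar>dx k (dx j (\<lambda>z. A z $ i)) (x, t)\<bar> \<le> H"
proof -
  obtain U where U: "U \<ge> 0" "\<And>j z. \<bar>u z $ j\<bar> \<le> U" using u_bounds(1) by blast
  obtain U1 where U1: "U1 \<ge> 0" "\<And>j k z. \<bar>dx j (\<lambda>z. u z $ k) z\<bar> \<le> U1" using u_bounds(2) by blast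
  obtain U2 where U2: "U2 \<ge> 0" "\<And>i j k z. \<bar>dx i (dx j (\<lambda>z. u z $ k)) z\<bar> \<le> U2" using u_bounds(3) by blast
  obtain G where G: "G \<ge> 0" "\<And>x t i j. 0 < t \<Longrightarrow> t \<le> T \<Longrightarrow> \<bar>dx j (\<lambda>z. A z $ i) (x, t)\<bar> \<le> G" using gradient_bounded by blast
  define \<Lambda> where "\<Lambda> = (10 + 36 * U1 + 12 * U + 44 * \<nu>) / (2 * \<nu>)"
  define B where "B = \<Lambda> * (3 * G^2) + 9 * U2^2 * G^2 + \<Lambda> * (18 * U1 * G^2)"
  have est: "\<bar>dx k (dx j (\<lambda>z. A z $ i)) (x, t)\<bar> \<le> sqrt B" if t: "1 < t" "t \<le> T" for x t i j k
  proof -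
    have "(dx k (dx j (\<lambda>z. A z $ i)) (x, t))^2 \<le> B"
      unfolding B_def \<Lambda>_def
      by (rule pos.second_derivative_estimate[OF nu A_nth_smooth pos.u_smooth' _ U(1) U1(1) U2(1) G(1) A_nth_eq])
        (use t U U1 U2 G(2) in auto)
    then show ?thesis by (rule real_le_rsqrt[of "\<bar>_\<bar>", simplified])
  qed
  have "\<bar>dx k (dx j (\<lambda>z. A z $ i)) (x, t)\<bar> \<le> max 0 (sqrt B)" if "0 < t" "t \<le> T" for x t i j k
    using est[of t k j i x] dxdx_A_early[of t k j i x] that by (cases "t < 2") (auto simp: le_max_iff_disj)
  then show ?thesis by (intro exI[of _ "max 0 (sqrt B)"]) auto
qed

end

section \<open>Consequences of a singular gradient\<close>

lemma matrix_axis_expansion: "(\<chi> i j. g i j) = (\<Sum>i\<in>UNIV. \<Sum>j\<in>UNIV. g i j *\<^sub>R axis i (axis j 1))"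
  for g :: "'n::finite \<Rightarrow> 'm::finite \<Rightarrow> real"
proof -
  have inner: "(\<Sum>j\<in>UNIV. g i j *\<^sub>R axis i (axis j 1)) = axis i (\<chi> j. g i j)" for i
  proof (subst vec_eq_iff, rule allI)
    fix a
    show "(\<Sum>j\<in>UNIV. g i j *\<^sub>R axis i (axis j 1)) $ a = axis i (\<chi> j. g i j) $ a"
      by (cases "a = i") (simp_all add: vec_eq_iff axis_def if_distrib[of "(*) _"] cong: if_cong)
  qed
  have outer: "(\<Sum>i\<in>UNIV. axis i (v i)) = (\<chi> i. v i)" for v :: "'n \<Rightarrow> real^'m"
    by (subst vec_eq_iff) (simp add: axis_def)
  show ?thesis unfolding inner outer ..
qed

context solution begin

definition G :: "3 \<Rightarrow> 3 \<Rightarrow> (real^3) \<times> real \<Rightarrow> real" where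
  "G i k = dx k (\<lambda>z. A z $ i)"

lemma G_smooth: "pos.smooth (G i k)"
  unfolding G_def by (rule pos.smooth_dx[OF A_nth_smooth])

lemma grad_A: "t > 0 \<Longrightarrow> grad A (x, t) $ i $ k = G i k (x, t)"
  using pos.dx_nth[OF A_smooth, of t k x i] by (simp add: grad_def G_def)

lemma G_early: "0 \<le> t \<Longrightarrow> t < 2 \<Longrightarrow> G i k (x, t) = (if i = k then 1 else 0)"
  unfolding G_def by (rule dx_A_early)

lemma grad_A_smooth: "pos.smooth (grad A)"
proof -
  have "pos.smooth (\<lambda>z. \<Sum>i\<in>UNIV. \<Sum>j\<in>UNIV. G i j z *\<^sub>R axis i (axis j 1) :: real^3^3)"
    by (intro smooth_on_sum smooth_on_scaleR_const pos.du G_smooth)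
  moreover have "grad A z = (\<Sum>i\<in>UNIV. \<Sum>j\<in>UNIV. G i j z *\<^sub>R axis i (axis j 1))" if "z \<in> UNIV \<times> {0<..}" for z
    unfolding matrix_axis_expansion[symmetric] using that grad_A[of "snd z" "fst z"] by (simp add: vec_eq_iff mem_Times_iff)
  ultimately show ?thesis by (rule smooth_on_cong[THEN iffD2, rotated])
qed

lemma dx_grad_A:
  assumes t: "t > 0" shows "dx m (grad A) (x, t) $ l $ n = dx m (G l n) (x, t)"
proof -
  have tI: "t \<in> {0<..}" using t by simp
  have "dx m (grad A) (x, t) $ l $ n = dx m (\<lambda>z. grad A z $ l $ n) (x, t)"
    unfolding pos.dx_nth[OF grad_A_smooth tI]
    by (rule pos.dx_nth[OF smooth_on_nth[OF pos.du grad_A_smooth] tI])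
  also have "\<dots> = dx m (G l n) (x, t)" by (rule whole.dx_cong) (rule grad_A[OF t])
  finally show ?thesis .
qed

text \<open>
  The gradient of the equation for \<open>A\<close>.  The right-hand side is \<open>- G (grad u)\<close>, which cancels the term
  \<open>(grad u) Q\<close> in the equation for \<open>G Q\<close>.
\<close>

lemma L_G:
  assumes t: "t > 0" shows "pos.L (G i k) (x, t) = - (\<Sum>l\<in>UNIV. dx k (\<lambda>z. u z $ l) (x, t) * G i l (x, t))"
proof -
  have tI: "t \<in> {0<..}" using t by simp
  show ?thesis unfolding G_def
    using pos.L_dx[OF A_nth_smooth pos.u_smooth' tI, of i "\<lambda>z. 0" k x] A_nth_eq[OF t] pos.dx_const by simp
qed

text \<open>
  Continuity up to the initial time is not part of the smoothness of \<open>A\<close>; it holds because \<open>A (x, t) = x\<close>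
  for small times.
\<close>

lemma G_continuous: "continuous_on (UNIV \<times> {0..}) (G i k)"
  unfolding continuous_on_eq_continuous_within
proof
  fix z :: "(real^3) \<times> real" assume z: "z \<in> UNIV \<times> {0..}"
  obtain x t where xt: "z = (x, t)" by (cases z)
  show "continuous (at z within UNIV \<times> {0..}) (G i k)"
  proof (cases "t < 2")
    case True
    show ?thesis
    proof (rule continuous_transform_within[of _ _ "\<lambda>z. if i = k then 1 else 0" "2 - t"])
      fix w :: "(real^3) \<times> real" assume w: "w \<in> UNIV \<times> {0..}" "dist w z < 2 - t"
      have "\<bar>snd w - t\<bar> < 2 - t" using dist_snd_le[of w z] w(2) xt by (simp add: dist_real_def)
      then have "snd w < 2" by linarith
      then show "(if i = k then 1 else 0) = G i k w" using w(1) G_early[of "snd w" i k "fst w"] by (cases w) auto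
    qed (use True z in auto)
  next
    case False
    then have "isCont (G i k) z"
      using smooth_on_imp_continuous_on[OF G_smooth] pos.open_strip xt by (simp add: continuous_on_eq_continuous_at)
    then show ?thesis by (rule continuous_at_imp_continuous_at_within)
  qed
qed

lemma grad_u: "grad u (x, t) $ i $ k = dx k (\<lambda>z. u z $ i) (x, t)"
  using whole.dx_nth[of u t k x i] u_smooth_vec by (simp add: grad_def)

end

locale solution_Q = solution +
  fixes T :: real and Q :: "(real^3) \<times> real \<Rightarrow> real^3^3"
  assumes T: "T > 0" and Q: "smooth_solution_Q \<nu> u A T Q"
begin

sublocale st: drift_strip \<nu> u "{0<..<T}"
  by unfold_locales simp

definition q :: "3 \<Rightarrow> 3 \<Rightarrow> (real^3) \<times> real \<Rightarrow> real" where
  "q i j = (\<lambda>z. Q z $ i $ j)"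

lemma Q_smooth: "st.smooth Q" and Q_cont: "continuous_on (UNIV \<times> {0..<T}) Q"
  and Q_bounded: "t < T \<Longrightarrow> bounded (Q ` (UNIV \<times> {0..t}))"
  and dQ_bounded: "t < T \<Longrightarrow> bounded (dx k Q ` (UNIV \<times> {0..t}))"
  and Q_eq: "0 < t \<Longrightarrow> t < T \<Longrightarrow> transport_diffusion \<nu> u Q (x, t) = grad u (x, t) ** Q (x, t)
          + (2 * \<nu>) *\<^sub>R (\<Sum>k\<in>UNIV. Q (x, t) ** dx k (grad A) (x, t) ** dx k Q (x, t))"
  and Q_init: "Q (x, 0) = mat 1"
  using Q by (auto simp: smooth_solution_Q_def)

lemma q_smooth: "st.smooth (q i j)"
  unfolding q_def by (intro smooth_on_nth st.du Q_smooth)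

lemma G_smooth': "st.smooth (G i j)"
  by (rule smooth_on_restrict[OF G_smooth st.du]) auto

lemma dx_Q: "0 < t \<Longrightarrow> t < T \<Longrightarrow> dx m Q (x, t) $ i $ j = dx m (q i j) (x, t)"
  unfolding q_def using st.dx_nth[OF Q_smooth, of t m x i] st.dx_nth[OF smooth_on_nth[OF st.du Q_smooth], of t m i x j] by simp

lemma L_q:
  assumes t: "0 < t" "t < T"
  shows "st.L (q i j) (x, t) = (\<Sum>l\<in>UNIV. dx l (\<lambda>z. u z $ i) (x, t) * q l j (x, t))
    + 2 * \<nu> * (\<Sum>m\<in>UNIV. \<Sum>n\<in>UNIV. (\<Sum>l\<in>UNIV. q i l (x, t) * dx m (G l n) (x, t)) * dx m (q n j) (x, t))"
proof -
  have tI: "t \<in> {0<..<T}" using t by simp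
  have "st.L (q i j) (x, t) = st.L Q (x, t) $ i $ j"
    unfolding q_def using st.L_nth[OF Q_smooth tI, of x i] st.L_nth[OF smooth_on_nth[OF st.du Q_smooth] tI, of i x j] by simp
  then show ?thesis unfolding Q_eq[OF t]
    by (simp add: matrix_matrix_mult_def grad_u dx_grad_A[OF t(1)] dx_Q[OF t] q_def)
qed

text \<open>
  The entries of \<open>G Q - I\<close>, and the matrix \<open>M\<close> of its equation \<open>L Z = 2 \<nu> Z M\<close>.
\<close>

definition Z :: "3 \<Rightarrow> 3 \<Rightarrow> (real^3) \<times> real \<Rightarrow> real" where
  "Z i j = (\<lambda>z. (\<Sum>k\<in>UNIV. G i k z * q k j z) - (if i = j then 1 else 0))"

definition M :: "3 \<Rightarrow> 3 \<Rightarrow> (real^3) \<times> real \<Rightarrow> real" where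
  "M l j = (\<lambda>z. \<Sum>m\<in>UNIV. \<Sum>n\<in>UNIV. dx m (G l n) z * dx m (q n j) z)"

lemma Z_smooth: "st.smooth (Z i j)"
  unfolding Z_def by (intro smooth_on_diff smooth_on_sum smooth_on_mult smooth_on_const st.du G_smooth' q_smooth)

text \<open>
  The product rule for \<open>G Q\<close> produces \<open>- 2 \<nu> (\<Sum>m. (D_m G) (D_m Q))\<close>, while the nonlinear term of the
  equation for \<open>Q\<close> contributes \<open>2 \<nu> G Q (\<Sum>m. (D_m G) (D_m Q))\<close>.  Their sum is a multiple of \<open>G Q - I\<close>.
\<close>

lemma L_Z:
  assumes t: "0 < t" "t < T"
  shows "st.L (Z i j) (x, t) = 2 * \<nu> * (\<Sum>l\<in>UNIV. Z i l (x, t) * M l j (x, t))"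
proof -
  have tI: "t \<in> {0<..<T}" using t by simp
  let ?G = "\<lambda>i k. G i k (x, t)" and ?q = "\<lambda>i k. q i k (x, t)" and ?u = "\<lambda>k l. dx k (\<lambda>z. u z $ l) (x, t)"
  let ?dG = "\<lambda>m l n. dx m (G l n) (x, t)" and ?dq = "\<lambda>m n j. dx m (q n j) (x, t)"
  have sm: "st.smooth (\<lambda>z. G i k z * q k j z)" for k by (intro smooth_on_mult st.du G_smooth' q_smooth)
  have "st.L (Z i j) (x, t) = (\<Sum>k\<in>UNIV. st.L (\<lambda>z. G i k z * q k j z) (x, t))"
    unfolding Z_def
    by (subst st.L_diff[OF tI smooth_on_sum[OF st.du sm] smooth_on_const[OF st.du]], subst st.L_sum[OF tI sm], subst st.L_const) simp
  also have "\<dots> = (\<Sum>k\<in>UNIV. ?G i k * st.L (q k j) (x, t)) + (\<Sum>k\<in>UNIV. ?q k j * pos.L (G i k) (x, t))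
     - 2 * \<nu> * (\<Sum>k\<in>UNIV. \<Sum>m\<in>UNIV. ?dG m i k * ?dq m k j)"
    by (simp add: st.L_mult[OF tI G_smooth' q_smooth] sum.distrib sum_subtractf sum_distrib_left)
  also have "(\<Sum>k\<in>UNIV. ?q k j * pos.L (G i k) (x, t)) = - (\<Sum>k\<in>UNIV. \<Sum>l\<in>UNIV. ?q k j * (?u k l * ?G i l))"
    unfolding L_G[OF t(1)] by (simp add: sum_distrib_left sum_negf)
  also have "(\<Sum>k\<in>UNIV. ?G i k * st.L (q k j) (x, t)) = (\<Sum>k\<in>UNIV. \<Sum>l\<in>UNIV. ?G i k * (?u l k * ?q l j))
     + 2 * \<nu> * (\<Sum>k\<in>UNIV. ?G i k * (\<Sum>m\<in>UNIV. \<Sum>n\<in>UNIV. (\<Sum>l\<in>UNIV. ?q k l * ?dG m l n) * ?dq m n j))"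
    unfolding L_q[OF t] by (simp add: sum_distrib_left distrib_left sum.distrib mult.left_commute)
  also have "(\<Sum>k\<in>UNIV. \<Sum>l\<in>UNIV. ?G i k * (?u l k * ?q l j)) = (\<Sum>k\<in>UNIV. \<Sum>l\<in>UNIV. ?q k j * (?u k l * ?G i l))"
    by (subst sum.swap) (simp add: mult_ac)
  also have "(\<Sum>k\<in>UNIV. ?G i k * (\<Sum>m\<in>UNIV. \<Sum>n\<in>UNIV. (\<Sum>l\<in>UNIV. ?q k l * ?dG m l n) * ?dq m n j))
     = (\<Sum>l\<in>UNIV. (\<Sum>k\<in>UNIV. ?G i k * ?q k l) * M l j (x, t))"
    unfolding M_def sum_3 by (simp add: algebra_simps)
  also have "(\<Sum>k\<in>UNIV. \<Sum>m\<in>UNIV. ?dG m i k * ?dq m k j) = M i j (x, t)"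
    unfolding M_def by (rule sum.swap)
  finally have e: "st.L (Z i j) (x, t) = 2 * \<nu> * ((\<Sum>l\<in>UNIV. (\<Sum>k\<in>UNIV. ?G i k * ?q k l) * M l j (x, t)) - M i j (x, t))"
    by (simp add: algebra_simps)
  have "(\<Sum>l\<in>UNIV. Z i l (x, t) * M l j (x, t)) = (\<Sum>l\<in>UNIV. (\<Sum>k\<in>UNIV. ?G i k * ?q k l) * M l j (x, t)) - (\<Sum>l\<in>UNIV. (if i = l then M l j (x, t) else 0))"
    unfolding Z_def sum_subtractf[symmetric] by (intro sum.cong refl) (simp add: algebra_simps)
  then show ?thesis unfolding e by simp
qed

lemma Z_continuous: "t < T \<Longrightarrow> continuous_on (UNIV \<times> {0..t}) (Z i j)"
  unfolding Z_def q_def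
  by (intro continuous_intros continuous_on_subset[OF G_continuous] continuous_on_subset[OF Q_cont]) auto

lemma M_bounded:
  assumes t: "t < T" shows "\<exists>K\<ge>0. \<forall>x s l j. 0 < s \<longrightarrow> s \<le> t \<longrightarrow> \<bar>M l j (x, s)\<bar> \<le> K"
proof -
  obtain H where H: "H \<ge> 0" "\<And>x s i j k. 0 < s \<Longrightarrow> s \<le> t \<Longrightarrow> \<bar>dx k (dx j (\<lambda>z. A z $ i)) (x, s)\<bar> \<le> H"
    using second_derivatives_bounded[of t] by blast
  have "\<exists>D. \<forall>z\<in>UNIV \<times> {0..t}. norm (dx k Q z) \<le> D" for k using dQ_bounded[OF t] by (auto simp: bounded_iff)
  then obtain D where D: "\<And>k z. z \<in> UNIV \<times> {0..t} \<Longrightarrow> norm (dx k Q z) \<le> D k" by metis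
  define D' where "D' = (\<Sum>k\<in>UNIV. \<bar>D k\<bar>)"
  have D': "\<bar>dx m (q n j) (x, s)\<bar> \<le> D'" if "0 < s" "s \<le> t" for x s m n j
  proof -
    have "\<bar>dx m (q n j) (x, s)\<bar> = \<bar>dx m Q (x, s) $ n $ j\<bar>" using dx_Q[of s m x n j] that t by simp
    also have "\<dots> \<le> norm (dx m Q (x, s) $ n)" by (rule component_le_norm_cart)
    also have "\<dots> \<le> norm (dx m Q (x, s))" by (rule Finite_Cartesian_Product.norm_nth_le)
    also have "\<dots> \<le> \<bar>D m\<bar>" using D[of "(x, s)" m] that by simp
    also have "\<dots> \<le> D'" unfolding D'_def by (rule member_le_sum) auto
    finally show ?thesis .
  qed
  have "\<bar>M l j (x, s)\<bar> \<le> 9 * (H * D')" if "0 < s" "s \<le> t" for x s l j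
  proof -
    have "\<bar>M l j (x, s)\<bar> \<le> (\<Sum>m\<in>(UNIV::3 set). \<Sum>n\<in>(UNIV::3 set). H * D')"
      unfolding M_def
    proof (intro order_trans[OF sum_abs] sum_mono)
      fix m n :: 3
      show "\<bar>dx m (G l n) (x, s) * dx m (q n j) (x, s)\<bar> \<le> H * D'"
        unfolding abs_mult using H D' that by (intro mult_mono) (auto simp: G_def)
    qed
    then show ?thesis by simp
  qed
  moreover have "D' \<ge> 0" unfolding D'_def by (rule sum_nonneg) auto
  ultimately show ?thesis using H(1) by (intro exI[of _ "9 * (H * D')"]) auto
qed

lemma Z_bounded:
  assumes t: "t < T" shows "\<exists>K. \<forall>x s i j. 0 \<le> s \<longrightarrow> s \<le> t \<longrightarrow> \<bar>Z i j (x, s)\<bar> \<le> K"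
proof -
  obtain B where B: "B \<ge> 0" "\<And>x s i j. 0 < s \<Longrightarrow> s \<le> t \<Longrightarrow> \<bar>dx j (\<lambda>z. A z $ i) (x, s)\<bar> \<le> B" using gradient_bounded[of t] by blast
  have GB: "\<bar>G i k (x, s)\<bar> \<le> max B 1" if "0 \<le> s" "s \<le> t" for i k x s
    using B(2)[of s k i x] G_early[of s i k x] that by (cases "s = 0") (auto simp: G_def le_max_iff_disj)
  obtain C where C: "\<And>z. z \<in> UNIV \<times> {0..t} \<Longrightarrow> norm (Q z) \<le> C" using Q_bounded[OF t] by (auto simp: bounded_iff)
  have qC: "\<bar>q k j (x, s)\<bar> \<le> C" if "0 \<le> s" "s \<le> t" for k j x s
    unfolding q_def using component_le_norm_cart[of "Q (x, s) $ k" j] Finite_Cartesian_Product.norm_nth_le[of "Q (x, s)" k] C[of "(x, s)"] that by simp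
  have "\<bar>Z i j (x, s)\<bar> \<le> 3 * (max B 1 * C) + 1" if "0 \<le> s" "s \<le> t" for x s i j
  proof -
    have "\<bar>\<Sum>k\<in>UNIV. G i k (x, s) * q k j (x, s)\<bar> \<le> (\<Sum>k\<in>(UNIV::3 set). max B 1 * C)"
      using GB[OF that] qC[OF that] by (intro order_trans[OF sum_abs] sum_mono) (auto simp: abs_mult intro!: mult_mono)
    then show ?thesis unfolding Z_def
      by (intro order_trans[OF abs_triangle_ineq4]) auto
  qed
  then show ?thesis by blast
qed

text \<open>
  The sum of the squares of all entries of \<open>Z\<close> vanishes initially, is bounded, and satisfies
  \<open>L \<zeta> \<le> const * \<zeta>\<close>, since \<open>2 |Z_ij| |Z_il| \<le> Z_ij^2 + Z_il^2\<close>.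
\<close>

lemma Z_zero:
  assumes t: "0 < t" "t < T" shows "Z i j (x, t) = 0"
proof -
  obtain K where K: "K \<ge> 0" "\<And>x s l j. 0 < s \<Longrightarrow> s \<le> t \<Longrightarrow> \<bar>M l j (x, s)\<bar> \<le> K" using M_bounded[OF t(2)] by blast
  obtain B where B: "\<And>x s i j. 0 \<le> s \<Longrightarrow> s \<le> t \<Longrightarrow> \<bar>Z i j (x, s)\<bar> \<le> B" using Z_bounded[OF t(2)] by blast
  obtain P where P: "\<And>x t. \<bar>\<Sum>i\<in>UNIV. x $ i * u (x, t) $ i\<bar> \<le> P" using u_bounds(4) by blast
  define W where "W = (\<lambda>(i, j). Z i j)"
  have smW: "st.smooth (W p)" for p unfolding W_def by (cases p) (simp add: Z_smooth)
  define \<zeta> where "\<zeta> = (\<lambda>z. \<Sum>p\<in>UNIV. (W p z)^2)"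
  have z0: "Z i j (x, 0) = 0" for i j x
    unfolding Z_def q_def Q_init using G_early[of 0] by (simp add: mat_def mult_delta_left)
  have "\<zeta> (x, t) \<le> 0"
  proof (rule st.whole_space_max_principle[OF nu, of _ t "9 * B^2" "2 * \<nu> * K * 6" P])
    show "st.smooth \<zeta>" unfolding \<zeta>_def by (intro smooth_on_sum smooth_on_power st.du smW)
    show "{0<..t} \<subseteq> {0<..<T}" using t by auto
    show "continuous_on (UNIV \<times> {0..t}) \<zeta>"
      unfolding \<zeta>_def W_def case_prod_beta by (intro continuous_intros Z_continuous[OF t(2)])
    show "\<zeta> (y, s) \<le> 9 * B^2" if "0 \<le> s" "s \<le> t" for y s
    proof -
      have "(W p (y, s))^2 \<le> B^2" for p
        using B[OF that, of "fst p" "snd p" y] unfolding W_def case_prod_beta by (metis abs_ge_zero power2_abs power_mono)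
      then have "\<zeta> (y, s) \<le> (\<Sum>p\<in>(UNIV::(3\<times>3) set). B^2)" unfolding \<zeta>_def by (intro sum_mono)
      then show ?thesis by simp
    qed
    show "\<zeta> (y, 0) \<le> 0" for y unfolding \<zeta>_def W_def by (simp add: z0 case_prod_beta)
    show "st.L \<zeta> (y, s) \<le> 2 * \<nu> * K * 6 * \<zeta> (y, s)" if s: "0 < s" "s \<le> t" for y s
    proof -
      have sI: "s \<in> {0<..<T}" using s t by simp
      have row: "2 * W (a, b) (y, s) * st.L (W (a, b)) (y, s) \<le> 2 * \<nu> * K * (\<Sum>l\<in>UNIV. (W (a, b) (y, s))^2 + (W (a, l) (y, s))^2)" for a b
      proof -
        have "2 * Z a b (y, s) * (Z a l (y, s) * M l b (y, s)) \<le> K * ((Z a b (y, s))^2 + (Z a l (y, s))^2)" for l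
        proof -
          have "2 * Z a b (y, s) * (Z a l (y, s) * M l b (y, s)) \<le> \<bar>M l b (y, s)\<bar> * (2 * \<bar>Z a b (y, s)\<bar> * \<bar>Z a l (y, s)\<bar>)"
            using abs_ge_self[of "2 * Z a b (y, s) * (Z a l (y, s) * M l b (y, s))"] by (simp add: abs_mult mult_ac)
          also have "\<dots> \<le> K * (2 * \<bar>Z a b (y, s)\<bar> * \<bar>Z a l (y, s)\<bar>)" using K(2)[OF s] by (intro mult_right_mono) auto
          also have "\<dots> \<le> K * ((Z a b (y, s))^2 + (Z a l (y, s))^2)"
            using sum_squares_bound[of "\<bar>Z a b (y, s)\<bar>" "\<bar>Z a l (y, s)\<bar>"] K(1) by (intro mult_left_mono) auto
          finally show ?thesis .
        qed
        then have "(\<Sum>l\<in>UNIV. 2 * Z a b (y, s) * (Z a l (y, s) * M l b (y, s))) \<le> (\<Sum>l\<in>UNIV. K * ((Z a b (y, s))^2 + (Z a l (y, s))^2))"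
          by (rule sum_mono)
        then have "2 * \<nu> * (\<Sum>l\<in>UNIV. 2 * Z a b (y, s) * (Z a l (y, s) * M l b (y, s))) \<le> 2 * \<nu> * (\<Sum>l\<in>UNIV. K * ((Z a b (y, s))^2 + (Z a l (y, s))^2))"
          using nu by (intro mult_left_mono) auto
        moreover have "2 * W (a, b) (y, s) * st.L (W (a, b)) (y, s) = 2 * \<nu> * (\<Sum>l\<in>UNIV. 2 * Z a b (y, s) * (Z a l (y, s) * M l b (y, s)))"
          unfolding W_def prod.case using L_Z[of s a b y] s t by (simp add: sum_distrib_left mult_ac)
        ultimately show ?thesis by (simp add: W_def sum_distrib_left mult_ac)
      qed
      have "st.L \<zeta> (y, s) \<le> (\<Sum>p\<in>UNIV. 2 * W p (y, s) * st.L (W p) (y, s))"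
        unfolding \<zeta>_def st.sum_squares_family(2)[of W, OF smW sI]
        using nu by (simp add: sum_nonneg)
      also have "\<dots> = (\<Sum>a\<in>UNIV. \<Sum>b\<in>UNIV. 2 * W (a, b) (y, s) * st.L (W (a, b)) (y, s))"
        unfolding UNIV_Times_UNIV[symmetric] sum.cartesian_product by (simp add: split_beta)
      also have "\<dots> \<le> (\<Sum>a\<in>UNIV. \<Sum>b\<in>UNIV. 2 * \<nu> * K * (\<Sum>l\<in>UNIV. (W (a, b) (y, s))^2 + (W (a, l) (y, s))^2))"
        by (intro sum_mono row)
      also have "\<dots> = 2 * \<nu> * K * 6 * (\<Sum>a\<in>UNIV. \<Sum>b\<in>UNIV. (W (a, b) (y, s))^2)"
        by (simp add: sum.distrib sum_distrib_left[symmetric])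
      also have "(\<Sum>a\<in>UNIV. \<Sum>b\<in>UNIV. (W (a, b) (y, s))^2) = \<zeta> (y, s)"
        unfolding \<zeta>_def UNIV_Times_UNIV[symmetric] sum.cartesian_product by (simp add: split_beta)
      finally show ?thesis .
    qed
  qed (use P K nu t in auto)
  moreover have "(W (i, j) (x, t))^2 \<le> \<zeta> (x, t)" unfolding \<zeta>_def by (rule member_le_sum) auto
  ultimately have "(W (i, j) (x, t))^2 \<le> 0" by linarith
  then show ?thesis by (simp add: W_def)
qed

lemma grad_A_Q: "0 < t \<Longrightarrow> t < T \<Longrightarrow> grad A (x, t) ** Q (x, t) = mat 1"
  using Z_zero[of t _ _ x] grad_A[of t x] by (simp add: vec_eq_iff matrix_matrix_mult_def mat_def Z_def q_def)

text \<open>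
  The essential supremum bounds a continuous function at every point, because nonempty open sets are not null
  sets.
\<close>

lemma Linfty_bound:
  assumes t: "0 < t" "t < T" and b: "Linfty_norm (\<lambda>x. Q (x, t)) \<le> ereal b"
  shows "norm (Q (x, t)) \<le> b"
proof -
  have "AE x in lborel. ereal (norm (Q (x, t))) \<le> ereal b"
    using esssup_AE[of "\<lambda>x. ereal (norm (Q (x, t)))" lborel]
  proof eventually_elim
    case (elim x)
    then show ?case using b unfolding Linfty_norm_def by (rule order_trans)
  qed
  then have "AE x in lborel. x \<in> {x. norm (Q (x, t)) \<le> b}" by simp
  then have "AE x in lebesgue. x \<in> {x. norm (Q (x, t)) \<le> b}" by (rule AE_completion)
  moreover have "closed {x. norm (Q (x, t)) \<le> b}"
  proof (rule closed_Collect_le)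
    show "continuous_on UNIV (\<lambda>x. norm (Q (x, t)))"
      by (intro continuous_on_norm strip.continuous_on_slice[OF whole.strip_axioms Q_cont]) (use t in auto)
  qed simp
  ultimately show ?thesis using mem_closed_if_AE_lebesgue by blast
qed

text \<open>
  If the limit superior were finite, \<open>Q (0, t)\<close> would be bounded for \<open>t\<close> close to \<open>T\<close>, and so would be
  \<open>det Q = 1 / det G\<close>.  By continuity \<open>det G (0, T)\<close> would be nonzero.
\<close>

lemma blow_up:
  assumes sing: "det (grad A (0, T)) = 0"
  shows "Limsup (at_left T) (\<lambda>t. Linfty_norm (\<lambda>x. Q (x, t))) = \<infinity>"
proof (rule ccontr)
  assume "Limsup (at_left T) (\<lambda>t. Linfty_norm (\<lambda>x. Q (x, t))) \<noteq> \<infinity>"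
  then have "\<exists>n::nat. Limsup (at_left T) (\<lambda>t. Linfty_norm (\<lambda>x. Q (x, t))) < ereal (real n)"
    by (simp only: less_PInf_Ex_of_nat)
  then obtain n :: nat where "Limsup (at_left T) (\<lambda>t. Linfty_norm (\<lambda>x. Q (x, t))) < ereal (real n)" ..
  then have ev1: "\<forall>\<^sub>F t in at_left T. Linfty_norm (\<lambda>x. Q (x, t)) < ereal (real n)" by (rule Limsup_lessD)
  have ev2: "\<forall>\<^sub>F t in at_left T. t \<in> {0<..<T}" using T by (intro eventually_at_left_real)
  define b where "b = real n + 1"
  have ev3: "\<forall>\<^sub>F t in at_left T. 1 / (6 * b^3) \<le> \<bar>det (grad A (0, t))\<bar>"
    using ev1 ev2
  proof eventually_elim
    case (elim t)
    then have t: "0 < t" "t < T" by auto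
    have n: "norm (Q (0, t)) \<le> b" using Linfty_bound[OF t, of "real n" 0] elim by (simp add: b_def less_imp_le)
    have c: "\<bar>Q (0, t) $ i $ j\<bar> \<le> b" for i j
      using component_le_norm_cart[of "Q (0, t) $ i" j] Finite_Cartesian_Product.norm_nth_le[of "Q (0, t)" i] n by simp
    have m: "\<bar>Q (0, t) $ i $ j * Q (0, t) $ i' $ j' * Q (0, t) $ i'' $ j''\<bar> \<le> b^3" for i j i' j' i'' j''
      unfolding abs_mult power3_eq_cube using c by (intro mult_mono) (auto simp: b_def)
    have six: "\<bar>p1 + p2 + p3 - p4 - p5 - p6\<bar> \<le> 6 * B"
      if "\<bar>p1\<bar> \<le> B" "\<bar>p2\<bar> \<le> B" "\<bar>p3\<bar> \<le> B" "\<bar>p4\<bar> \<le> B" "\<bar>p5\<bar> \<le> B" "\<bar>p6\<bar> \<le> B" for p1 p2 p3 p4 p5 p6 B :: real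
      using that by linarith
    have "\<bar>det (Q (0, t))\<bar> \<le> 6 * b^3"
      unfolding det_3 by (rule six) (rule m)+
    moreover have "det (grad A (0, t)) * det (Q (0, t)) = 1"
      using arg_cong[OF grad_A_Q[OF t, of 0], of det] by (simp only: det_mul det_I)
    then have e: "\<bar>det (grad A (0, t))\<bar> * \<bar>det (Q (0, t))\<bar> = 1" by (simp only: abs_mult[symmetric] abs_one)
    moreover have "b > 0" by (simp add: b_def)
    ultimately have "1 \<le> \<bar>det (grad A (0, t))\<bar> * (6 * b^3)"
      using mult_left_mono[of "\<bar>det (Q (0, t))\<bar>" "6 * b^3" "\<bar>det (grad A (0, t))\<bar>"] by simp
    then show ?case using \<open>b > 0\<close> by (simp add: divide_le_eq)
  qed
  have "isCont (\<lambda>t. det (grad A (0, t))) T"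
  proof -
    have "isCont (\<lambda>t. G i k (0, t)) T" for i k
    proof -
      have "isCont (G i k) (0, T)" using smooth_on_imp_continuous_on[OF G_smooth] pos.open_strip T by (simp add: continuous_on_eq_continuous_at)
      moreover have "isCont (\<lambda>t. (0 :: real^3, t)) T" by (intro continuous_intros)
      ultimately show ?thesis using isCont_o2[of T "\<lambda>t. (0 :: real^3, t)" "G i k"] by simp
    qed
    then have "isCont (\<lambda>t. det (\<chi> i k. G i k (0, t))) T"
      unfolding det_3 vec_lambda_beta by (intro isCont_add isCont_diff isCont_mult)
    moreover have "\<forall>\<^sub>F t in nhds T. det (\<chi> i k. G i k (0, t)) = det (grad A (0, t))"
    proof -
      have "\<forall>\<^sub>F t in nhds T. t \<in> {0<..}" using T by (intro eventually_nhds_in_open) auto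
      then show ?thesis
      proof eventually_elim
        case (elim t)
        then have "(\<chi> i k. G i k (0, t)) = grad A (0, t)" using grad_A[of t 0] by (simp add: vec_eq_iff)
        then show ?case by simp
      qed
    qed
    ultimately show ?thesis using isCont_cong[of "\<lambda>t. det (\<chi> i k. G i k (0, t))" "\<lambda>t. det (grad A (0, t))" T] by simp
  qed
  then have "((\<lambda>t. \<bar>det (grad A (0, t))\<bar>) \<longlongrightarrow> \<bar>det (grad A (0, T))\<bar>) (at_left T)"
    by (intro tendsto_rabs) (simp add: isCont_def filterlim_at_split)
  then have "1 / (6 * b^3) \<le> \<bar>det (grad A (0, T))\<bar>"
    by (rule tendsto_lowerbound[OF _ ev3]) simp
  then show False using sing by (simp add: b_def)
qed

end

context solution begin

lemma has_derivative_A_slice: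
  assumes t: "t > 0"
  shows "((\<lambda>x. A (x, t)) has_derivative (\<lambda>h. grad A (x, t) *v h)) (at x)"
proof -
  let ?f = "frechet_derivative A (at (x, t))"
  have d: "(A has_derivative ?f) (at (x, t))"
    using smooth_on_has_derivative[OF A_smooth pos.open_strip] t by simp
  then interpret bounded_linear ?f by (rule has_derivative_bounded_linear)
  have "((\<lambda>x. (x, t)) has_derivative (\<lambda>h. (h, 0))) (at x)" by (auto intro!: derivative_eq_intros)
  from has_derivative_compose[OF this, of A ?f] d
  have "((\<lambda>x. A (x, t)) has_derivative (\<lambda>h. ?f (h, 0))) (at x)" by simp
  moreover have "?f (h, 0) = grad A (x, t) *v h" for h
  proof -
    have "(\<Sum>j\<in>UNIV. h $ j *\<^sub>R (axis j 1 :: real^3)) = h" by (simp add: vec_eq_iff axis_def if_distrib[of "(*) _"] cong: if_cong)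
    then have "(h, 0::real) = (\<Sum>j\<in>UNIV. h $ j *\<^sub>R (axis j 1, 0))"
      by (simp add: prod_eq_iff fst_sum snd_sum)
    then have "?f (h, 0) = ?f (\<Sum>j\<in>UNIV. h $ j *\<^sub>R (axis j 1, 0))" by (rule arg_cong)
    also have "\<dots> = (\<Sum>j\<in>UNIV. h $ j *\<^sub>R ?f (axis j 1, 0))" unfolding sum scaleR ..
    also have "\<dots> = (\<Sum>j\<in>UNIV. h $ j *\<^sub>R dx j A (x, t))" using pos.dx_eq_frechet[OF A_smooth] t by simp
    also have "\<dots> = grad A (x, t) *v h" by (simp add: vec_eq_iff matrix_vector_mult_def grad_def mult.commute)
    finally show ?thesis .
  qed
  ultimately show ?thesis by simp
qed

text \<open>
  By the chain rule the derivative of an inverse is a left inverse of the gradient.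
\<close>

lemma not_smoothly_invertible:
  assumes t: "t > 0" and sing: "det (grad A (0, t)) = 0"
  shows "\<not> smoothly_invertible_at_origin (\<lambda>x. A (x, t))"
proof
  let ?f = "\<lambda>x. A (x, t)"
  assume "smoothly_invertible_at_origin ?f"
  then obtain U V where UV: "open U" "0 \<in> U" "open V" "bij_betw ?f U V" "smooth_on V (inv_into U ?f)"
    by (auto simp: smoothly_invertible_at_origin_def)
  let ?g = "inv_into U ?f"
  have fV: "?f 0 \<in> V" using UV by (auto simp: bij_betw_def)
  have "(?g has_derivative frechet_derivative ?g (at (?f 0))) (at (?f 0))"
    by (rule smooth_on_has_derivative[OF UV(5,3) fV])
  then have "((\<lambda>x. ?g (?f x)) has_derivative (\<lambda>h. frechet_derivative ?g (at (?f 0)) (grad A (0, t) *v h))) (at 0)"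
    by (rule has_derivative_compose[OF has_derivative_A_slice[OF t]])
  then have "((\<lambda>x. x) has_derivative (\<lambda>h. frechet_derivative ?g (at (?f 0)) (grad A (0, t) *v h))) (at 0)"
    by (rule has_derivative_transform_within_open[OF _ UV(1,2)]) (use UV(4) in \<open>auto simp: bij_betw_def intro!: inv_into_f_f[of "\<lambda>x. A (x, t)" U]\<close>)
  then have id: "frechet_derivative ?g (at (?f 0)) (grad A (0, t) *v h) = h" for h
    using fun_cong[OF has_derivative_unique[OF _ has_derivative_ident], of _ 0 h] by blast
  have lin: "linear (frechet_derivative ?g (at (?f 0)))"
    using smooth_on_has_derivative[OF UV(5,3) fV] by (simp add: has_derivative_linear)
  have "\<forall>h. grad A (0, t) *v h = 0 \<longrightarrow> h = 0"
  proof (intro allI impI)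
    fix h assume "grad A (0, t) *v h = 0"
    then show "h = 0" using id[of h] linear_0[OF lin] by simp
  qed
  then have "invertible (grad A (0, t))"
    unfolding invertible_left_inverse by (simp add: matrix_left_invertible_ker)
  then show False using sing by (simp add: invertible_det_nz)
qed

theorem singular_gradient_conclusion:
  assumes t: "t > 0" and sing: "det (grad A (0, t)) = 0"
  shows "\<not> smoothly_invertible_at_origin (\<lambda>x. A (x, t)) \<and>
    (\<forall>Q. smooth_solution_Q \<nu> u A t Q \<longrightarrow> Limsup (at_left t) (\<lambda>\<tau>. Linfty_norm (\<lambda>x. Q (x, \<tau>))) = \<infinity>)"
proof (intro conjI allI impI)
  show "\<not> smoothly_invertible_at_origin (\<lambda>x. A (x, t))" by (rule not_smoothly_invertible[OF t sing])
  fix Q assume "smooth_solution_Q \<nu> u A t Q"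
  then interpret solution_Q \<nu> u A t Q by unfold_locales (use t in auto)
  show "Limsup (at_left t) (\<lambda>\<tau>. Linfty_norm (\<lambda>x. Q (x, \<tau>))) = \<infinity>" by (rule blow_up[OF sing])
qed

end

section \<open>Separated functions and comparison in a ball\<close>

lemma neq3: "(1::3) \<noteq> 2" "(1::3) \<noteq> 3" "(2::3) \<noteq> 3" "(2::3) \<noteq> 1" "(3::3) \<noteq> 1" "(3::3) \<noteq> 2"
  by simp_all

lemma smooth_on_vecI:
  fixes f :: "'a::euclidean_space \<Rightarrow> real^3"
  assumes "diff_unique S" "\<And>i. smooth_on S (\<lambda>z. f z $ i)"
  shows "smooth_on S f"
proof -
  have "smooth_on S (\<lambda>z. \<Sum>i\<in>UNIV. f z $ i *\<^sub>R (axis i 1 :: real^3))"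
    by (intro smooth_on_sum smooth_on_scaleR_const assms)
  moreover have "(\<Sum>i\<in>UNIV. f z $ i *\<^sub>R (axis i 1 :: real^3)) = f z" for z
    by (simp add: vec_eq_iff axis_def if_distrib[of "(*) _"] cong: if_cong)
  ultimately show ?thesis by simp
qed

text \<open>
  The arguments are the factors in time, in the second and in the first coordinate, in this order.
\<close>

definition sep :: "(real \<Rightarrow> real) \<Rightarrow> (real \<Rightarrow> real) \<Rightarrow> (real \<Rightarrow> real) \<Rightarrow> (real^3) \<times> real \<Rightarrow> real" where
  "sep f g h z = f (snd z) * g (fst z $ 2) * h (fst z $ 1)"

lemma smooth_on_sep:
  assumes "diff_unique S" "smooth_on UNIV f" "smooth_on UNIV g" "smooth_on UNIV h"
  shows "smooth_on S (sep f g h)"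
proof -
  have "smooth_on S (\<lambda>z. f (snd z))" "smooth_on S (\<lambda>z. g (fst z $ 2))" "smooth_on S (\<lambda>z. h (fst z $ 1))"
    by (rule smooth_on_compose[OF assms(1) assms(2) smooth_on_snd[OF assms(1)]],
        rule smooth_on_compose[OF assms(1) assms(3) smooth_on_coord[OF assms(1)]],
        rule smooth_on_compose[OF assms(1) assms(4) smooth_on_coord[OF assms(1)]])
  then show ?thesis unfolding sep_def[abs_def] by (intro smooth_on_mult assms(1))
qed

context strip begin

lemma dx_sep:
  assumes "\<And>r. (g has_real_derivative g' r) (at r)" "\<And>r. (h has_real_derivative h' r) (at r)"
  shows "dx 1 (sep f g h) (x, t) = sep f g h' (x, t)" "dx 2 (sep f g h) (x, t) = sep f g' h (x, t)" "dx 3 (sep f g h) (x, t) = 0"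
proof -
  have lin: "((\<lambda>s. x $ i + s * c) has_real_derivative c) (at 0)" for c i
    by (auto intro!: derivative_eq_intros)
  have G: "((\<lambda>s. g (x $ i + s * c)) has_real_derivative g' (x $ i) * c) (at 0)" for c i
    using DERIV_chain2[OF _ lin, of g "g' (x $ i)"] assms(1)[of "x $ i"] by simp
  have H: "((\<lambda>s. h (x $ i + s * c)) has_real_derivative h' (x $ i) * c) (at 0)" for c i
    using DERIV_chain2[OF _ lin, of h "h' (x $ i)"] assms(2)[of "x $ i"] by simp
  have "dx k (sep f g h) (x, t) = f t * (g' (x $ 2) * axis k 1 $ 2) * h (x $ 1) + f t * g (x $ 2) * (h' (x $ 1) * axis k 1 $ 1)" for k
    unfolding sep_def[abs_def] by (rule dx_realI) (auto intro!: derivative_eq_intros G H)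
  then show "dx 1 (sep f g h) (x, t) = sep f g h' (x, t)" "dx 2 (sep f g h) (x, t) = sep f g' h (x, t)" "dx 3 (sep f g h) (x, t) = 0"
    by (simp_all add: sep_def axis_def neq3)
qed

lemma dt_sep: "(f has_real_derivative f') (at t) \<Longrightarrow> dt (sep f g h) (x, t) = f' * g (x $ 2) * h (x $ 1)"
  unfolding sep_def[abs_def] by (rule dt_realI) (auto intro!: derivative_eq_intros)

lemma dx_cong_near:
  fixes f g :: "(real^3) \<times> real \<Rightarrow> real"
  assumes g: "smooth g" and t: "t \<in> I" and d: "d > 0" and eq: "\<And>y. dist x y < d \<Longrightarrow> f (y, t) = g (y, t)"
  shows "dx j f (x, t) = dx j g (x, t)"
proof (rule dx_realI)
  have "\<forall>\<^sub>F h in nhds 0. f (x + h *\<^sub>R axis j 1, t) = g (x + h *\<^sub>R axis j 1, t)"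
    unfolding eventually_nhds_metric by (intro exI[of _ d]) (auto simp: d dist_norm intro!: eq)
  then have "((\<lambda>h. f (x + h *\<^sub>R axis j 1, t)) has_real_derivative dx j g (x, t)) (at 0) \<longleftrightarrow>
      ((\<lambda>h. g (x + h *\<^sub>R axis j 1, t)) has_real_derivative dx j g (x, t)) (at 0)"
    by (rule DERIV_cong_ev[OF refl _ refl])
  then show "((\<lambda>h. f (x + h *\<^sub>R axis j 1, t)) has_real_derivative dx j g (x, t)) (at 0)"
    using dx_real[OF g t, of x j] by blast
qed

end

context strip_L begin

text \<open>
  When the factors in space are eigenfunctions with eigenvalues \<open>- m1\<close> and \<open>- m2\<close>, diffusion acts on the time
  factor alone.
\<close>

lemma L_sep:
  assumes f: "(f has_real_derivative f') (at t)" and t: "t \<in> I"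
    and g: "\<And>r. (g has_real_derivative g' r) (at r)" "\<And>r. (g' has_real_derivative - m1 * g r) (at r)"
    and h: "\<And>r. (h has_real_derivative h' r) (at r)" "\<And>r. (h' has_real_derivative - m2 * h r) (at r)"
  shows "L (sep f g h) (x, t) = (f' + \<nu> * (m1 + m2) * f t) * g (x $ 2) * h (x $ 1)
     + u (x, t) $ 1 * sep f g h' (x, t) + u (x, t) $ 2 * sep f g' h (x, t)"
proof -
  have d1: "dx 1 (dx 1 (sep f g h)) (x, t) = - m2 * sep f g h (x, t)"
  proof -
    have "dx 1 (dx 1 (sep f g h)) (x, t) = dx 1 (sep f g h') (x, t)" by (rule dx_cong) (rule dx_sep(1)[OF g(1) h(1)])
    also have "\<dots> = sep f g (\<lambda>r. - m2 * h r) (x, t)" by (rule dx_sep(1)[OF g(1) h(2)])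
    finally show ?thesis by (simp add: sep_def)
  qed
  have d2: "dx 2 (dx 2 (sep f g h)) (x, t) = - m1 * sep f g h (x, t)"
  proof -
    have "dx 2 (dx 2 (sep f g h)) (x, t) = dx 2 (sep f g' h) (x, t)" by (rule dx_cong) (rule dx_sep(2)[OF g(1) h(1)])
    also have "\<dots> = sep f (\<lambda>r. - m1 * g r) h (x, t)" by (rule dx_sep(2)[OF g(2) h(1)])
    finally show ?thesis by (simp add: sep_def)
  qed
  have d3: "dx 3 (dx 3 (sep f g h)) (x, t) = 0"
    using dx_cong[of "dx 3 (sep f g h)" t "\<lambda>z. 0" 3 x] dx_sep(3)[OF g(1) h(1)] dx_const by simp
  show ?thesis unfolding L_real dt_sep[OF f] sum_3 d1 d2 d3 dx_sep[OF g(1) h(1)] by (simp add: sep_def algebra_simps)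
qed

text \<open>
  The barrier \<open>f0 t + (C / R^2) (|x|^2 + K' t)\<close> dominates \<open>|D|\<close> on the boundary of the ball of radius \<open>R\<close>,
  where only the crude bound \<open>C\<close> is known, and it is of order \<open>f0 + 1 / R\<close> on the unit ball.
\<close>

lemma local_comparison:
  fixes D :: "(real^3) \<times> real \<Rightarrow> real"
  assumes nu: "\<nu> > 0" and D: "smooth D" and I: "{0<..T} \<subseteq> I" and cont: "continuous_on (UNIV \<times> {0..T}) D"
    and init: "\<And>x. D (x, 0) = 0" and C: "C > 0" and R: "R \<ge> 1" and U: "U \<ge> 0" and f0: "f0 \<ge> 0"
    and bdd: "\<And>x t. norm x \<le> R \<Longrightarrow> 0 \<le> t \<Longrightarrow> t \<le> T \<Longrightarrow> \<bar>D (x, t)\<bar> \<le> C"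
    and region: "\<And>x t. norm x < R \<Longrightarrow> 0 < t \<Longrightarrow> t \<le> T \<Longrightarrow> \<bar>L D (x, t)\<bar> \<le> f0 \<and> (\<forall>j. \<bar>u (x, t) $ j\<bar> \<le> U)"
    and x: "norm x \<le> 1" and t: "0 \<le> t" "t \<le> T"
  shows "\<bar>D (x, t)\<bar> \<le> f0 * T + C / R^2 * (1 + (6 * \<nu> + 6 * U * R + 1) * T)"
proof -
  define K' where "K' = 6 * \<nu> + 6 * U * R + 1"
  have K': "K' > 0" using nu U R by (auto simp: K'_def intro!: add_nonneg_pos)
  define n where "n = (\<lambda>z::(real^3) \<times> real. \<Sum>i\<in>UNIV. (fst z $ i - 0 $ i)^2)"
  have n_eq: "n (y, s) = (norm y)^2" for y s unfolding n_def by (simp add: norm_sq_sum)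
  have smn: "smooth n" unfolding n_def by (rule smooth_norm_sq)
  define c where "c = C / R^2"
  have c: "c > 0" using C R by (simp add: c_def)
  have one: "s * D (x, t) \<le> f0 * T + c * (1 + K' * T)" if s: "s = 1 \<or> s = -1" for s
  proof -
    define F where "F = (\<lambda>z. s * D z - ((f0 + c * K') * snd z + c * n z))"
    have smF: "smooth F" unfolding F_def by (intro smooth_intros(1-9) D smn)
    have "F (x, t) \<le> 0"
    proof (rule cylinder_max_principle[OF nu smF I, of 0 R])
      show "continuous_on (cball 0 R \<times> {0..T}) F"
        unfolding F_def n_def by (intro continuous_intros continuous_on_subset[OF cont]) auto
      show "F (y, 0) \<le> 0" for y using c by (simp add: F_def init n_eq)
      show "F (y, r) \<le> 0" if "dist 0 y = R" "0 \<le> r" "r \<le> T" for y r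
      proof -
        have "s * D (y, r) \<le> C" using bdd[of y r] that s by (auto simp: abs_le_iff)
        also have "C = c * n (y, r)" using that R by (simp add: c_def n_eq)
        also have "\<dots> \<le> (f0 + c * K') * r + c * n (y, r)" using that f0 c K' by simp
        finally show ?thesis by (simp add: F_def)
      qed
      fix y :: "real^3" and r :: real assume y: "dist 0 y < R" and r: "0 < r" "r \<le> T"
      have rI: "r \<in> I" using r I by auto
      have reg: "\<bar>L D (y, r)\<bar> \<le> f0" "\<And>j. \<bar>u (y, r) $ j\<bar> \<le> U" using region[of y r] y r by auto
      have "L F (y, r) = L (\<lambda>z. s * D z) (y, r) - L (\<lambda>z. (f0 + c * K') * snd z + c * n z) (y, r)"
        unfolding F_def by (rule L_diff[OF rI]) (intro smooth_intros(1-9) D smn)+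
      also have "L (\<lambda>z. (f0 + c * K') * snd z + c * n z) (y, r) = L (\<lambda>z. (f0 + c * K') * snd z) (y, r) + L (\<lambda>z. c * n z) (y, r)"
        by (rule L_add[OF rI]) (intro smooth_intros(1-9) smn)+
      also have "L (\<lambda>z. (f0 + c * K') * snd z) (y, r) = f0 + c * K'"
        by (rule L_time[where g="\<lambda>t. (f0 + c * K') * t"]) (auto intro!: derivative_eq_intros)
      also have "L (\<lambda>z. c * n z) (y, r) = c * (2 * (\<Sum>i\<in>UNIV. y $ i * u (y, r) $ i) - 6 * \<nu>)"
        using L_cmult[OF rI smn, of c y] L_norm_sq[OF rI, of 0 y] by (simp add: n_def)
      also have "L (\<lambda>z. s * D z) (y, r) = s * L D (y, r)" by (rule L_cmult[OF rI D])
      finally have LF: "L F (y, r) = s * L D (y, r) - f0 - c * (K' - 6 * \<nu> + 2 * (\<Sum>i\<in>UNIV. y $ i * u (y, r) $ i))"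
        by (simp add: algebra_simps)
      have "\<bar>\<Sum>i\<in>UNIV. y $ i * u (y, r) $ i\<bar> \<le> (\<Sum>i\<in>(UNIV::3 set). R * U)"
      proof (intro order_trans[OF sum_abs] sum_mono)
        fix i show "\<bar>y $ i * u (y, r) $ i\<bar> \<le> R * U"
          unfolding abs_mult using component_le_norm_cart[of y i] y reg(2)[of i] R by (intro mult_mono) auto
      qed
      then have "K' - 6 * \<nu> + 2 * (\<Sum>i\<in>UNIV. y $ i * u (y, r) $ i) > 0"
        unfolding K'_def by (simp add: abs_le_iff algebra_simps)
      then have "c * (K' - 6 * \<nu> + 2 * (\<Sum>i\<in>UNIV. y $ i * u (y, r) $ i)) > 0" using c by simp
      moreover have "s * L D (y, r) \<le> f0" using reg(1) s by (auto simp: abs_le_iff)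
      ultimately show "L F (y, r) < 0" unfolding LF by linarith
    qed (use x R t in auto)
    then have "s * D (x, t) \<le> (f0 + c * K') * t + c * (norm x)^2" by (simp add: F_def n_eq)
    also have "\<dots> \<le> (f0 + c * K') * T + c * 1"
      using t f0 c K' x by (intro add_mono mult_left_mono) (auto simp: power_le_one)
    finally show ?thesis by (simp add: algebra_simps)
  qed
  show ?thesis using one[of 1] one[of "-1"] by (simp add: abs_le_iff c_def K'_def)
qed

end

section \<open>Time profiles\<close>

locale profile =
  fixes \<nu> :: real
  assumes nu_pos: "\<nu> > 0"
begin

text \<open>
  The first shear has the time factor \<open>alpha\<close> and the second one \<open>beta\<close>.  The other functions are the
  amplitudes of the modes of the approximate solution; \<open>derivative_profiles\<close> lists the linear equations that
  they satisfy, where the mode belonging to the eigenvalue \<open>- k\<close> is damped at the rate \<open>k \<nu>\<close>.  The choice of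
  \<open>alpha\<close> and \<open>beta\<close> with the factor \<open>exp (- \<nu> t)\<close> makes \<open>c0\<close>, \<open>b\<close> and \<open>c1\<close>
  explicit.
\<close>

definition "c0 t = exp (- \<nu> * t) * step (t - 2)" for t
definition "alpha t = exp (- \<nu> * t) * step' (t - 2)" for t
definition "b t = exp (- \<nu> * t) * step (t - 3)" for t
definition "beta t = - exp (- \<nu> * t) * step' (t - 3)" for t
definition "c1 t = - b t * c0 t" for t
definition "duhamel k t = exp (- k * \<nu> * t) * antideriv (\<lambda>s. - exp (k * \<nu> * s) * beta s * c1 s) t" for k t
definition "E t = 2 * duhamel 5 t - b t * c1 t" for t

lemma smooth_affine: "smooth_on UNIV f \<Longrightarrow> smooth_on UNIV (\<lambda>t. f (c * t - d))" for f :: "real \<Rightarrow> real" and c d :: real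
  using smooth_on_compose[OF du_UNIV, of f "\<lambda>t. c * t - d"]
    smooth_on_diff[OF du_UNIV smooth_on_mult[OF du_UNIV smooth_on_const[OF du_UNIV] smooth_on_linear[OF du_UNIV bounded_linear_ident]] smooth_on_const[OF du_UNIV], of c d]
  by simp

lemma smooth_exp: "smooth_on UNIV (\<lambda>t. exp (c * t))" for c :: real
  using smooth_affine[OF smooth_on_exp, of c 0] by simp

lemma smooth_shift: "smooth_on UNIV (\<lambda>t. step (t - d))" "smooth_on UNIV (\<lambda>t. step' (t - d))"
  using smooth_affine[OF smooth_on_step, of 1 d] smooth_affine[OF smooth_on_step', of 1 d] by simp_all

lemma smooth_profiles: "smooth_on UNIV c0" "smooth_on UNIV alpha" "smooth_on UNIV b" "smooth_on UNIV beta" "smooth_on UNIV c1"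
proof -
  show c0: "smooth_on UNIV c0" unfolding c0_def by (intro smooth_on_mult du_UNIV smooth_exp smooth_shift)
  show "smooth_on UNIV alpha" unfolding alpha_def by (intro smooth_on_mult du_UNIV smooth_exp smooth_shift)
  show b: "smooth_on UNIV b" unfolding b_def by (intro smooth_on_mult du_UNIV smooth_exp smooth_shift)
  show "smooth_on UNIV beta" unfolding beta_def by (intro smooth_on_mult smooth_on_uminus du_UNIV smooth_exp smooth_shift)
  show "smooth_on UNIV c1" unfolding c1_def by (intro smooth_on_mult smooth_on_uminus du_UNIV c0 b)
qed

lemma smooth_source: "smooth_on UNIV (\<lambda>s. - exp (k * \<nu> * s) * beta s * c1 s)"
  by (intro smooth_on_mult smooth_on_uminus du_UNIV smooth_profiles smooth_exp)

lemma smooth_duhamel: "smooth_on UNIV (duhamel k)"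
  unfolding duhamel_def using smooth_exp[of "- k * \<nu>"]
  by (intro smooth_on_mult du_UNIV smooth_on_antideriv smooth_source) auto

lemma step_shift_derivative: "((\<lambda>t. step (t - d)) has_real_derivative step' (t - d)) (at t)"
proof -
  have "((\<lambda>t. t - d) has_real_derivative 1) (at t)" by (auto intro!: derivative_eq_intros)
  from DERIV_chain2[OF step_derivative this] show ?thesis by simp
qed

lemma early: "t \<le> 3 \<Longrightarrow> b t = 0" "t \<le> 3 \<Longrightarrow> beta t = 0" "t \<le> 3 \<Longrightarrow> c1 t = 0" "t \<le> 2 \<Longrightarrow> c0 t = 0" "t \<le> 2 \<Longrightarrow> alpha t = 0"
  "t \<ge> 3 \<Longrightarrow> alpha t = 0" "t \<ge> 4 \<Longrightarrow> beta t = 0"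
  by (simp_all add: b_def beta_def c1_def c0_def alpha_def step_le_0 step'_bounds)

text \<open>
  The first shear has stopped when the second one starts, so it does not act on the modes that the second one
  creates.
\<close>

lemma alpha_disjoint: "b t * alpha t = 0" "c1 t * alpha t = 0"
  using early[of t] by (cases "t \<le> 3"; simp)+

lemma duhamel_early: "0 \<le> t \<Longrightarrow> t \<le> 3 \<Longrightarrow> duhamel k t = 0"
  using antideriv_const[OF smooth_on_imp_continuous_on[OF smooth_source], of 0 t k]
    antideriv(1)[OF smooth_on_imp_continuous_on[OF smooth_source], of k] early
  by (simp add: duhamel_def)

lemma derivative_profiles:
  "(c0 has_real_derivative - \<nu> * c0 t + alpha t) (at t)"
  "(b has_real_derivative - \<nu> * b t - beta t) (at t)"
  "(c1 has_real_derivative - 2 * \<nu> * c1 t + beta t * c0 t) (at t)"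
  "(duhamel k has_real_derivative - k * \<nu> * duhamel k t - beta t * c1 t) (at t)"
proof -
  show c0: "(c0 has_real_derivative - \<nu> * c0 t + alpha t) (at t)"
    unfolding c0_def alpha_def by (auto intro!: derivative_eq_intros step_shift_derivative)
  show b: "(b has_real_derivative - \<nu> * b t - beta t) (at t)"
    unfolding b_def beta_def by (auto intro!: derivative_eq_intros step_shift_derivative)
  have "(c1 has_real_derivative - (b t) * (- \<nu> * c0 t + alpha t) + - (- \<nu> * b t - beta t) * c0 t) (at t)"
    unfolding c1_def by (auto intro!: derivative_eq_intros c0 b simp: algebra_simps)
  moreover have "- (b t) * (- \<nu> * c0 t + alpha t) + - (- \<nu> * b t - beta t) * c0 t = (- 2 * \<nu> * c1 t + beta t * c0 t) - b t * alpha t"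
    by (simp add: c1_def algebra_simps)
  ultimately show "(c1 has_real_derivative - 2 * \<nu> * c1 t + beta t * c0 t) (at t)"
    unfolding alpha_disjoint by (simp only: diff_0_right)
  have ex: "exp (- (k * \<nu> * t)) * exp (k * \<nu> * t) = 1" by (simp add: exp_add[symmetric])
  have ad: "(antideriv (\<lambda>s. - exp (k * \<nu> * s) * beta s * c1 s) has_real_derivative - exp (k * \<nu> * t) * beta t * c1 t) (at t)"
    by (rule antideriv(2)[OF smooth_on_imp_continuous_on[OF smooth_source]])
  have ed: "((\<lambda>t. exp (- k * \<nu> * t)) has_real_derivative - k * \<nu> * exp (- k * \<nu> * t)) (at t)"
    by (auto intro!: derivative_eq_intros)
  have "exp (- k * \<nu> * t) * (- exp (k * \<nu> * t) * beta t * c1 t) = - (exp (- (k * \<nu> * t)) * exp (k * \<nu> * t)) * (beta t * c1 t)" by simp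
  also have "\<dots> = - beta t * c1 t" unfolding ex by simp
  finally have e: "exp (- k * \<nu> * t) * (- exp (k * \<nu> * t) * beta t * c1 t) = - beta t * c1 t" .
  show "(duhamel k has_real_derivative - k * \<nu> * duhamel k t - beta t * c1 t) (at t)"
    unfolding duhamel_def
    by (rule DERIV_cong[OF DERIV_mult[OF ed ad]]) (use e in \<open>simp add: mult_ac\<close>)
qed

definition "kappa = E 4"

text \<open>
  The function \<open>E\<close> is the coefficient of \<open>amp * \<epsilon>^2\<close> in the gradient determinant at the origin.  It satisfies
  \<open>E' = - 5 \<nu> E + 2 \<nu> b^2 c0\<close> with \<open>E 3 = 0\<close>, so diffusion makes it positive.  The last term is the difference
  between the damping rate \<open>5 \<nu>\<close> of the mode \<open>cos y * sin (2 x)\<close> and the rate \<open>3 \<nu>\<close> of the product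
  \<open>b * c1\<close>.
\<close>

lemma kappa_pos: "kappa > 0"
proof -
  have E: "(E has_real_derivative - 5 * \<nu> * E t + 2 * \<nu> * (b t)^2 * c0 t) (at t)" for t
  proof -
    have "(E has_real_derivative 2 * (- 5 * \<nu> * duhamel 5 t - beta t * c1 t) - ((- \<nu> * b t - beta t) * c1 t + b t * (- 2 * \<nu> * c1 t + beta t * c0 t))) (at t)"
      unfolding E_def by (auto intro!: derivative_eq_intros derivative_profiles)
    then show ?thesis by (simp add: E_def c1_def algebra_simps power2_eq_square)
  qed
  define F where "F t = exp (5 * \<nu> * t) * E t" for t
  have F: "(F has_real_derivative exp (5 * \<nu> * t) * (2 * \<nu> * (b t)^2 * c0 t)) (at t)" for t
    unfolding F_def by (auto intro!: derivative_eq_intros E simp: algebra_simps)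
  have "F 3 = 0" using duhamel_early[of 3 5] early(1)[of 3] by (simp add: F_def E_def)
  moreover obtain s where s: "3 < s" "s < 4" "F 4 - F 3 = (4 - 3) * (exp (5 * \<nu> * s) * (2 * \<nu> * (b s)^2 * c0 s))"
    using MVT2[of 3 4 F "\<lambda>t. exp (5 * \<nu> * t) * (2 * \<nu> * (b t)^2 * c0 t)"] F by auto
  moreover have "b s > 0" "c0 s > 0" using s by (auto simp: b_def c0_def intro!: mult_pos_pos step_pos)
  then have "exp (5 * \<nu> * s) * (2 * \<nu> * (b s)^2 * c0 s) > 0" using nu_pos by simp
  ultimately have "F 4 > 0" by simp
  then show ?thesis by (simp add: F_def kappa_def zero_less_mult_iff)
qed

lemma profile_bounded:
  fixes f :: "real \<Rightarrow> real"
  assumes "smooth_on UNIV f" shows "\<exists>B\<ge>0. \<forall>t\<in>{0..4}. \<bar>f t\<bar> \<le> B"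
proof -
  have "bounded (f ` {0..4})"
    by (intro compact_imp_bounded compact_continuous_image continuous_on_subset[OF smooth_on_imp_continuous_on[OF assms]]) auto
  then obtain B where "\<forall>t\<in>{0..4}. \<bar>f t\<bar> \<le> B" by (auto simp: bounded_iff)
  then show ?thesis by (intro exI[of _ "max B 0"]) (auto simp: le_max_iff_disj)
qed

end

section \<open>The velocity field and the approximate solution\<close>

text \<open>
  With \<open>s x = sin x + cos x\<close> both \<open>s\<close> and its derivative equal \<open>1\<close> at the origin, and \<open>s^2 = 1 + sin (2 x)\<close>.
  The second shear and the gradient of the mode that it creates are therefore both visible at the origin.
\<close>

abbreviation sx :: "real \<Rightarrow> real" where "sx \<equiv> \<lambda>r. sin r + cos r"
abbreviation sx' :: "real \<Rightarrow> real" where "sx' \<equiv> \<lambda>r. cos r - sin r"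
abbreviation one :: "real \<Rightarrow> real" where "one \<equiv> \<lambda>r. 1"
abbreviation nul :: "real \<Rightarrow> real" where "nul \<equiv> \<lambda>r. 0"
abbreviation s2 :: "real \<Rightarrow> real" where "s2 \<equiv> \<lambda>r. sin (2 * r)"
abbreviation s2' :: "real \<Rightarrow> real" where "s2' \<equiv> \<lambda>r. 2 * cos (2 * r)"
abbreviation msin :: "real \<Rightarrow> real" where "msin \<equiv> \<lambda>r. - sin r"

lemma trig_derivatives:
  "(sx has_real_derivative sx' r) (at r)" "(sx' has_real_derivative - 1 * sx r) (at r)"
  "(one has_real_derivative nul r) (at r)" "(nul has_real_derivative - 0 * one r) (at r)"
  "(s2 has_real_derivative s2' r) (at r)" "(s2' has_real_derivative - 4 * s2 r) (at r)"
  "(cos has_real_derivative msin r) (at r)" "(msin has_real_derivative - 1 * cos r) (at r)"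
  "(sin has_real_derivative cos r) (at r)" "(cos has_real_derivative - 1 * sin r) (at r)"
  by (auto intro!: derivative_eq_intros)

lemma smooth_trig: "smooth_on UNIV sx" "smooth_on UNIV sx'" "smooth_on UNIV one" "smooth_on UNIV nul"
  "smooth_on UNIV s2" "smooth_on UNIV s2'" "smooth_on UNIV msin"
proof -
  have "smooth_on UNIV (\<lambda>r::real. 2 * r)"
    by (intro smooth_on_mult smooth_on_const smooth_on_linear bounded_linear_ident du_UNIV)
  then have t: "smooth_on UNIV s2" "smooth_on UNIV (\<lambda>r::real. cos (2 * r))"
    using smooth_on_compose[OF du_UNIV smooth_on_sin_cos(1)] smooth_on_compose[OF du_UNIV smooth_on_sin_cos(2)] by auto
  show "smooth_on UNIV sx" "smooth_on UNIV sx'" "smooth_on UNIV one" "smooth_on UNIV nul"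
    "smooth_on UNIV s2" "smooth_on UNIV s2'" "smooth_on UNIV msin"
    by (intro smooth_on_add smooth_on_diff smooth_on_const smooth_on_mult smooth_on_uminus smooth_on_sin_cos t du_UNIV)+
qed

lemma trig_bounds: "\<bar>sx r\<bar> \<le> 2" "\<bar>sx' r\<bar> \<le> 2" "\<bar>s2 r\<bar> \<le> 1" "\<bar>s2' r\<bar> \<le> 2" "\<bar>msin r\<bar> \<le> 1"
proof -
  note b = abs_sin_le_one[of r] abs_cos_le_one[of r] abs_sin_le_one[of "2 * r"] abs_cos_le_one[of "2 * r"]
  show "\<bar>sx r\<bar> \<le> 2" using b(1,2) by linarith
  show "\<bar>sx' r\<bar> \<le> 2" using b(1,2) by linarith
  show "\<bar>s2 r\<bar> \<le> 1" using b(3) by linarith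
  show "\<bar>s2' r\<bar> \<le> 2" using b(4) by linarith
  show "\<bar>msin r\<bar> \<le> 1" using b(1) by linarith
qed

lemma sx_square: "sx r * sx r = 1 + s2 r" for r :: real
  using sin_cos_squared_add[of r] sin_double[of r] by (simp add: algebra_simps power2_eq_square)

context profile begin

text \<open>
  The first component of the equation for the approximate solution is violated by \<open>\<epsilon>\<close> times this function,
  which does not depend on \<open>\<epsilon>\<close>; see \<open>L_app\<close>.
\<close>

definition defect :: "(real^3) \<times> real \<Rightarrow> real" where
  "defect z = 2 / kappa * (sep (\<lambda>t. beta t * duhamel 1 t) sin sx z + sep (\<lambda>t. beta t * duhamel 5 t) sin (\<lambda>r. sx r * s2 r) z)"

end

locale construction = profile +
  fixes \<epsilon> R :: real
  assumes eps: "0 < \<epsilon>" "\<epsilon> \<le> 1" and R: "R \<ge> 2"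
begin

text \<open>
  The amplitude that makes the determinant \<open>1 + amp * \<epsilon>^2 * kappa\<close> equal to \<open>-1\<close>.
\<close>

definition amp :: real where "amp = - 2 / (kappa * \<epsilon>^2)"

text \<open>
  A stream function: the velocity is the rotated gradient of \<open>Psi\<close> times the cutoff, hence divergence free in
  spite of the cutoff, and it equals \<open>vel0\<close> where the cutoff is \<open>1\<close>.
\<close>

definition Psi :: "(real^3) \<times> real \<Rightarrow> real" where
  "Psi z = - amp * sep alpha sin one z + \<epsilon> * sep beta one sx' z"

definition pot :: "(real^3) \<times> real \<Rightarrow> real" where "pot z = cutoff R z * Psi z"

definition vel :: "(real^3) \<times> real \<Rightarrow> real^3" where
  "vel z = vector [dx 2 pot z, - dx 1 pot z, 0]"

definition vel0 :: "(real^3) \<times> real \<Rightarrow> real^3" where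
  "vel0 z = vector [- amp * sep alpha cos one z, \<epsilon> * sep beta one sx z, 0]"

lemma vel_nth: "vel z $ 1 = dx 2 pot z" "vel z $ 2 = - dx 1 pot z" "vel z $ 3 = 0"
  "vel0 z $ 1 = - amp * sep alpha cos one z" "vel0 z $ 2 = \<epsilon> * sep beta one sx z" "vel0 z $ 3 = 0"
  by (simp_all add: vel_def vel0_def)

lemma smooth_Psi: "diff_unique S \<Longrightarrow> smooth_on S Psi"
  unfolding Psi_def[abs_def]
  by (intro smooth_on_add smooth_on_mult smooth_on_const smooth_on_sep smooth_profiles smooth_on_sin_cos smooth_trig)

lemma smooth_pot: "diff_unique S \<Longrightarrow> smooth_on S pot"
  unfolding pot_def[abs_def] by (intro smooth_on_mult smooth_on_cutoff smooth_Psi)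

lemma R0: "R > 0" using R by simp

lemma dx_Psi: "dx 2 Psi (x, t) = vel0 (x, t) $ 1" "dx 1 Psi (x, t) = - vel0 (x, t) $ 2" "dx 3 Psi (x, t) = 0"
proof -
  note du = whole.du
  have sm: "whole.smooth (sep alpha sin one)" "whole.smooth (sep beta one sx')"
    by (intro smooth_on_sep du smooth_profiles smooth_on_sin_cos smooth_trig)+
  have "dx k Psi (x, t) = - amp * dx k (sep alpha sin one) (x, t) + \<epsilon> * dx k (sep beta one sx') (x, t)" for k
    unfolding Psi_def[abs_def]
    by (subst whole.dx_add; (intro UNIV_I smooth_on_mult smooth_on_const du sm)?)
       (simp only: whole.dx_cmult[OF UNIV_I sm(1)] whole.dx_cmult[OF UNIV_I sm(2)])
  then show "dx 2 Psi (x, t) = vel0 (x, t) $ 1" "dx 1 Psi (x, t) = - vel0 (x, t) $ 2" "dx 3 Psi (x, t) = 0"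
    unfolding vel_nth
    by (simp_all only: whole.dx_sep[OF trig_derivatives(9) trig_derivatives(3)] whole.dx_sep[OF trig_derivatives(3) trig_derivatives(2)])
      (simp_all add: sep_def algebra_simps)
qed

lemma dx_pot: "dx k pot (x, t) = cutoff R (x, t) * dx k Psi (x, t) + Psi (x, t) * dx k (cutoff R) (x, t)"
  unfolding pot_def[abs_def] by (rule whole.dx_mult[OF UNIV_I smooth_on_cutoff[OF whole.du] smooth_Psi[OF whole.du]])

lemma vel_inner: "norm x \<le> R \<Longrightarrow> vel (x, t) = vel0 (x, t)"
  using dx_pot[of _ x t] cutoff_eq_1[OF R0, of x t] whole.dx_cutoff_inner[OF UNIV_I R0, of x _ t] dx_Psi[of x t]
  by (simp add: vec_eq_iff forall_3 vel_nth)

lemma Psi_time: "t \<le> 2 \<or> t \<ge> 4 \<Longrightarrow> Psi (x, t) = 0"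
  using early(2,5,6,7)[of t] by (auto simp: Psi_def sep_def)

lemma smooth_vel: "smooth_on UNIV vel"
proof (rule smooth_on_vecI[OF du_UNIV])
  fix i
  have s: "smooth_on UNIV (dx k pot)" for k using whole.smooth_dx[OF smooth_pot[OF whole.du]] by simp
  show "smooth_on UNIV (\<lambda>z. vel z $ i)"
    using exhaust_3[of i] s smooth_on_uminus[OF du_UNIV s] smooth_on_const[OF du_UNIV] by (auto simp: vel_nth)
qed

lemma vel_zero_outside: "norm z > 2 * R + 4 \<Longrightarrow> vel z = 0" and vel_zero_early: "t \<le> 2 \<Longrightarrow> vel (x, t) = 0"
proof -
  have p: "pot z = 0" if "norm z > 2 * R + 4" for z
  proof -
    obtain x t where z: "z = (x, t)" by (cases z)
    have "norm z \<le> norm x + \<bar>t\<bar>" unfolding z using norm_Pair_le[of x t] by simp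
    then have "norm x > 2 * R \<or> \<bar>t\<bar> > 4" using that by linarith
    then show ?thesis
      using cutoff_eq_0[OF R0, of x t] Psi_time[of t x] unfolding pot_def z by (auto simp: abs_if split: if_splits)
  qed
  show "vel z = 0" if "norm z > 2 * R + 4"
    using dx_zero_outside[of "2 * R + 4" pot, OF p] that by (cases z) (simp add: vec_eq_iff forall_3 vel_nth)
  show "vel (x, t) = 0" if "t \<le> 2"
    using whole.dx_cong[of pot t "\<lambda>z. 0"] Psi_time[of t] that
    by (simp add: vec_eq_iff forall_3 vel_nth pot_def whole.dx_const)
qed

lemma div_vel: "(\<Sum>i\<in>UNIV. dx i (\<lambda>z. vel z $ i) (x, t)) = 0"
proof -
  have s: "whole.smooth pot" by (rule smooth_pot[OF whole.du])
  have "dx 2 (\<lambda>z. - dx 1 pot z) (x, t) = - dx 2 (dx 1 pot) (x, t)"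
    by (rule whole.dx_minus[OF UNIV_I whole.smooth_dx[OF s]])
  moreover have "dx 1 (dx 2 pot) (x, t) = dx 2 (dx 1 pot) (x, t)" by (rule whole.dx_commute[OF s UNIV_I])
  moreover have "dx 1 (\<lambda>z. dx 2 pot z) (x, t) = dx 1 (dx 2 pot) (x, t)" by simp
  ultimately show ?thesis by (simp add: sum_3 vel_nth whole.dx_const)
qed

sublocale vel: late_drift \<nu> vel
proof
  show "\<exists>\<rho>>0. \<forall>z. norm z > \<rho> \<longrightarrow> vel z = 0"
    using vel_zero_outside R by (intro exI[of _ "2 * R + 4"]) auto
qed (use nu_pos smooth_vel div_vel vel_zero_early in auto)

lemma C0_infinity_vel: "C0_infinity vel"
  unfolding C0_infinity_def
proof (intro conjI exI)
  have "smooth_on (UNIV \<times> {0..}) (\<lambda>z. vel z)"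
  proof (rule smooth_on_vecI[OF diff_unique_half])
    fix i
    show "smooth_on (UNIV \<times> {0..}) (\<lambda>z. vel z $ i)" by (rule smooth_on_restrict[OF vel.u_smooth diff_unique_half]) simp
  qed
  then show "smooth_on (UNIV \<times> {0..}) vel" by simp
  let ?K = "cball 0 (2 * R + 4) \<inter> (UNIV \<times> {0..}) :: ((real^3) \<times> real) set"
  show "compact ?K"
    by (rule compact_Int_closed[OF compact_cball closed_Times[OF closed_UNIV closed_atLeast]])
  show "?K \<subseteq> UNIV \<times> {0..}" by auto
  show "\<forall>z\<in>UNIV \<times> {0..} - ?K. vel z = 0"
  proof
    fix z :: "(real^3) \<times> real" assume "z \<in> UNIV \<times> {0..} - ?K"
    then have "norm z > 2 * R + 4" by (auto simp: not_le)
    then show "vel z = 0" by (rule vel_zero_outside)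
  qed
qed

lemma divergence_free_vel: "divergence_free vel"
  unfolding divergence_free_def using div_vel whole.dx_nth[of vel _ _ _ _] smooth_vel by simp

text \<open>
  The expansion of the solution in powers of \<open>\<epsilon>\<close>, with \<open>amp * \<epsilon>^2\<close> counted as a constant.  The terms with
  \<open>c0\<close> and \<open>b\<close> are the responses to the two shears.  The second shear transports \<open>c0 * cos y\<close> and creates the
  term with \<open>c1\<close>; transporting that one yields \<open>cos y * s^2 = cos y + cos y * sin (2 x)\<close>, hence the last two
  terms.
\<close>

definition app :: "3 \<Rightarrow> (real^3) \<times> real \<Rightarrow> real" where
  "app i z = (if i = 1 then fst z $ 1 + (amp * sep c0 cos one z + (amp * \<epsilon> * sep c1 sin sx z
      + (amp * \<epsilon>^2 * sep (duhamel 1) cos one z + amp * \<epsilon>^2 * sep (duhamel 5) cos s2 z)))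
    else if i = 2 then fst z $ 2 + \<epsilon> * sep b one sx z else fst z $ 3)"

lemma smooth_app_parts:
  assumes "diff_unique S"
  shows "smooth_on S (sep c0 cos one)" "smooth_on S (sep c1 sin sx)" "smooth_on S (sep (duhamel 1) cos one)"
    "smooth_on S (sep (duhamel 5) cos s2)" "smooth_on S (sep b one sx)"
  by (intro smooth_on_sep assms smooth_profiles smooth_duhamel smooth_on_sin_cos smooth_trig)+

lemma smooth_app: "diff_unique S \<Longrightarrow> smooth_on S (app i)"
  using exhaust_3[of i] unfolding app_def[abs_def]
  by (auto simp: neq3 intro!: smooth_on_add smooth_on_mult smooth_on_const smooth_on_coord smooth_app_parts)

context
  fixes x :: "real^3" and t :: real
  assumes x: "norm x \<le> R" and t: "t > 0"
begin

interpretation pos: drift_strip \<nu> vel "{0<..}" by unfold_locales simp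

text \<open>
  All terms up to the order \<open>amp * \<epsilon>^2\<close> cancel by the equations for the time profiles.  What remains is the
  transport of the last two terms of \<open>app\<close> by the second shear; it is of size \<open>amp * \<epsilon>^3\<close>, which is a constant
  times \<open>\<epsilon>\<close>.
\<close>

lemma L_app:
  "pos.L (app 1) (x, t) = \<epsilon> * defect (x, t)" "pos.L (app 2) (x, t) = 0" "pos.L (app 3) (x, t) = 0"
proof -
  have tI: "t \<in> {0<..}" using t by simp
  note parts = smooth_app_parts[OF pos.du]
  note smi = smooth_on_add smooth_on_mult smooth_on_const smooth_on_coord parts pos.du
  let ?y = "x $ 2" and ?x = "x $ 1"
  have v: "vel (x, t) $ 1 = - amp * (alpha t * cos ?y)" "vel (x, t) $ 2 = \<epsilon> * (beta t * sx ?x)" "vel (x, t) $ 3 = 0"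
    unfolding vel_inner[OF x] vel_nth by (simp_all add: sep_def)
  have L0: "pos.L (sep c0 cos one) (x, t) = alpha t * cos ?y - \<epsilon> * beta t * c0 t * sx ?x * sin ?y"
    using pos.L_sep[OF derivative_profiles(1) tI trig_derivatives(7,8) trig_derivatives(3,4), of x]
    unfolding v by (simp add: sep_def algebra_simps)
  have L1: "pos.L (sep c1 sin sx) (x, t) = beta t * c0 t * sin ?y * sx ?x + \<epsilon> * beta t * c1 t * cos ?y * (1 + s2 ?x)"
  proof -
    have "pos.L (sep c1 sin sx) (x, t) = (- 2 * \<nu> * c1 t + beta t * c0 t + \<nu> * (1 + 1) * c1 t) * sin ?y * sx ?x
       + - amp * (alpha t * cos ?y) * (c1 t * sin ?y * sx' ?x) + \<epsilon> * (beta t * sx ?x) * (c1 t * cos ?y * sx ?x)"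
      using pos.L_sep[OF derivative_profiles(3) tI trig_derivatives(9,10) trig_derivatives(1,2), of x]
      unfolding v by (simp only: sep_def snd_conv fst_conv)
    also have "- amp * (alpha t * cos ?y) * (c1 t * sin ?y * sx' ?x) = - amp * cos ?y * sin ?y * sx' ?x * (c1 t * alpha t)"
      by (simp only: mult_ac)
    also have "\<epsilon> * (beta t * sx ?x) * (c1 t * cos ?y * sx ?x) = \<epsilon> * beta t * c1 t * cos ?y * (sx ?x * sx ?x)"
      by (simp only: mult_ac)
    finally show ?thesis unfolding alpha_disjoint sx_square by (simp add: algebra_simps)
  qed
  have L2: "pos.L (sep (duhamel 1) cos one) (x, t) = - beta t * c1 t * cos ?y - \<epsilon> * beta t * duhamel 1 t * sx ?x * sin ?y"
    using pos.L_sep[OF derivative_profiles(4)[of 1] tI trig_derivatives(7,8) trig_derivatives(3,4), of x]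
    unfolding v by (simp add: sep_def algebra_simps)
  have da: "duhamel 5 t * alpha t = 0" using duhamel_early[of t 5] early(6)[of t] t by (cases "t \<le> 3") auto
  have L3: "pos.L (sep (duhamel 5) cos s2) (x, t) = - beta t * c1 t * cos ?y * s2 ?x - \<epsilon> * beta t * duhamel 5 t * sx ?x * sin ?y * s2 ?x"
  proof -
    have "pos.L (sep (duhamel 5) cos s2) (x, t) = (- 5 * \<nu> * duhamel 5 t - beta t * c1 t + \<nu> * (1 + 4) * duhamel 5 t) * cos ?y * s2 ?x
       + - amp * (alpha t * cos ?y) * (duhamel 5 t * cos ?y * s2' ?x) + \<epsilon> * (beta t * sx ?x) * (duhamel 5 t * msin ?y * s2 ?x)"
      using pos.L_sep[OF derivative_profiles(4)[of 5] tI trig_derivatives(7,8) trig_derivatives(5,6), of x]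
      unfolding v by (simp only: sep_def snd_conv fst_conv)
    also have "- amp * (alpha t * cos ?y) * (duhamel 5 t * cos ?y * s2' ?x) = - amp * cos ?y * cos ?y * s2' ?x * (duhamel 5 t * alpha t)"
      by (simp only: mult_ac)
    finally show ?thesis unfolding da by (simp add: algebra_simps)
  qed
  have "pos.L (app 1) (x, t) = vel (x, t) $ 1 + (amp * pos.L (sep c0 cos one) (x, t) + (amp * \<epsilon> * pos.L (sep c1 sin sx) (x, t)
      + (amp * \<epsilon>^2 * pos.L (sep (duhamel 1) cos one) (x, t) + amp * \<epsilon>^2 * pos.L (sep (duhamel 5) cos s2) (x, t))))"
    unfolding app_def[abs_def] if_P[OF refl]
    by (subst pos.L_add[OF tI], (intro smi)+)+
      (simp only: pos.L_coord pos.L_cmult[OF tI parts(1)] pos.L_cmult[OF tI parts(2)] pos.L_cmult[OF tI parts(3)] pos.L_cmult[OF tI parts(4)])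
  also have "\<dots> = - amp * \<epsilon>^3 * beta t * sx ?x * sin ?y * (duhamel 1 t + duhamel 5 t * s2 ?x)"
    unfolding L0 L1 L2 L3 v by (simp add: algebra_simps power2_eq_square power3_eq_cube)
  also have "\<dots> = - (amp * \<epsilon>^3) * beta t * sx ?x * sin ?y * (duhamel 1 t + duhamel 5 t * s2 ?x)" by simp
  also have "\<dots> = - (- 2 / kappa * \<epsilon>) * beta t * sx ?x * sin ?y * (duhamel 1 t + duhamel 5 t * s2 ?x)"
  proof -
    have "amp * \<epsilon>^3 = - 2 / kappa * \<epsilon>" using eps by (simp add: amp_def power2_eq_square power3_eq_cube)
    then show ?thesis by (simp only:)
  qed
  finally have "pos.L (app 1) (x, t) = 2 / kappa * \<epsilon> * beta t * sx ?x * sin ?y * (duhamel 1 t + duhamel 5 t * s2 ?x)" by simp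
  then show "pos.L (app 1) (x, t) = \<epsilon> * defect (x, t)" by (simp add: defect_def sep_def algebra_simps add_divide_distrib)
  have Lb: "pos.L (sep b one sx) (x, t) = - beta t * sx ?x"
  proof -
    have "pos.L (sep b one sx) (x, t) = (- \<nu> * b t - beta t + \<nu> * (0 + 1) * b t) * 1 * sx ?x
       + - amp * (alpha t * cos ?y) * (b t * 1 * sx' ?x) + \<epsilon> * (beta t * sx ?x) * (b t * 0 * sx ?x)"
      using pos.L_sep[OF derivative_profiles(2) tI trig_derivatives(3,4) trig_derivatives(1,2), of x]
      unfolding v by (simp only: sep_def snd_conv fst_conv)
    also have "- amp * (alpha t * cos ?y) * (b t * 1 * sx' ?x) = - amp * cos ?y * sx' ?x * (b t * alpha t)" by (simp only: mult_ac mult_1)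
    finally show ?thesis unfolding alpha_disjoint by (simp add: algebra_simps)
  qed
  have "pos.L (app 2) (x, t) = vel (x, t) $ 2 + \<epsilon> * pos.L (sep b one sx) (x, t)"
    unfolding app_def[abs_def] if_not_P[OF neq3(4)] if_P[OF refl]
    by (subst pos.L_add[OF tI], (intro smi)+) (simp only: pos.L_coord pos.L_cmult[OF tI parts(5)])
  then show "pos.L (app 2) (x, t) = 0" unfolding Lb v by simp
  show "pos.L (app 3) (x, t) = 0"
    unfolding app_def[abs_def] using v pos.L_coord[of 3 x t] by (simp add: neq3)
qed

end

lemma dx_app_origin:
  "dx 1 (app 1) (0, 4) = 1 + amp * \<epsilon>^2 * (2 * duhamel 5 4)" "dx 2 (app 1) (0, 4) = amp * \<epsilon> * c1 4" "dx 3 (app 1) (0, 4) = 0"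
  "dx 1 (app 2) (0, 4) = \<epsilon> * b 4" "dx 2 (app 2) (0, 4) = 1" "dx 3 (app 2) (0, 4) = 0"
  "dx 1 (app 3) (0, 4) = 0" "dx 2 (app 3) (0, 4) = 0" "dx 3 (app 3) (0, 4) = 1"
proof -
  note parts = smooth_app_parts[OF whole.du]
  note smi = smooth_on_add smooth_on_mult smooth_on_const smooth_on_coord parts whole.du UNIV_I
  note ds = whole.dx_sep[OF trig_derivatives(7) trig_derivatives(3)] whole.dx_sep[OF trig_derivatives(9) trig_derivatives(1)]
    whole.dx_sep[OF trig_derivatives(7) trig_derivatives(5)] whole.dx_sep[OF trig_derivatives(3) trig_derivatives(1)]
  have a1: "dx k (app 1) (0, 4) = (if 1 = k then 1 else 0) + (amp * dx k (sep c0 cos one) (0, 4) + (amp * \<epsilon> * dx k (sep c1 sin sx) (0, 4)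
      + (amp * \<epsilon>^2 * dx k (sep (duhamel 1) cos one) (0, 4) + amp * \<epsilon>^2 * dx k (sep (duhamel 5) cos s2) (0, 4))))" for k
    unfolding app_def[abs_def] if_P[OF refl]
    by (subst whole.dx_add, (intro smi)+)+
      (simp only: whole.dx_coord whole.dx_cmult[OF UNIV_I parts(1)] whole.dx_cmult[OF UNIV_I parts(2)] whole.dx_cmult[OF UNIV_I parts(3)] whole.dx_cmult[OF UNIV_I parts(4)])
  show "dx 1 (app 1) (0, 4) = 1 + amp * \<epsilon>^2 * (2 * duhamel 5 4)" "dx 2 (app 1) (0, 4) = amp * \<epsilon> * c1 4" "dx 3 (app 1) (0, 4) = 0"
    unfolding a1 ds by (simp_all add: sep_def neq3)
  have a2: "dx k (app 2) (0, 4) = (if 2 = k then 1 else 0) + \<epsilon> * dx k (sep b one sx) (0, 4)" for k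
    unfolding app_def[abs_def] if_not_P[OF neq3(4)] if_P[OF refl]
    by (subst whole.dx_add, (intro smi)+) (simp only: whole.dx_coord whole.dx_cmult[OF UNIV_I parts(5)])
  show "dx 1 (app 2) (0, 4) = \<epsilon> * b 4" "dx 2 (app 2) (0, 4) = 1" "dx 3 (app 2) (0, 4) = 0"
    unfolding a2 ds by (simp_all add: sep_def neq3)
  have a3: "dx k (app 3) (0, 4) = (if 3 = k then 1 else 0)" for k
    unfolding app_def[abs_def] by (simp add: neq3 whole.dx_coord)
  show "dx 1 (app 3) (0, 4) = 0" "dx 2 (app 3) (0, 4) = 0" "dx 3 (app 3) (0, 4) = 1"
    unfolding a3 by (simp_all add: neq3)
qed

end

section \<open>Sign of the determinant and conclusion\<close>

text \<open>
  The limiting determinant, \<open>X - b Y = -1\<close>, is attained as \<open>\<epsilon>\<close> tends to \<open>0\<close>: the large entry \<open>Y / \<epsilon>\<close> is always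
  multiplied by an entry of the second row or by one of the third row, and these are \<open>\<epsilon> b\<close> or \<open>0\<close> up to
  \<open>\<epsilon>^2 C\<close>.  The proof multiplies the large entry by \<open>\<epsilon>\<close>, divides the off-diagonal entries of the second row
  by \<open>\<epsilon>\<close>, and passes to the limit in each product.
\<close>

lemma det_negative:
  fixes X Y b C :: real
  assumes lim: "X - b * Y = - 1" and C: "C \<ge> 0"
  shows "\<exists>\<epsilon>. 0 < \<epsilon> \<and> \<epsilon> \<le> 1 \<and> (\<forall>G :: real^3^3.
    \<bar>G $ 1 $ 1 - X\<bar> \<le> \<epsilon> * C \<and> \<bar>G $ 1 $ 2 - Y / \<epsilon>\<bar> \<le> \<epsilon> * C \<and> \<bar>G $ 1 $ 3\<bar> \<le> \<epsilon> * C \<and>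
    \<bar>G $ 2 $ 1 - \<epsilon> * b\<bar> \<le> \<epsilon>^2 * C \<and> \<bar>G $ 2 $ 2 - 1\<bar> \<le> \<epsilon>^2 * C \<and> \<bar>G $ 2 $ 3\<bar> \<le> \<epsilon>^2 * C \<and>
    \<bar>G $ 3 $ 1\<bar> \<le> \<epsilon>^2 * C \<and> \<bar>G $ 3 $ 2\<bar> \<le> \<epsilon>^2 * C \<and> \<bar>G $ 3 $ 3 - 1\<bar> \<le> \<epsilon>^2 * C \<longrightarrow> det G < 0)"
proof (rule ccontr)
  assume no: "\<not> ?thesis"
  define e where "e n = 1 / real (Suc n)" for n
  have e: "0 < e n" "e n \<le> 1" for n by (simp_all add: e_def)
  have e0: "e \<longlonglongrightarrow> 0" unfolding e_def using LIMSEQ_inverse_real_of_nat by (simp add: inverse_eq_divide)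
  have "\<exists>G :: real^3^3. \<bar>G $ 1 $ 1 - X\<bar> \<le> e n * C \<and> \<bar>G $ 1 $ 2 - Y / e n\<bar> \<le> e n * C \<and> \<bar>G $ 1 $ 3\<bar> \<le> e n * C \<and>
    \<bar>G $ 2 $ 1 - e n * b\<bar> \<le> (e n)^2 * C \<and> \<bar>G $ 2 $ 2 - 1\<bar> \<le> (e n)^2 * C \<and> \<bar>G $ 2 $ 3\<bar> \<le> (e n)^2 * C \<and>
    \<bar>G $ 3 $ 1\<bar> \<le> (e n)^2 * C \<and> \<bar>G $ 3 $ 2\<bar> \<le> (e n)^2 * C \<and> \<bar>G $ 3 $ 3 - 1\<bar> \<le> (e n)^2 * C \<and> det G \<ge> 0" for n
  proof (rule ccontr)
    assume c: "\<not> ?thesis"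
    have "\<not> (0 < e n \<and> e n \<le> 1 \<and> (\<forall>G :: real^3^3.
      \<bar>G $ 1 $ 1 - X\<bar> \<le> e n * C \<and> \<bar>G $ 1 $ 2 - Y / e n\<bar> \<le> e n * C \<and> \<bar>G $ 1 $ 3\<bar> \<le> e n * C \<and>
      \<bar>G $ 2 $ 1 - e n * b\<bar> \<le> (e n)^2 * C \<and> \<bar>G $ 2 $ 2 - 1\<bar> \<le> (e n)^2 * C \<and> \<bar>G $ 2 $ 3\<bar> \<le> (e n)^2 * C \<and>
      \<bar>G $ 3 $ 1\<bar> \<le> (e n)^2 * C \<and> \<bar>G $ 3 $ 2\<bar> \<le> (e n)^2 * C \<and> \<bar>G $ 3 $ 3 - 1\<bar> \<le> (e n)^2 * C \<longrightarrow> det G < 0))"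
      using no by blast
    with c e[of n] show False by (meson not_le)
  qed
  then obtain G :: "nat \<Rightarrow> real^3^3" where G:
    "\<And>n. \<bar>G n $ 1 $ 1 - X\<bar> \<le> e n * C" "\<And>n. \<bar>G n $ 1 $ 2 - Y / e n\<bar> \<le> e n * C" "\<And>n. \<bar>G n $ 1 $ 3\<bar> \<le> e n * C"
    "\<And>n. \<bar>G n $ 2 $ 1 - e n * b\<bar> \<le> (e n)^2 * C" "\<And>n. \<bar>G n $ 2 $ 2 - 1\<bar> \<le> (e n)^2 * C" "\<And>n. \<bar>G n $ 2 $ 3\<bar> \<le> (e n)^2 * C"
    "\<And>n. \<bar>G n $ 3 $ 1\<bar> \<le> (e n)^2 * C" "\<And>n. \<bar>G n $ 3 $ 2\<bar> \<le> (e n)^2 * C" "\<And>n. \<bar>G n $ 3 $ 3 - 1\<bar> \<le> (e n)^2 * C"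
    "\<And>n. det (G n) \<ge> 0" by metis
  have conv: "f \<longlonglongrightarrow> l" if "\<And>n. \<bar>f n - l\<bar> \<le> e n * C" for f :: "nat \<Rightarrow> real" and l
  proof -
    have "(\<lambda>n. e n * C) \<longlonglongrightarrow> 0" using tendsto_mult_left_zero[OF e0] by simp
    then have "(\<lambda>n. f n - l) \<longlonglongrightarrow> 0"
      by (rule Lim_null_comparison[rotated]) (use that in \<open>simp add: eventually_sequentially\<close>)
    then show ?thesis by (rule LIM_zero_cancel)
  qed
  have sq: "(e n)^2 * C \<le> e n * C" for n
    using e[of n] C by (intro mult_right_mono) (simp_all add: power2_eq_square mult_left_le_one_le)
  have conv2: "f \<longlonglongrightarrow> l" if "\<And>n. \<bar>f n - l\<bar> \<le> (e n)^2 * C" for f :: "nat \<Rightarrow> real" and l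
    by (rule conv) (rule order_trans[OF that sq])
  have div: "\<bar>r / e n - s\<bar> \<le> e n * C" if "\<bar>r - e n * s\<bar> \<le> (e n)^2 * C" for r s n
  proof -
    have "\<bar>r / e n - s\<bar> = \<bar>r - e n * s\<bar> / e n" using e[of n] by (simp add: abs_if field_simps)
    also have "\<dots> \<le> (e n)^2 * C / e n" using that e[of n] by (intro divide_right_mono) auto
    finally show ?thesis using e[of n] by (simp add: power2_eq_square)
  qed
  have l11: "(\<lambda>n. G n $ 1 $ 1) \<longlonglongrightarrow> X" by (rule conv) (rule G)
  have l12: "(\<lambda>n. e n * G n $ 1 $ 2) \<longlonglongrightarrow> Y"
  proof (rule conv2)
    fix n
    have "\<bar>e n * G n $ 1 $ 2 - Y\<bar> = e n * \<bar>G n $ 1 $ 2 - Y / e n\<bar>" using e[of n] by (simp add: abs_if field_simps)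
    also have "\<dots> \<le> e n * (e n * C)" using e[of n] by (intro mult_left_mono G) auto
    finally show "\<bar>e n * G n $ 1 $ 2 - Y\<bar> \<le> (e n)^2 * C" by (simp add: power2_eq_square)
  qed
  have l13: "(\<lambda>n. G n $ 1 $ 3) \<longlonglongrightarrow> 0" by (rule conv) (simp add: G)
  have l21: "(\<lambda>n. G n $ 2 $ 1 / e n) \<longlonglongrightarrow> b" by (rule conv) (rule div, rule G)
  have l22: "(\<lambda>n. G n $ 2 $ 2) \<longlonglongrightarrow> 1" by (rule conv2) (rule G)
  have l23: "(\<lambda>n. G n $ 2 $ 3 / e n) \<longlonglongrightarrow> 0" by (rule conv) (rule div, simp add: G)
  have l31: "(\<lambda>n. G n $ 3 $ 1) \<longlonglongrightarrow> 0" by (rule conv2) (simp add: G)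
  have l32: "(\<lambda>n. G n $ 3 $ 2) \<longlonglongrightarrow> 0" by (rule conv2) (simp add: G)
  have l33: "(\<lambda>n. G n $ 3 $ 3) \<longlonglongrightarrow> 1" by (rule conv2) (rule G)
  have "(\<lambda>n. G n $ 1 $ 1 * G n $ 2 $ 2 * G n $ 3 $ 3 + (e n * G n $ 1 $ 2) * (G n $ 2 $ 3 / e n) * G n $ 3 $ 1
      + G n $ 1 $ 3 * (e n * (G n $ 2 $ 1 / e n)) * G n $ 3 $ 2 - G n $ 1 $ 1 * (e n * (G n $ 2 $ 3 / e n)) * G n $ 3 $ 2
      - (e n * G n $ 1 $ 2) * (G n $ 2 $ 1 / e n) * G n $ 3 $ 3 - G n $ 1 $ 3 * G n $ 2 $ 2 * G n $ 3 $ 1)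
    \<longlonglongrightarrow> X * 1 * 1 + Y * 0 * 0 + 0 * (0 * b) * 0 - X * (0 * 0) * 0 - Y * b * 1 - 0 * 1 * 0"
    by (intro tendsto_add tendsto_diff tendsto_mult e0 l11 l12 l13 l21 l22 l23 l31 l32 l33)
  moreover have "G n $ 1 $ 1 * G n $ 2 $ 2 * G n $ 3 $ 3 + (e n * G n $ 1 $ 2) * (G n $ 2 $ 3 / e n) * G n $ 3 $ 1
      + G n $ 1 $ 3 * (e n * (G n $ 2 $ 1 / e n)) * G n $ 3 $ 2 - G n $ 1 $ 1 * (e n * (G n $ 2 $ 3 / e n)) * G n $ 3 $ 2
      - (e n * G n $ 1 $ 2) * (G n $ 2 $ 1 / e n) * G n $ 3 $ 3 - G n $ 1 $ 3 * G n $ 2 $ 2 * G n $ 3 $ 1 = det (G n)" for n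
    using e(1)[of n] by (simp add: det_3)
  moreover have "X * 1 * 1 + Y * 0 * 0 + 0 * (0 * b) * 0 - X * (0 * 0) * 0 - Y * b * 1 - 0 * 1 * 0 = - 1"
    using lim by (simp add: mult.commute)
  ultimately have "(\<lambda>n. det (G n)) \<longlonglongrightarrow> - 1" by (simp only:)
  then have "0 \<le> (- 1 :: real)" by (rule LIMSEQ_le_const) (use G(10) in auto)
  then show False by simp
qed

context profile begin

text \<open>
  The constant of \<open>gradient_estimate\<close> when the velocity and its first derivatives are bounded by
  \<open>2 / step_mass\<close>.  This bound holds for \<open>t \<ge> 3\<close>, when only the small shear acts; so the constant depends
  neither on \<open>\<epsilon>\<close> nor on \<open>R\<close>, although the velocity is large at earlier times.
\<close>

definition gradient_factor :: real where "gradient_factor = (2 + 6 * (2 / step_mass) + 12 * (2 / step_mass) + 44 * \<nu>) / (2 * \<nu>)"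

definition gradient_const :: "real \<Rightarrow> real" where
  "gradient_const H = sqrt (2 * gradient_factor * (4 * H + 1)^2 + (3 + gradient_factor) * H^2)"

lemma gradient_factor_nonneg: "gradient_factor \<ge> 0"
  unfolding gradient_factor_def using nu_pos step_mass_pos by simp

lemma velocity_profile_bounds: "\<bar>alpha t\<bar> \<le> 1 / step_mass" "\<bar>beta t\<bar> \<le> 1 / step_mass"
proof -
  have *: "\<bar>exp (- \<nu> * t) * step' (t - d)\<bar> \<le> 1 / step_mass" if "d \<ge> 0" for d
  proof (cases "t \<le> 0")
    case True
    then show ?thesis using that step_mass_pos by (simp add: step'_bounds)
  next
    case False
    then have "exp (- \<nu> * t) \<le> 1" using nu_pos by simp
    then have "exp (- \<nu> * t) * step' (t - d) \<le> 1 * (1 / step_mass)" by (intro mult_mono step'_bounds) auto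
    then show ?thesis by (simp add: abs_mult step'_bounds)
  qed
  show "\<bar>alpha t\<bar> \<le> 1 / step_mass" "\<bar>beta t\<bar> \<le> 1 / step_mass"
    using *[of 2] *[of 3] by (simp_all add: alpha_def beta_def)
qed

lemma profiles_bounded: "\<exists>M\<ge>0. \<forall>t\<in>{0..4}. \<bar>c0 t\<bar> \<le> M \<and> \<bar>c1 t\<bar> \<le> M \<and> \<bar>duhamel 1 t\<bar> \<le> M \<and> \<bar>duhamel 5 t\<bar> \<le> M \<and> \<bar>b t\<bar> \<le> M"
proof -
  obtain B0 B1 B2 B3 B4 where B: "\<forall>t\<in>{0..4}. \<bar>c0 t\<bar> \<le> B0" "\<forall>t\<in>{0..4}. \<bar>c1 t\<bar> \<le> B1" "\<forall>t\<in>{0..4}. \<bar>duhamel 1 t\<bar> \<le> B2"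
    "\<forall>t\<in>{0..4}. \<bar>duhamel 5 t\<bar> \<le> B3" "\<forall>t\<in>{0..4}. \<bar>b t\<bar> \<le> B4" and nn: "B0 \<ge> 0" "B1 \<ge> 0" "B2 \<ge> 0" "B3 \<ge> 0" "B4 \<ge> 0"
    using profile_bounded[OF smooth_profiles(1)] profile_bounded[OF smooth_profiles(5)] profile_bounded[OF smooth_duhamel[of 1]]
      profile_bounded[OF smooth_duhamel[of 5]] profile_bounded[OF smooth_profiles(3)] by metis
  show ?thesis
  proof (intro exI[of _ "B0 + B1 + B2 + B3 + B4"] conjI ballI)
    fix t :: real assume "t \<in> {0..4}"
    then have "\<bar>c0 t\<bar> \<le> B0" "\<bar>c1 t\<bar> \<le> B1" "\<bar>duhamel 1 t\<bar> \<le> B2" "\<bar>duhamel 5 t\<bar> \<le> B3" "\<bar>b t\<bar> \<le> B4" using B by auto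
    then show "\<bar>c0 t\<bar> \<le> B0 + B1 + B2 + B3 + B4" "\<bar>c1 t\<bar> \<le> B0 + B1 + B2 + B3 + B4" "\<bar>duhamel 1 t\<bar> \<le> B0 + B1 + B2 + B3 + B4"
      "\<bar>duhamel 5 t\<bar> \<le> B0 + B1 + B2 + B3 + B4" "\<bar>b t\<bar> \<le> B0 + B1 + B2 + B3 + B4" using nn by linarith+
  qed (use nn in simp)
qed

lemma smooth_defect_factors: "smooth_on UNIV (\<lambda>r. sx r * s2 r)" "smooth_on UNIV (\<lambda>t. beta t * duhamel k t)"
  by (intro smooth_on_mult du_UNIV smooth_trig smooth_profiles smooth_duhamel)+

lemma smooth_defect: "diff_unique S \<Longrightarrow> smooth_on S defect"
  unfolding defect_def[abs_def]
  by (intro smooth_on_mult smooth_on_const smooth_on_add smooth_on_sep smooth_defect_factors smooth_on_sin_cos smooth_trig)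

text \<open>
  The bound \<open>H\<close> depends on \<open>\<nu>\<close> only, and not on the parameters \<open>\<epsilon>\<close> and \<open>R\<close> that are chosen in terms of it.
\<close>

lemma defect_bounds: "\<exists>H\<ge>0. \<forall>x t. 0 \<le> t \<longrightarrow> t \<le> 4 \<longrightarrow> \<bar>defect (x, t)\<bar> \<le> H \<and> (\<forall>j. \<bar>dx j defect (x, t)\<bar> \<le> H)"
proof -
  obtain B1 where B1: "B1 \<ge> 0" "\<And>t. t \<in> {0..4} \<Longrightarrow> \<bar>beta t * duhamel 1 t\<bar> \<le> B1" using profile_bounded[OF smooth_defect_factors(2)[of 1]] by blast
  obtain B5 where B5: "B5 \<ge> 0" "\<And>t. t \<in> {0..4} \<Longrightarrow> \<bar>beta t * duhamel 5 t\<bar> \<le> B5" using profile_bounded[OF smooth_defect_factors(2)[of 5]] by blast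
  define H where "H = 2 / kappa * (B1 * 1 * 2 + B5 * 1 * 6)"
  let ?f1 = "\<lambda>t. beta t * duhamel 1 t" and ?f5 = "\<lambda>t. beta t * duhamel 5 t"
  let ?h = "\<lambda>r. sx r * s2 r" and ?h' = "\<lambda>r. sx' r * s2 r + s2' r * sx r"
  have hb: "\<bar>?h r\<bar> \<le> 6" "\<bar>?h' r\<bar> \<le> 6" for r
  proof -
    have "\<bar>sx r * s2 r\<bar> \<le> 2 * 1" unfolding abs_mult by (intro mult_mono trig_bounds) auto
    then show "\<bar>?h r\<bar> \<le> 6" by simp
    have "\<bar>sx' r * s2 r\<bar> \<le> 2 * 1" unfolding abs_mult by (intro mult_mono trig_bounds) auto
    moreover have "\<bar>s2' r * sx r\<bar> \<le> 2 * 2" unfolding abs_mult by (intro mult_mono trig_bounds) auto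
    ultimately show "\<bar>?h' r\<bar> \<le> 6" by linarith
  qed
  have h': "(?h has_real_derivative ?h' r) (at r)" for r
    by (rule DERIV_mult[OF trig_derivatives(1) trig_derivatives(5)])
  have sb: "\<bar>sep f g h (x, t)\<bar> \<le> B * 1 * c" if "\<bar>f t\<bar> \<le> B" "\<And>r. \<bar>g r\<bar> \<le> 1" "\<And>r. \<bar>h r\<bar> \<le> c" "B \<ge> 0" for f g h :: "real \<Rightarrow> real" and B c x t
    unfolding sep_def abs_mult fst_conv snd_conv using that by (intro mult_mono) auto
  have comb: "\<bar>2 / kappa * (p + r)\<bar> \<le> H" if "\<bar>p\<bar> \<le> B1 * 1 * 2" "\<bar>r\<bar> \<le> B5 * 1 * 6" for p r
    unfolding H_def abs_mult using that kappa_pos by (intro mult_mono) auto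
  show ?thesis
  proof (intro exI[of _ H] conjI allI impI)
    show "H \<ge> 0" unfolding H_def using kappa_pos B1 B5 by simp
    fix x :: "real^3" and t :: real assume "0 \<le> t" "t \<le> 4"
    then have t: "t \<in> {0..4}" by simp
    show "\<bar>defect (x, t)\<bar> \<le> H"
      unfolding defect_def by (intro comb sb B1 B5 t trig_bounds hb abs_sin_le_one)
    fix j :: 3
    have sm: "whole.smooth (sep ?f1 sin sx)" "whole.smooth (sep ?f5 sin ?h)"
      by (intro smooth_on_sep whole.du smooth_defect_factors smooth_on_sin_cos smooth_trig)+
    have d: "dx j defect (x, t) = 2 / kappa * (dx j (sep ?f1 sin sx) (x, t) + dx j (sep ?f5 sin ?h) (x, t))"
      unfolding defect_def[abs_def]
      by (simp only: whole.dx_cmult[OF UNIV_I smooth_on_add[OF whole.du sm]] whole.dx_add[OF UNIV_I sm])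
    have b1: "\<bar>dx j (sep ?f1 sin sx) (x, t)\<bar> \<le> B1 * 1 * 2"
      using exhaust_3[of j] whole.dx_sep[OF trig_derivatives(9) trig_derivatives(1), of ?f1 x t] B1(1)
        sb[of ?f1 t B1 sin sx' 2 x] sb[of ?f1 t B1 cos sx 2 x] B1(2)[OF t] trig_bounds by auto
    have b5: "\<bar>dx j (sep ?f5 sin ?h) (x, t)\<bar> \<le> B5 * 1 * 6"
      using exhaust_3[of j] whole.dx_sep[OF trig_derivatives(9) h', of ?f5 x t] B5(1)
        sb[of ?f5 t B5 sin ?h' 6 x] sb[of ?f5 t B5 cos ?h 6 x] B5(2)[OF t] hb by auto
    show "\<bar>dx j defect (x, t)\<bar> \<le> H" unfolding d by (rule comb[OF b1 b5])
  qed
qed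

end

context construction begin

text \<open>
  A bound for the velocity, including the contribution of the gradient of the cutoff.  It does not depend on
  \<open>R\<close>, so that \<open>R\<close> can be chosen in terms of it.
\<close>

definition vmax :: real where "vmax = (\<bar>amp\<bar> + 2) / step_mass * (1 + 4 / step_mass)"

lemma vmax_nonneg: "vmax \<ge> 0" using step_mass_pos by (simp add: vmax_def)

lemma Psi_bound: "\<bar>Psi z\<bar> \<le> (\<bar>amp\<bar> + 2) / step_mass" and vel0_bound: "\<bar>vel0 z $ j\<bar> \<le> (\<bar>amp\<bar> + 2) / step_mass"
proof -
  have a: "\<bar>amp * (alpha t * g)\<bar> \<le> \<bar>amp\<bar> * (1 / step_mass)" if "\<bar>g\<bar> \<le> 1" for t g
  proof -
    have "\<bar>alpha t * g\<bar> \<le> 1 / step_mass * 1" unfolding abs_mult using that velocity_profile_bounds[of t] step_mass_pos by (intro mult_mono) auto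
    then show ?thesis unfolding abs_mult[of amp] by (intro mult_left_mono) auto
  qed
  have bb: "\<bar>\<epsilon> * (beta t * g)\<bar> \<le> 2 / step_mass" if "\<bar>g\<bar> \<le> 2" for t g
  proof -
    have "\<bar>beta t * g\<bar> \<le> 1 / step_mass * 2" unfolding abs_mult using that velocity_profile_bounds[of t] step_mass_pos by (intro mult_mono) auto
    then have "\<bar>\<epsilon>\<bar> * \<bar>beta t * g\<bar> \<le> 1 * (1 / step_mass * 2)" using eps by (intro mult_mono) auto
    then show ?thesis by (simp add: abs_mult)
  qed
  have e: "(\<bar>amp\<bar> + 2) / step_mass = \<bar>amp\<bar> * (1 / step_mass) + 2 / step_mass" by (simp add: add_divide_distrib)
  obtain x t where z: "z = (x, t)" by (cases z)
  show "\<bar>Psi z\<bar> \<le> (\<bar>amp\<bar> + 2) / step_mass"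
    using a[of "sin (x $ 2)" t] bb[of "sx' (x $ 1)" t] trig_bounds(2)[of "x $ 1"] unfolding e Psi_def z sep_def by simp
  have p: "0 \<le> 2 / step_mass" "0 \<le> \<bar>amp\<bar> * (1 / step_mass)" using step_mass_pos by auto
  show "\<bar>vel0 z $ j\<bar> \<le> (\<bar>amp\<bar> + 2) / step_mass"
    using exhaust_3[of j] a[of "cos (x $ 2)" t] bb[of "sx (x $ 1)" t] trig_bounds(1)[of "x $ 1"] p
    unfolding e z by (auto simp: vel_nth sep_def)
qed

lemma vel_bound: "\<bar>vel z $ j\<bar> \<le> vmax"
proof -
  obtain x t where z: "z = (x, t)" by (cases z)
  let ?B = "(\<bar>amp\<bar> + 2) / step_mass"
  have B: "?B \<ge> 0" using step_mass_pos by simp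
  have "\<bar>dx k pot (x, t)\<bar> \<le> vmax" if k: "\<bar>dx k Psi (x, t)\<bar> \<le> ?B" for k
  proof -
    have "\<bar>cutoff R (x, t) * dx k Psi (x, t)\<bar> \<le> 1 * ?B"
      unfolding abs_mult using k cutoff_bounds[of R "(x, t)"] B by (intro mult_mono) auto
    moreover have "\<bar>dx k (cutoff R) (x, t)\<bar> \<le> 4 / step_mass"
    proof -
      have "4 / (step_mass * R) \<le> 4 / step_mass" using R step_mass_pos by (intro divide_left_mono) auto
      then show ?thesis using whole.dx_cutoff_bound[OF UNIV_I R0, of k x t] by linarith
    qed
    then have "\<bar>Psi (x, t) * dx k (cutoff R) (x, t)\<bar> \<le> ?B * (4 / step_mass)"
      unfolding abs_mult using Psi_bound[of "(x, t)"] B by (intro mult_mono) auto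
    ultimately show ?thesis unfolding dx_pot vmax_def by (simp add: distrib_left abs_le_iff)
  qed
  then show ?thesis
    using exhaust_3[of j] dx_Psi[of x t] vel0_bound[of "(x, t)" 1] vel0_bound[of "(x, t)" 2] vmax_nonneg unfolding z by (auto simp: vel_nth)
qed

lemma app_bound:
  assumes M: "\<forall>t\<in>{0..4}. \<bar>c0 t\<bar> \<le> M \<and> \<bar>c1 t\<bar> \<le> M \<and> \<bar>duhamel 1 t\<bar> \<le> M \<and> \<bar>duhamel 5 t\<bar> \<le> M \<and> \<bar>b t\<bar> \<le> M"
    and M0: "M \<ge> 0" and t: "t \<in> {0..4}"
  shows "\<bar>app i (x, t) - x $ i\<bar> \<le> (5 * \<bar>amp\<bar> + 2) * M"
proof -
  have sb: "\<bar>k * sep f g h (x, t)\<bar> \<le> K * (M * c)" if "\<bar>k\<bar> \<le> K" "\<bar>f t\<bar> \<le> M" "\<And>r. \<bar>g r\<bar> \<le> 1" "\<And>r. \<bar>h r\<bar> \<le> c" for f g h :: "real \<Rightarrow> real" and k K c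
  proof -
    have "\<bar>sep f g h (x, t)\<bar> \<le> M * 1 * c" unfolding sep_def abs_mult fst_conv snd_conv using that M0 by (intro mult_mono) auto
    then show ?thesis unfolding abs_mult[of k] using that(1) by (intro mult_mono) auto
  qed
  have Mt: "\<bar>c0 t\<bar> \<le> M" "\<bar>c1 t\<bar> \<le> M" "\<bar>duhamel 1 t\<bar> \<le> M" "\<bar>duhamel 5 t\<bar> \<le> M" "\<bar>b t\<bar> \<le> M" using M t by auto
  have am: "\<bar>amp * \<epsilon>\<bar> \<le> \<bar>amp\<bar>" "\<bar>amp * \<epsilon>^2\<bar> \<le> \<bar>amp\<bar>"
    unfolding abs_mult using eps by (intro mult_right_le_one_le; simp add: power_le_one)+
  have b: "\<bar>amp * sep c0 cos one (x, t)\<bar> \<le> \<bar>amp\<bar> * (M * 1)" "\<bar>amp * \<epsilon> * sep c1 sin sx (x, t)\<bar> \<le> \<bar>amp\<bar> * (M * 2)"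
    "\<bar>amp * \<epsilon>^2 * sep (duhamel 1) cos one (x, t)\<bar> \<le> \<bar>amp\<bar> * (M * 1)" "\<bar>amp * \<epsilon>^2 * sep (duhamel 5) cos s2 (x, t)\<bar> \<le> \<bar>amp\<bar> * (M * 1)"
    "\<bar>\<epsilon> * sep b one sx (x, t)\<bar> \<le> 1 * (M * 2)"
    by (intro sb am Mt trig_bounds abs_sin_le_one abs_cos_le_one; use eps in simp)+
  have "0 \<le> \<bar>amp\<bar> * M" using M0 by simp
  then show ?thesis
    using b M0 exhaust_3[of i] by (auto simp: app_def neq3 distrib_right abs_le_iff)
qed

lemma app_init: "app i (x, 0) = x $ i"
  using exhaust_3[of i] early[of 0] duhamel_early[of 0] by (auto simp: app_def sep_def neq3)

end

text \<open>
  The constants \<open>H\<close> and \<open>M\<close> come from the time profiles, that is from \<open>\<nu>\<close> alone.  The lower bound for \<open>R\<close>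
  turns the error term of \<open>local_comparison\<close>, which is of order \<open>1 / R\<close>, into one of order \<open>\<epsilon>^2\<close>.
\<close>

locale approximation = construction +
  fixes A H M
  assumes A: "smooth_solution_A \<nu> vel A"
    and H: "H \<ge> 0" "\<And>x t. 0 \<le> t \<Longrightarrow> t \<le> 4 \<Longrightarrow> \<bar>defect (x, t)\<bar> \<le> H" "\<And>x t j. 0 \<le> t \<Longrightarrow> t \<le> 4 \<Longrightarrow> \<bar>dx j defect (x, t)\<bar> \<le> H"
    and M: "M \<ge> 0" "\<forall>t\<in>{0..4}. \<bar>c0 t\<bar> \<le> M \<and> \<bar>c1 t\<bar> \<le> M \<and> \<bar>duhamel 1 t\<bar> \<le> M \<and> \<bar>duhamel 5 t\<bar> \<le> M \<and> \<bar>b t\<bar> \<le> M"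
    and R_large: "(4 * vmax + (5 * \<bar>amp\<bar> + 2) * M + 1) * (5 + 24 * \<nu> + 24 * vmax) / \<epsilon>^2 \<le> R"
begin

sublocale sol: solution \<nu> vel A
  by unfold_locales (rule A)

definition D :: "3 \<Rightarrow> (real^3) \<times> real \<Rightarrow> real" where "D i z = A z $ i - app i z"

text \<open>
  A bound for \<open>|L D|\<close> and its gradient, componentwise: only the first component of \<open>app\<close> has a defect.
\<close>

definition def_size :: "3 \<Rightarrow> real" where "def_size i = (if i = 1 then \<epsilon> * H else 0)"

lemma def_size_nonneg: "def_size i \<ge> 0" using eps H by (simp add: def_size_def)

lemma D_smooth: "sol.pos.smooth (D i)"
  unfolding D_def[abs_def] by (intro smooth_on_diff sol.pos.du sol.A_nth_smooth smooth_app)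

lemma L_D: "norm x \<le> R \<Longrightarrow> t > 0 \<Longrightarrow> sol.pos.L (D i) (x, t) = (if i = 1 then - \<epsilon> * defect (x, t) else 0)"
proof -
  assume x: "norm x \<le> R" and t: "t > 0"
  then have tI: "t \<in> {0<..}" by simp
  have "sol.pos.L (D i) (x, t) = - sol.pos.L (app i) (x, t)"
    unfolding D_def[abs_def] sol.pos.L_diff[OF tI sol.A_nth_smooth smooth_app[OF sol.pos.du]] sol.A_nth_eq[OF t] by simp
  then show ?thesis using L_app[OF x t] exhaust_3[of i] by (auto simp: neq3)
qed

lemma error_small:
  assumes x: "norm x \<le> 1" and t: "0 \<le> t" "t \<le> 4"
  shows "\<bar>D i (x, t)\<bar> \<le> 4 * def_size i + \<epsilon>^2"
proof -
  define C where "C = 4 * vmax + (5 * \<bar>amp\<bar> + 2) * M + 1"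
  have C: "C > 0" unfolding C_def using vmax_nonneg M by (intro add_nonneg_pos add_nonneg_nonneg mult_nonneg_nonneg) auto
  have "\<bar>D i (x, t)\<bar> \<le> def_size i * 4 + C / R^2 * (1 + (6 * \<nu> + 6 * vmax * R + 1) * 4)"
  proof (rule sol.pos.local_comparison[OF nu_pos D_smooth _ _ _ C _ vmax_nonneg def_size_nonneg])
    show "continuous_on (UNIV \<times> {0..4}) (D i)"
      unfolding D_def
      by (intro continuous_intros continuous_on_subset[OF sol.A_cont]
          continuous_on_subset[OF smooth_on_imp_continuous_on[OF smooth_app[OF du_UNIV]]]) auto
    show "D i (x, 0) = 0" for x by (simp add: D_def sol.A_init app_init)
    show "\<bar>D i (y, s)\<bar> \<le> C" if "0 \<le> s" "s \<le> 4" for y s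
    proof -
      have "\<bar>A (y, s) $ i - y $ i\<bar> \<le> vmax * s" by (rule sol.A_growth[OF vel_bound that(1)])
      also have "\<dots> \<le> vmax * 4" using that vmax_nonneg by (intro mult_left_mono) auto
      finally have "\<bar>A (y, s) $ i - y $ i\<bar> \<le> 4 * vmax" by simp
      moreover have "\<bar>app i (y, s) - y $ i\<bar> \<le> (5 * \<bar>amp\<bar> + 2) * M" using app_bound[OF M(2,1)] that by simp
      ultimately show ?thesis unfolding D_def C_def by linarith
    qed
    show "\<bar>sol.pos.L (D i) (y, s)\<bar> \<le> def_size i \<and> (\<forall>j. \<bar>vel (y, s) $ j\<bar> \<le> vmax)" if "norm y < R" "0 < s" "s \<le> 4" for y s
    proof -
      have "\<epsilon> * \<bar>defect (y, s)\<bar> \<le> \<epsilon> * H" using H(2)[of s y] that eps by (intro mult_left_mono) auto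
      then show ?thesis using L_D[of y s i] that vel_bound eps by (auto simp: def_size_def abs_mult)
    qed
  qed (use x t R in auto)
  also have "C / R^2 * (1 + (6 * \<nu> + 6 * vmax * R + 1) * 4) \<le> \<epsilon>^2"
  proof -
    have "1 + (6 * \<nu> + 6 * vmax * R + 1) * 4 \<le> (5 + 24 * \<nu> + 24 * vmax) * R"
    proof -
      have "(5 + 24 * \<nu>) * 1 \<le> (5 + 24 * \<nu>) * R" using R nu_pos by (intro mult_left_mono) auto
      then show ?thesis by (simp add: algebra_simps)
    qed
    then have "C / R^2 * (1 + (6 * \<nu> + 6 * vmax * R + 1) * 4) \<le> C / R^2 * ((5 + 24 * \<nu> + 24 * vmax) * R)"
      using C by (intro mult_left_mono) auto
    also have "\<dots> = C * (5 + 24 * \<nu> + 24 * vmax) / R" using R by (simp add: power2_eq_square)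
    also have "\<dots> \<le> \<epsilon>^2"
    proof -
      have "C * (5 + 24 * \<nu> + 24 * vmax) \<le> R * \<epsilon>^2"
        using R_large eps unfolding C_def[symmetric] by (simp add: pos_divide_le_eq)
      then show ?thesis using R by (simp add: pos_divide_le_eq mult.commute)
    qed
    finally show ?thesis .
  qed
  finally show ?thesis by simp
qed

text \<open>
  From time \<open>3\<close> on the first shear, whose amplitude is of order \<open>1 / \<epsilon>^2\<close>, is switched off.
\<close>

lemma dx_vel_bound:
  assumes x: "norm x \<le> 1" and t: "t \<ge> 3"
  shows "\<bar>vel (x, t) $ j\<bar> \<le> 2 / step_mass" "\<bar>dx k (\<lambda>z. vel z $ j) (x, t)\<bar> \<le> 2 / step_mass"
proof -
  have bb: "\<bar>\<epsilon> * (beta t * g)\<bar> \<le> 2 / step_mass" if "\<bar>g\<bar> \<le> 2" for g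
  proof -
    have "\<bar>beta t * g\<bar> \<le> 1 / step_mass * 2" unfolding abs_mult using that velocity_profile_bounds[of t] step_mass_pos by (intro mult_mono) auto
    then have "\<bar>\<epsilon>\<bar> * \<bar>beta t * g\<bar> \<le> 1 * (1 / step_mass * 2)" using eps by (intro mult_mono) auto
    then show ?thesis by (simp add: abs_mult)
  qed
  have p: "0 \<le> 2 / step_mass" using step_mass_pos by simp
  have v: "vel (y, t) $ 1 = 0" "vel (y, t) $ 2 = \<epsilon> * sep beta one sx (y, t)" "vel (y, t) $ 3 = 0" if "norm y \<le> 2" for y
    using vel_inner[of y t] that R early(6)[OF t] by (simp_all add: vel_nth sep_def)
  show "\<bar>vel (x, t) $ j\<bar> \<le> 2 / step_mass"
    using exhaust_3[of j] v[of x] x bb[OF trig_bounds(1)] p by (auto simp: sep_def)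
  have near: "norm y \<le> 2" if "dist x y < 1" for y
    using that x norm_triangle_ineq2[of y x] by (simp add: dist_norm norm_minus_commute)
  have smb: "whole.smooth (sep beta one sx)" by (intro smooth_on_sep whole.du smooth_profiles smooth_trig)
  have d1: "dx k (\<lambda>z. vel z $ 1) (x, t) = 0"
    using whole.dx_cong_near[OF smooth_on_const[OF whole.du] UNIV_I zero_less_one, of x "\<lambda>z. vel z $ 1" t 0 k] v near whole.dx_const by simp
  have d3: "dx k (\<lambda>z. vel z $ 3) (x, t) = 0"
    using whole.dx_cong_near[OF smooth_on_const[OF whole.du] UNIV_I zero_less_one, of x "\<lambda>z. vel z $ 3" t 0 k] v near whole.dx_const by simp
  have "dx k (\<lambda>z. vel z $ 2) (x, t) = dx k (\<lambda>z. \<epsilon> * sep beta one sx z) (x, t)"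
    by (rule whole.dx_cong_near[OF smooth_on_mult[OF whole.du smooth_on_const[OF whole.du] smb] UNIV_I zero_less_one])
      (use v near in auto)
  also have "\<dots> = \<epsilon> * dx k (sep beta one sx) (x, t)" by (rule whole.dx_cmult[OF UNIV_I smb])
  finally have "\<bar>dx k (\<lambda>z. vel z $ 2) (x, t)\<bar> \<le> 2 / step_mass"
    using exhaust_3[of k] whole.dx_sep[OF trig_derivatives(3) trig_derivatives(1), of beta x t] bb[OF trig_bounds(2)] p by (auto simp: sep_def)
  then show "\<bar>dx k (\<lambda>z. vel z $ j) (x, t)\<bar> \<le> 2 / step_mass"
    using exhaust_3[of j] d1 d3 p by auto
qed

lemma gradient_close_sq:
  "(dx j (D i) (0, 4))^2 \<le> gradient_factor * (4 * def_size i + \<epsilon>^2)^2 + 3 * (def_size i)^2 + gradient_factor * ((4 * def_size i + \<epsilon>^2)^2 + (def_size i)^2)"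
proof -
  have p: "0 \<le> 2 / step_mass" using step_mass_pos by simp
  have "(\<Sum>j\<in>UNIV. (dx j (D i) (0, 4))^2) \<le> gradient_factor * (4 * def_size i + \<epsilon>^2)^2 + 3 * (def_size i)^2 + gradient_factor * ((4 * def_size i + \<epsilon>^2)^2 + (def_size i)^2)"
    unfolding gradient_factor_def
  proof (rule sol.pos.gradient_estimate[OF nu_pos D_smooth sol.pos.u_smooth' _ p p])
    fix x :: "real^3" and t :: real assume "dist 0 x \<le> 1" and t: "4 - 1 \<le> t" "t \<le> 4"
    then have x: "norm x \<le> 1" by simp
    have t0: "t > 0" using t by simp
    have "\<epsilon> * \<bar>defect (x, t)\<bar> \<le> \<epsilon> * H" using H(2)[of t x] t eps by (intro mult_left_mono) auto
    then have LD: "\<bar>sol.pos.L (D i) (x, t)\<bar> \<le> def_size i"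
      using L_D[of x t i] x R t0 eps by (auto simp: def_size_def abs_mult)
    have near: "norm y \<le> R" if "dist x y < 1" for y
      using that x R norm_triangle_ineq2[of y x] by (simp add: dist_norm norm_minus_commute)
    have dLD: "\<bar>dx j (sol.pos.L (D i)) (x, t)\<bar> \<le> def_size i" for j
    proof (cases "i = 1")
      case True
      have "dx j (sol.pos.L (D i)) (x, t) = dx j (\<lambda>z. - \<epsilon> * defect z) (x, t)"
        by (rule whole.dx_cong_near[OF smooth_on_mult[OF whole.du smooth_on_const[OF whole.du] smooth_defect[OF whole.du]] UNIV_I zero_less_one])
          (use L_D near t0 True in auto)
      also have "\<dots> = - \<epsilon> * dx j defect (x, t)" by (rule whole.dx_cmult[OF UNIV_I smooth_defect[OF whole.du]])
      finally show ?thesis using H(3)[of t j x] t eps True by (simp add: def_size_def abs_mult)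
    next
      case False
      have "dx j (sol.pos.L (D i)) (x, t) = dx j (\<lambda>z. 0) (x, t)"
        by (rule whole.dx_cong_near[OF smooth_on_const[OF whole.du] UNIV_I zero_less_one]) (use L_D near t0 False in auto)
      then show ?thesis using def_size_nonneg[of i] by (simp add: whole.dx_const)
    qed
    have t3: "3 \<le> t" using t by simp
    show "\<bar>D i (x, t)\<bar> \<le> 4 * def_size i + \<epsilon>\<^sup>2 \<and> \<bar>sol.pos.L (D i) (x, t)\<bar> \<le> def_size i \<and> (\<forall>j. \<bar>dx j (sol.pos.L (D i)) (x, t)\<bar> \<le> def_size i)
      \<and> (\<forall>j. \<bar>vel (x, t) $ j\<bar> \<le> 2 / step_mass) \<and> (\<forall>j k. \<bar>dx j (\<lambda>z. vel z $ k) (x, t)\<bar> \<le> 2 / step_mass)"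
      using error_small[OF x, of t i] t LD dLD dx_vel_bound[OF x t3] by auto
  qed auto
  moreover have "(dx j (D i) (0, 4))^2 \<le> (\<Sum>j\<in>UNIV. (dx j (D i) (0, 4))^2)" by (rule member_le_sum) auto
  ultimately show ?thesis by linarith
qed

text \<open>
  The first row is accurate to order \<open>\<epsilon>\<close> and the others to order \<open>\<epsilon>^2\<close>, as required by \<open>det_negative\<close>.
\<close>

lemma gradient_close:
  shows "\<bar>sol.G 1 j (0, 4) - dx j (app 1) (0, 4)\<bar> \<le> \<epsilon> * gradient_const H"
    "i \<noteq> 1 \<Longrightarrow> \<bar>sol.G i j (0, 4) - dx j (app i) (0, 4)\<bar> \<le> \<epsilon>^2 * gradient_const H"
proof -
  note gradient_factor = gradient_factor_nonneg
  have dD: "sol.G i j (0, 4) - dx j (app i) (0, 4) = dx j (D i) (0, 4)" for i j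
    unfolding D_def[abs_def] sol.G_def
    by (subst sol.pos.dx_diff[OF _ sol.A_nth_smooth smooth_app[OF sol.pos.du]]) auto
  have sq: "2 * gradient_factor * (4 * H + 1)^2 + (3 + gradient_factor) * H^2 \<ge> 0" using gradient_factor by simp
  have e2: "\<epsilon>^2 \<le> \<epsilon>" using eps by (simp add: power2_eq_square)
  show "\<bar>sol.G 1 j (0, 4) - dx j (app 1) (0, 4)\<bar> \<le> \<epsilon> * gradient_const H"
  proof -
    have "4 * (\<epsilon> * H) + \<epsilon>^2 \<le> \<epsilon> * (4 * H + 1)" using e2 by (simp add: algebra_simps)
    then have s: "(4 * (\<epsilon> * H) + \<epsilon>^2)^2 \<le> (\<epsilon> * (4 * H + 1))^2" using eps H by (intro power_mono) auto
    have "(dx j (D 1) (0, 4))^2 \<le> gradient_factor * (\<epsilon> * (4 * H + 1))^2 + 3 * (\<epsilon> * H)^2 + gradient_factor * ((\<epsilon> * (4 * H + 1))^2 + (\<epsilon> * H)^2)"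
      using gradient_close_sq[of j 1] mult_left_mono[OF s gradient_factor] by (simp add: def_size_def distrib_left)
    also have "\<dots> = \<epsilon>^2 * (2 * gradient_factor * (4 * H + 1)^2 + (3 + gradient_factor) * H^2)" by (simp only: power_mult_distrib) algebra
    finally have "\<bar>dx j (D 1) (0, 4)\<bar> \<le> sqrt (\<epsilon>^2 * (2 * gradient_factor * (4 * H + 1)^2 + (3 + gradient_factor) * H^2))"
      by (simp add: real_le_rsqrt)
    then show ?thesis unfolding dD gradient_const_def real_sqrt_mult using eps by simp
  qed
  show "\<bar>sol.G i j (0, 4) - dx j (app i) (0, 4)\<bar> \<le> \<epsilon>^2 * gradient_const H" if i: "i \<noteq> 1"
  proof -
    have "(dx j (D i) (0, 4))^2 \<le> (\<epsilon>^2)^2 * (2 * gradient_factor)"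
      using gradient_close_sq[of j i] i by (simp add: def_size_def algebra_simps)
    also have "\<dots> \<le> (\<epsilon>^2)^2 * (2 * gradient_factor * (4 * H + 1)^2 + (3 + gradient_factor) * H^2)"
    proof (intro mult_left_mono)
      have "2 * gradient_factor * 1 \<le> 2 * gradient_factor * (4 * H + 1)^2" using gradient_factor H by (intro mult_left_mono) (auto simp: one_le_power)
      moreover have "0 \<le> (3 + gradient_factor) * H^2" using gradient_factor by simp
      ultimately show "2 * gradient_factor \<le> 2 * gradient_factor * (4 * H + 1)^2 + (3 + gradient_factor) * H^2" by simp
    qed simp
    finally have "\<bar>dx j (D i) (0, 4)\<bar> \<le> sqrt ((\<epsilon>^2)^2 * (2 * gradient_factor * (4 * H + 1)^2 + (3 + gradient_factor) * H^2))"
      by (simp add: real_le_rsqrt)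
    moreover have "sqrt ((\<epsilon>^2)^2) = \<epsilon>^2" by (rule real_sqrt_unique) auto
    ultimately show ?thesis unfolding dD gradient_const_def by (simp only: real_sqrt_mult)
  qed
qed

text \<open>
  The gradient is still the identity matrix at time \<open>1\<close>, and the intermediate value theorem applies on
  \<open>[1, 4]\<close>.
\<close>

lemma singular_time:
  assumes neg: "det (grad A (0, 4)) < 0"
  shows "\<exists>t>0. det (grad A (0, t)) = 0"
proof -
  define f where "f t = det (\<chi> i k. sol.G i k (0, t))" for t
  have f: "det (grad A (0, t)) = f t" if "t > 0" for t
  proof -
    have "(\<chi> i k. sol.G i k (0, t)) = grad A (0, t)" using sol.grad_A[OF that] by (simp add: vec_eq_iff)
    then show ?thesis by (simp add: f_def)
  qed
  have "continuous_on {1..4} (\<lambda>t. sol.G i k (0, t))" for i k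
    by (rule continuous_on_compose2[OF sol.G_continuous]) (auto intro!: continuous_intros)
  then have cont: "continuous_on {1..4} f"
    unfolding f_def det_3 vec_lambda_beta by (intro continuous_on_add continuous_on_diff continuous_on_mult)
  have "f 1 = 1" unfolding f_def det_3 vec_lambda_beta using sol.G_early[of 1] by (simp add: neq3)
  then obtain t where "1 \<le> t" "t \<le> 4" "f t = 0"
    using IVT2'[of f 4 0 1] cont neg f[of 4] by auto
  then show ?thesis using f[of t] by (intro exI[of _ t]) auto
qed

end

theorem theorem1p1:
  fixes \<nu> :: real
  assumes "\<nu> > 0"
  shows "\<exists>u :: (real ^ 3) \<times> real \<Rightarrow> real ^ 3.
    C0_infinity u \<and> divergence_free u \<and>
    (\<forall>A. smooth_solution_A \<nu> u A \<longrightarrow>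
      (\<exists>t>0.
        \<not> smoothly_invertible_at_origin (\<lambda>x. A (x, t)) \<and>
        (\<forall>Q. smooth_solution_Q \<nu> u A t Q \<longrightarrow>
          Limsup (at_left t) (\<lambda>\<tau>. Linfty_norm (\<lambda>x. Q (x, \<tau>))) = \<infinity>)))"
proof -
  interpret profile \<nu> by unfold_locales fact
  obtain H where H: "H \<ge> 0" "\<And>x t. 0 \<le> t \<Longrightarrow> t \<le> 4 \<Longrightarrow> \<bar>defect (x, t)\<bar> \<le> H" "\<And>x t j. 0 \<le> t \<Longrightarrow> t \<le> 4 \<Longrightarrow> \<bar>dx j defect (x, t)\<bar> \<le> H"
    using defect_bounds by blast
  obtain M where M: "M \<ge> 0" "\<forall>t\<in>{0..4}. \<bar>c0 t\<bar> \<le> M \<and> \<bar>c1 t\<bar> \<le> M \<and> \<bar>duhamel 1 t\<bar> \<le> M \<and> \<bar>duhamel 5 t\<bar> \<le> M \<and> \<bar>b t\<bar> \<le> M"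
    using profiles_bounded by blast
  define C where "C = gradient_const H"
  have C: "C \<ge> 0" unfolding C_def gradient_const_def using gradient_factor_nonneg by simp
  define X where "X = 1 - 4 * duhamel 5 4 / kappa"
  define Y where "Y = - 2 * c1 4 / kappa"
  have "X - b 4 * Y = 1 - 2 * E 4 / kappa" by (simp add: X_def Y_def E_def diff_divide_distrib right_diff_distrib)
  then have "X - b 4 * Y = - 1" using kappa_pos unfolding kappa_def[symmetric] by simp
  from det_negative[OF this C] obtain \<epsilon> where eps: "0 < \<epsilon>" "\<epsilon> \<le> 1" and neg: "\<And>G :: real^3^3.
    \<bar>G $ 1 $ 1 - X\<bar> \<le> \<epsilon> * C \<and> \<bar>G $ 1 $ 2 - Y / \<epsilon>\<bar> \<le> \<epsilon> * C \<and> \<bar>G $ 1 $ 3\<bar> \<le> \<epsilon> * C \<and>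
    \<bar>G $ 2 $ 1 - \<epsilon> * b 4\<bar> \<le> \<epsilon>^2 * C \<and> \<bar>G $ 2 $ 2 - 1\<bar> \<le> \<epsilon>^2 * C \<and> \<bar>G $ 2 $ 3\<bar> \<le> \<epsilon>^2 * C \<and>
    \<bar>G $ 3 $ 1\<bar> \<le> \<epsilon>^2 * C \<and> \<bar>G $ 3 $ 2\<bar> \<le> \<epsilon>^2 * C \<and> \<bar>G $ 3 $ 3 - 1\<bar> \<le> \<epsilon>^2 * C \<Longrightarrow> det G < 0" by blast
  \<comment> \<open>\<open>amp\<close> and \<open>vmax\<close> depend on \<open>\<epsilon>\<close> only; the radius 2 is a placeholder that allows to mention them before \<open>R\<close>\<close>
  interpret pre: construction \<nu> \<epsilon> 2 by unfold_locales (use eps in auto)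
  define R where "R = max 2 ((4 * pre.vmax + (5 * \<bar>pre.amp\<bar> + 2) * M + 1) * (5 + 24 * \<nu> + 24 * pre.vmax) / \<epsilon>^2)"
  interpret construction \<nu> \<epsilon> R by unfold_locales (use eps in \<open>auto simp: R_def\<close>)
  show ?thesis
  proof (intro exI[of _ vel] conjI allI impI)
    show "C0_infinity vel" by (rule C0_infinity_vel)
    show "divergence_free vel" by (rule divergence_free_vel)
    fix A assume A: "smooth_solution_A \<nu> vel A"
    interpret approximation \<nu> \<epsilon> R A H M
      by unfold_locales (use A H M in \<open>auto simp: R_def\<close>)
    have amp: "amp * \<epsilon>^2 = - 2 / kappa" "amp * \<epsilon> = - 2 / kappa / \<epsilon>"
      using eps by (simp_all add: amp_def power2_eq_square)
    have G: "grad A (0, 4) $ i $ j = sol.G i j (0, 4)" for i j by (rule sol.grad_A) simp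
    have "det (grad A (0, 4)) < 0"
    proof (rule neg)
      have "dx 1 (app 1) (0, 4) = X" "dx 2 (app 1) (0, 4) = Y / \<epsilon>"
        using dx_app_origin(1,2) unfolding amp X_def Y_def by simp_all
      then show "\<bar>grad A (0, 4) $ 1 $ 1 - X\<bar> \<le> \<epsilon> * C \<and> \<bar>grad A (0, 4) $ 1 $ 2 - Y / \<epsilon>\<bar> \<le> \<epsilon> * C \<and> \<bar>grad A (0, 4) $ 1 $ 3\<bar> \<le> \<epsilon> * C \<and>
        \<bar>grad A (0, 4) $ 2 $ 1 - \<epsilon> * b 4\<bar> \<le> \<epsilon>^2 * C \<and> \<bar>grad A (0, 4) $ 2 $ 2 - 1\<bar> \<le> \<epsilon>^2 * C \<and> \<bar>grad A (0, 4) $ 2 $ 3\<bar> \<le> \<epsilon>^2 * C \<and>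
        \<bar>grad A (0, 4) $ 3 $ 1\<bar> \<le> \<epsilon>^2 * C \<and> \<bar>grad A (0, 4) $ 3 $ 2\<bar> \<le> \<epsilon>^2 * C \<and> \<bar>grad A (0, 4) $ 3 $ 3 - 1\<bar> \<le> \<epsilon>^2 * C"
        using gradient_close(1)[of 1] gradient_close(1)[of 2] gradient_close(1)[of 3]
          gradient_close(2)[OF neq3(4), of 1] gradient_close(2)[OF neq3(4), of 2] gradient_close(2)[OF neq3(4), of 3]
          gradient_close(2)[OF neq3(5), of 1] gradient_close(2)[OF neq3(5), of 2] gradient_close(2)[OF neq3(5), of 3]
        unfolding G C_def dx_app_origin(3-9) by simp
    qed
    then obtain t where "t > 0" "det (grad A (0, t)) = 0" using singular_time by blast
    then show "\<exists>t>0. \<not> smoothly_invertible_at_origin (\<lambda>x. A (x, t)) \<and>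
        (\<forall>Q. smooth_solution_Q \<nu> vel A t Q \<longrightarrow> Limsup (at_left t) (\<lambda>\<tau>. Linfty_norm (\<lambda>x. Q (x, \<tau>))) = \<infinity>)"
      using sol.singular_gradient_conclusion by blast
  qed
qed

end
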